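(* Let $\mathbb{T}_{\mathcal C}$ be the projective Fraïssé limit of the family $\mathcal{T}_{\mathcal{C}}$. Then $E(\mathbb{T}_{\mathcal C})$ is transitive, and the topological realization $|\mathbb{T}_{\mathcal C}|$ is a Kelley dendroid (thus smooth) with a dense set of endpoints, such that each point of $|\mathbb{T}_{\mathcal C}|$ is either an endpoint or a ramification point in the classical sense.
   Context: Graphs are pairs $(V,E)$ with $E\subseteq V^2$ reflexive and symmetric; a topological graph has compact zero-dimensional second-countable vertex set and closed edge set. Trees: finite graphs with unique simple paths between distinct vertices; rooted trees have a root $r$ and order $x\le y$ iff the path from $r$ to $y$ contains $x$. Epimorphisms between rooted trees: vertex maps sending edges to edges, surjective on vertices and edges, root to root, order-preserving. Connected: not a union of two nonempty disjoint closed sets with no edges between. Confluent: for each closed connected $Q$ of the target every component $K$ of $f^{-1}(Q)$ has $f(K)=Q$; light: distinct vertices with the same image are never adjacent. Splitting edge map: replace an edge $\langle a,b\rangle$ ($a<b$) by $\langle a,x\rangle,\langle x,b\rangle$ with $x$ new, identity elsewhere, $x\mapsto a$ or $b$; adding edge map: add a new vertex $y$ and an edge $\langle v,y\rangle$, identity elsewhere, $y\mapsto v$. Simple*-confluent epimorphisms are finite compositions of splitting edge maps, adding edge maps and light confluent epimorphisms. $\mathcal T_{\mathcal C}$ is the projective Fraïssé family of rooted trees with at least two vertices and simple*-confluent epimorphisms. Its projective Fraïssé limit $\mathbb T_{\mathcal C}$ is the unique rooted topological graph that is an inverse limit $\varprojlim\{F_n,\alpha_n\}$ of members of $\mathcal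 T_{\mathcal C}$ with bonding maps in the family (edges coordinatewise) such that (i) every $A\in\mathcal T_{\mathcal C}$ is an image of $\mathbb T_{\mathcal C}$ under an admissible epimorphism, and (ii) for admissible $f\colon\mathbb T_{\mathcal C}\to A$ and $g\colon B\to A$ in the family there is admissible $h\colon\mathbb T_{\mathcal C}\to B$ with $f=g\circ h$, admissible meaning of the form $h'\circ\alpha^\infty_m$ with $h'$ in the family. When the edge relation is transitive, the topological realization is the quotient space $V/E$. A dendroid is a hereditarily unicoherent arcwise connected continuum; it is smooth if for some point $p$ the order ($x\le y$ iff every arc from $p$ to $y$ contains $x$) is closed. A continuum $X$ is Kelley if for every subcontinuum $K$, every $p\in K$ and every sequence $p_n\to p$ there are subcontinua $K_n\ni p_n$ converging to $K$ in the Hausdorff metric. An endpoint (classical sense) is a point that is an endpoint of every arc containing it; a ramification point (classical sense) is a point $p$ for which there are three arcs pairwise intersecting exactly in $\{p\}$. *)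

theory Defs
  imports "HOL-Analysis.Analysis"
begin

type_synonym rtree = "nat set \<times> (nat \<times> nat) set \<times> nat"

definition verts :: "rtree \<Rightarrow> nat set" where "verts T = fst T"
definition edges :: "rtree \<Rightarrow> (nat \<times> nat) set" where "edges T = fst (snd T)"
definition root :: "rtree \<Rightarrow> nat" where "root T = snd (snd T)"

definition is_graph :: "'a set \<Rightarrow> ('a \<times> 'a) set \<Rightarrow> bool" where
  "is_graph V E \<longleftrightarrow> E \<subseteq> V \<times> V \<and> (\<forall>v\<in>V. (v,v) \<in> E) \<and> (\<forall>a b. (a,b) \<in> E \<longrightarrow> (b,a) \<in> E)"

definition spath :: "rtree \<Rightarrow> nat \<Rightarrow> nat \<Rightarrow> nat list \<Rightarrow> bool" where
  "spath T a b p \<longleftrightarrow> p \<noteq> [] \<and> hd p = a \<and> last p = b \<and> distinct p \<and> set p \<subseteq> verts T \<and>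
     (\<forall>i. Suc i < length p \<longrightarrow> (p ! i, p ! Suc i) \<in> edges T)"

definition is_tree :: "rtree \<Rightarrow> bool" where
  "is_tree T \<longleftrightarrow> finite (verts T) \<and> is_graph (verts T) (edges T) \<and>
     (\<forall>a\<in>verts T. \<forall>b\<in>verts T. a \<noteq> b \<longrightarrow> (\<exists>!p. spath T a b p))"

definition rooted_tree :: "rtree \<Rightarrow> bool" where
  "rooted_tree T \<longleftrightarrow> is_tree T \<and> root T \<in> verts T"

definition tle :: "rtree \<Rightarrow> nat \<Rightarrow> nat \<Rightarrow> bool" where
  "tle T x y \<longleftrightarrow> x \<in> verts T \<and> y \<in> verts T \<and> (\<forall>p. spath T (root T) y p \<longrightarrow> x \<in> set p)"

definition epi :: "rtree \<Rightarrow> rtree \<Rightarrow> (nat \<Rightarrow> nat) \<Rightarrow> bool" where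
  "epi A B f \<longleftrightarrow> f ` verts A = verts B \<and>
     (\<lambda>(a,b). (f a, f b)) ` edges A = edges B \<and>
     f (root A) = root B \<and>
     (\<forall>x y. tle A x y \<longrightarrow> tle B (f x) (f y))"

definition gconnected :: "rtree \<Rightarrow> nat set \<Rightarrow> bool" where
  "gconnected T Q \<longleftrightarrow> Q \<subseteq> verts T \<and>
     \<not> (\<exists>A B. A \<noteq> {} \<and> B \<noteq> {} \<and> A \<inter> B = {} \<and> A \<union> B = Q \<and>
            (\<forall>a\<in>A. \<forall>b\<in>B. (a,b) \<notin> edges T))"

definition gcomponent :: "rtree \<Rightarrow> nat set \<Rightarrow> nat set \<Rightarrow> bool" where
  "gcomponent T S K \<longleftrightarrow> K \<subseteq> S \<and> K \<noteq> {} \<and> gconnected T K \<and>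
     (\<forall>K'. K \<subseteq> K' \<and> K' \<subseteq> S \<and> gconnected T K' \<longrightarrow> K' = K)"

definition confluent :: "rtree \<Rightarrow> rtree \<Rightarrow> (nat \<Rightarrow> nat) \<Rightarrow> bool" where
  "confluent A B f \<longleftrightarrow> (\<forall>Q. gconnected B Q \<longrightarrow>
     (\<forall>K. gcomponent A {v \<in> verts A. f v \<in> Q} K \<longrightarrow> f ` K = Q))"

definition light :: "rtree \<Rightarrow> (nat \<Rightarrow> nat) \<Rightarrow> bool" where
  "light A f \<longleftrightarrow> (\<forall>a\<in>verts A. \<forall>b\<in>verts A. a \<noteq> b \<and> f a = f b \<longrightarrow> (a,b) \<notin> edges A)"

definition split_map :: "rtree \<Rightarrow> rtree \<Rightarrow> (nat \<Rightarrow> nat) \<Rightarrow> bool" where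
  "split_map T' T f \<longleftrightarrow> (\<exists>a b x. (a,b) \<in> edges T \<and> tle T a b \<and> a \<noteq> b \<and> x \<notin> verts T \<and>
     verts T' = insert x (verts T) \<and>
     edges T' = (edges T - {(a,b),(b,a)}) \<union> {(a,x),(x,a),(x,b),(b,x),(x,x)} \<and>
     root T' = root T \<and> (\<forall>v\<in>verts T. f v = v) \<and> (f x = a \<or> f x = b))"

definition add_map :: "rtree \<Rightarrow> rtree \<Rightarrow> (nat \<Rightarrow> nat) \<Rightarrow> bool" where
  "add_map T' T f \<longleftrightarrow> (\<exists>v y. v \<in> verts T \<and> y \<notin> verts T \<and>
     verts T' = insert y (verts T) \<and>
     edges T' = edges T \<union> {(v,y),(y,v),(y,y)} \<and>
     root T' = root T \<and> (\<forall>u\<in>verts T. f u = u) \<and> f y = v)"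

text \<open>simple*-confluent epimorphisms: finite compositions of the three kinds of maps
  (maps are identified when they agree on the vertex set of the domain)\<close>
inductive sc_epi :: "rtree \<Rightarrow> rtree \<Rightarrow> (nat \<Rightarrow> nat) \<Rightarrow> bool" where
  lc: "rooted_tree A \<Longrightarrow> rooted_tree B \<Longrightarrow> epi A B f \<Longrightarrow> light A f \<Longrightarrow> confluent A B f \<Longrightarrow> sc_epi A B f"
| split: "rooted_tree T \<Longrightarrow> split_map T' T f \<Longrightarrow> sc_epi T' T f"
| add: "rooted_tree T \<Longrightarrow> add_map T' T f \<Longrightarrow> sc_epi T' T f"
| comp: "sc_epi A B f \<Longrightarrow> sc_epi B C g \<Longrightarrow> sc_epi A C (g \<circ> f)"
| cong: "sc_epi A B f \<Longrightarrow> (\<forall>v\<in>verts A. g v = f v) \<Longrightarrow> sc_epi A B g"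

definition in_TC :: "rtree \<Rightarrow> bool" where
  "in_TC T \<longleftrightarrow> rooted_tree T \<and> card (verts T) \<ge> 2"

definition lim_verts :: "(nat \<Rightarrow> rtree) \<Rightarrow> (nat \<Rightarrow> nat \<Rightarrow> nat) \<Rightarrow> (nat \<Rightarrow> nat) set" where
  "lim_verts F \<alpha> = {x. \<forall>n. x n \<in> verts (F n) \<and> \<alpha> n (x (Suc n)) = x n}"

definition lim_edges :: "(nat \<Rightarrow> rtree) \<Rightarrow> (nat \<Rightarrow> nat \<Rightarrow> nat) \<Rightarrow> ((nat \<Rightarrow> nat) \<times> (nat \<Rightarrow> nat)) set" where
  "lim_edges F \<alpha> = {(x,y). x \<in> lim_verts F \<alpha> \<and> y \<in> lim_verts F \<alpha> \<and> (\<forall>n. (x n, y n) \<in> edges (F n))}"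

definition lim_top :: "(nat \<Rightarrow> rtree) \<Rightarrow> (nat \<Rightarrow> nat \<Rightarrow> nat) \<Rightarrow> (nat \<Rightarrow> nat) topology" where
  "lim_top F \<alpha> = subtopology (product_topology (\<lambda>n. discrete_topology (verts (F n))) UNIV) (lim_verts F \<alpha>)"

definition admissible :: "(nat \<Rightarrow> rtree) \<Rightarrow> (nat \<Rightarrow> nat \<Rightarrow> nat) \<Rightarrow> rtree \<Rightarrow> ((nat \<Rightarrow> nat) \<Rightarrow> nat) \<Rightarrow> bool" where
  "admissible F \<alpha> A h \<longleftrightarrow> (\<exists>m h'. sc_epi (F m) A h' \<and> (\<forall>x\<in>lim_verts F \<alpha>. h x = h' (x m)))"

definition is_TC_limit :: "(nat \<Rightarrow> rtree) \<Rightarrow> (nat \<Rightarrow> nat \<Rightarrow> nat) \<Rightarrow> bool" where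
  "is_TC_limit F \<alpha> \<longleftrightarrow>
     (\<forall>n. in_TC (F n)) \<and> (\<forall>n. sc_epi (F (Suc n)) (F n) (\<alpha> n)) \<and>
     (\<forall>A. in_TC A \<longrightarrow> (\<exists>h. admissible F \<alpha> A h)) \<and>
     (\<forall>A B f g. in_TC A \<and> in_TC B \<and> admissible F \<alpha> A f \<and> sc_epi B A g \<longrightarrow>
        (\<exists>h. admissible F \<alpha> B h \<and> (\<forall>x\<in>lim_verts F \<alpha>. f x = g (h x))))"

definition quotient_top :: "'a topology \<Rightarrow> ('a \<times> 'a) set \<Rightarrow> 'a set topology" where
  "quotient_top X R = topology (\<lambda>U. U \<subseteq> topspace X // R \<and> openin X (\<Union>U))"

definition realization :: "(nat \<Rightarrow> rtree) \<Rightarrow> (nat \<Rightarrow> nat \<Rightarrow> nat) \<Rightarrow> (nat \<Rightarrow> nat) set topology" where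
  "realization F \<alpha> = quotient_top (lim_top F \<alpha>) (lim_edges F \<alpha>)"

definition continuum :: "'a topology \<Rightarrow> bool" where
  "continuum X \<longleftrightarrow> topspace X \<noteq> {} \<and> compact_space X \<and> connected_space X \<and> metrizable_space X"

definition subcontinuum :: "'a topology \<Rightarrow> 'a set \<Rightarrow> bool" where
  "subcontinuum X K \<longleftrightarrow> K \<subseteq> topspace X \<and> continuum (subtopology X K)"

definition arc_param :: "'a topology \<Rightarrow> 'a set \<Rightarrow> (real \<Rightarrow> 'a) \<Rightarrow> bool" where
  "arc_param X A g \<longleftrightarrow> A \<subseteq> topspace X \<and> homeomorphic_map (top_of_set {0..1}) (subtopology X A) g"

definition is_arc :: "'a topology \<Rightarrow> 'a set \<Rightarrow> bool" where
  "is_arc X A \<longleftrightarrow> (\<exists>g. arc_param X A g)"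

definition arc_from :: "'a topology \<Rightarrow> 'a \<Rightarrow> 'a \<Rightarrow> 'a set \<Rightarrow> bool" where
  "arc_from X p q A \<longleftrightarrow> (p = q \<and> p \<in> topspace X \<and> A = {p}) \<or>
     (p \<noteq> q \<and> (\<exists>g. arc_param X A g \<and> g 0 = p \<and> g 1 = q))"

definition arcwise_connected_sp :: "'a topology \<Rightarrow> bool" where
  "arcwise_connected_sp X \<longleftrightarrow> (\<forall>p\<in>topspace X. \<forall>q\<in>topspace X. p \<noteq> q \<longrightarrow> (\<exists>A. arc_from X p q A))"

definition hered_unicoherent :: "'a topology \<Rightarrow> bool" where
  "hered_unicoherent X \<longleftrightarrow> (\<forall>K L. subcontinuum X K \<and> subcontinuum X L \<longrightarrow> connectedin X (K \<inter> L))"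

definition dendroid :: "'a topology \<Rightarrow> bool" where
  "dendroid X \<longleftrightarrow> continuum X \<and> hered_unicoherent X \<and> arcwise_connected_sp X"

definition smooth_dendroid :: "'a topology \<Rightarrow> bool" where
  "smooth_dendroid X \<longleftrightarrow> dendroid X \<and> (\<exists>p\<in>topspace X.
     closedin (prod_topology X X)
       {(x,y). x \<in> topspace X \<and> y \<in> topspace X \<and> (\<forall>A. arc_from X p y A \<longrightarrow> x \<in> A)})"

definition hausdist :: "('a \<Rightarrow> 'a \<Rightarrow> real) \<Rightarrow> 'a set \<Rightarrow> 'a set \<Rightarrow> real" where
  "hausdist d A B = max (SUP a\<in>A. INF b\<in>B. d a b) (SUP b\<in>B. INF a\<in>A. d a b)"

definition kelley :: "'a topology \<Rightarrow> bool" where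
  "kelley X \<longleftrightarrow> continuum X \<and>
    (\<forall>d. Metric_space (topspace X) d \<and> Metric_space.mtopology (topspace X) d = X \<longrightarrow>
      (\<forall>K p pn. subcontinuum X K \<and> p \<in> K \<and> range pn \<subseteq> topspace X \<and> limitin X pn p sequentially \<longrightarrow>
         (\<exists>Kn. (\<forall>n. subcontinuum X (Kn n) \<and> pn n \<in> Kn n) \<and>
               (\<lambda>n. hausdist d (Kn n) K) \<longlonglongrightarrow> 0)))"

definition endpoint :: "'a topology \<Rightarrow> 'a \<Rightarrow> bool" where
  "endpoint X p \<longleftrightarrow> p \<in> topspace X \<and> (\<forall>A g. arc_param X A g \<and> p \<in> A \<longrightarrow> p = g 0 \<or> p = g 1)"

definition ramification_point :: "'a topology \<Rightarrow> 'a \<Rightarrow> bool" where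
  "ramification_point X p \<longleftrightarrow> p \<in> topspace X \<and> (\<exists>A1 A2 A3. is_arc X A1 \<and> is_arc X A2 \<and> is_arc X A3 \<and>
     A1 \<inter> A2 = {p} \<and> A1 \<inter> A3 = {p} \<and> A2 \<inter> A3 = {p})"

end

theory Submission
  imports Defs
begin

text \<open>Let \<open>L\<close> be the inverse limit with the coordinatewise order and \<open>q\<close> the quotient map by the edge relation.
  The extension property is used only in this form: every simple*-confluent \<open>g\<close> from a tree \<open>B\<close> to \<open>F n\<close> is a
  factor of some bonding map into \<open>F n\<close>. If \<open>g\<close> splits an edge, this shows that edge classes in \<open>L\<close> have at
  most two points; splitting repeatedly and interpolating, functions on \<open>F n\<close> extend approximately to continuous
  edge-invariant functions on \<open>L\<close>. These embed the quotient into a countable power of the reals and yield a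
  height that increases strictly along the order modulo edges, so order intervals become arcs; hereditary
  unicoherence comes from intersecting subtrees level by level. As bonding maps are confluent, the image of a
  subcontinuum in \<open>F n\<close> is also the image of a subcontinuum through any prescribed point over it, which is the
  Kelley property. If \<open>g\<close> adds a leaf, we see that maximal threads, which are end points, are dense. If \<open>g\<close>
  folds two copies of the part of \<open>F n\<close> above a vertex, we see that, above a thread \<open>x\<close> that is not maximal,
  the threads which leave a given one exactly at \<open>x\<close> form a residual set, which produces a triod at \<open>q x\<close>.\<close>

text \<open>A simple*-confluent map lifts connected sets, preserves the order and descends at most
  one edge when its argument does. Composition keeps all this, so the kinds of generators need not
  be told apart afterwards. The obstacle is that a single \<open>F n\<close> does not show the
  limit: a vertex may have many children, whereas a thread with an adjacent upper neighbour has only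
  that one way up. Such facts are found by testing \<open>F n\<close> against one modified tree and
  reading off where the factor map sends the threads. A point of the quotient is represented by the
  upper thread of its class, since only then does moving strictly up leave the class. The height is
  strict modulo edges because non-adjacent comparable vertices differ in height by at least 2, while
  extending a function with steps at most 1 costs at most 1/2, the sum of the powers of 1/3.
  Smoothness is not deduced from the Kelley property: segments from the root thread lie in every arc
  with the same ends, so the order of the quotient is the image of the compact order on
  threads.\<close>

section \<open>Simple paths, parents, heights and the order of a rooted tree\<close>

lemma spath_iff:
  "spath T a b p \<longleftrightarrow> p \<noteq> [] \<and> hd p = a \<and> last p = b \<and> distinct p \<and> set p \<subseteq> verts T \<and>
     successively (\<lambda>x y. (x, y) \<in> edges T) p"
  by (auto simp: spath_def successively_conv_nth)

lemma spath_refl_iff: "spath T a a p \<longleftrightarrow> p = [a] \<and> a \<in> verts T"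
proof
  assume p: "spath T a a p"
  then obtain xs where xs: "p = a # xs"
    by (metis spath_def list.collapse)
  moreover have "xs = []"
    using p unfolding spath_def xs by (metis distinct.simps(2) last_ConsR last_in_set)
  ultimately show "p = [a] \<and> a \<in> verts T"
    using p by (auto simp: spath_def)
qed (auto simp: spath_def)

lemma spath_snoc:
  "p \<noteq> [] \<Longrightarrow> spath T a b (p @ [b']) \<longleftrightarrow>
     b' = b \<and> spath T a (last p) p \<and> b \<notin> set p \<and> b \<in> verts T \<and> (last p, b) \<in> edges T"
  by (auto simp: spath_iff successively_append_iff)

lemma spath_append:
  "p \<noteq> [] \<Longrightarrow> spath T a b (p @ q) \<Longrightarrow> spath T a (last p) p"
  by (auto simp: spath_iff successively_append_iff)

definition rpath :: "rtree \<Rightarrow> nat \<Rightarrow> nat list" where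
  "rpath T v = (THE p. spath T (root T) v p)"

text \<open>The root is its own parent. Since all loops are edges, \<open>edges_iff\<close> then
  needs no exception for the root.\<close>

definition par :: "rtree \<Rightarrow> nat \<Rightarrow> nat" where
  "par T v = (if v = root T then v else last (butlast (rpath T v)))"

definition ht :: "rtree \<Rightarrow> nat \<Rightarrow> nat" where
  "ht T v = length (rpath T v)"

lemma rooted_treeD:
  assumes "rooted_tree T"
  shows "finite (verts T)" "root T \<in> verts T"
    "\<And>a b. (a, b) \<in> edges T \<Longrightarrow> a \<in> verts T" "\<And>a b. (a, b) \<in> edges T \<Longrightarrow> b \<in> verts T"
    "\<And>a b. (a, b) \<in> edges T \<Longrightarrow> (b, a) \<in> edges T" "\<And>a. a \<in> verts T \<Longrightarrow> (a, a) \<in> edges T"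
  using assms by (auto simp: rooted_tree_def is_tree_def is_graph_def)

lemma rpath_ex1:
  assumes "rooted_tree T" "v \<in> verts T"
  shows "\<exists>!p. spath T (root T) v p"
  using assms by (cases "v = root T") (auto simp: rooted_tree_def is_tree_def spath_refl_iff)

lemma rpath_spath: "rooted_tree T \<Longrightarrow> v \<in> verts T \<Longrightarrow> spath T (root T) v (rpath T v)"
  unfolding rpath_def by (rule theI') (rule rpath_ex1)

lemma rpath_unique: "rooted_tree T \<Longrightarrow> spath T (root T) v p \<Longrightarrow> rpath T v = p"
  by (metis last_in_set rpath_ex1 rpath_spath spath_def subsetD)

text \<open>If \<open>v\<close> is not on the root path of \<open>u\<close>, appending it gives the
  root path of \<open>v\<close>. Otherwise the part of that path up to \<open>v\<close> is the root
  path of \<open>v\<close>, and appending \<open>u\<close> to this part must give back the whole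
  path. Uniqueness of root paths is used both times.\<close>

lemma rpath_edge:
  assumes T: "rooted_tree T" and e: "(u, v) \<in> edges T" "u \<noteq> v"
  shows "rpath T v = rpath T u @ [v] \<or> rpath T u = rpath T v @ [u]"
proof (cases "v \<in> set (rpath T u)")
  case False
  have "spath T (root T) u (rpath T u)"
    using T e rooted_treeD rpath_spath by blast
  then have "spath T (root T) v (rpath T u @ [v])"
    using False e rooted_treeD[OF T] by (auto simp: spath_iff successively_append_iff)
  then show ?thesis
    using rpath_unique[OF T] by blast
next
  case True
  then obtain xs ys where xs: "rpath T u = xs @ v # ys"
    by (auto simp: in_set_conv_decomp)
  have u: "spath T (root T) u (rpath T u)"
    using T e rooted_treeD rpath_spath by blast
  then have v: "rpath T v = xs @ [v]"
    using spath_append[of "xs @ [v]" T "root T" u ys] xs rpath_unique[OF T, of v "xs @ [v]"] by auto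
  have "last (rpath T u) = u" "distinct (rpath T u)"
    using u by (auto simp: spath_def)
  then have "u \<notin> set (xs @ [v])"
    unfolding xs using e(2) by (auto split: if_splits)
  moreover have "spath T (root T) v (rpath T v)"
    using T e rooted_treeD rpath_spath by blast
  ultimately have "spath T (root T) u (rpath T v @ [u])"
    using e rooted_treeD[OF T] spath_snoc[of "rpath T v" T "root T" u u] by (auto simp: v spath_def)
  then show ?thesis
    using rpath_unique[OF T] by blast
qed

lemma rpath_root: "rooted_tree T \<Longrightarrow> rpath T (root T) = [root T]"
  by (rule rpath_unique) (auto simp: spath_refl_iff rooted_treeD)

lemma par_root [simp]: "par T (root T) = root T"
  by (simp add: par_def)

lemma rpath_par:
  assumes T: "rooted_tree T" and v: "v \<in> verts T" "v \<noteq> root T"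
  shows "rpath T v = rpath T (par T v) @ [v]" "(par T v, v) \<in> edges T"
proof -
  let ?p = "rpath T v"
  have p: "spath T (root T) v ?p" using T v(1) by (rule rpath_spath)
  have pv: "?p = butlast ?p @ [v]"
    using p by (metis append_butlast_last_id spath_def)
  have ne: "butlast ?p \<noteq> []"
    using p v(2) pv by (metis append_Nil list.sel(1) spath_def)
  have "par T v = last (butlast ?p)" using v by (simp add: par_def)
  then have "spath T (root T) (par T v) (butlast ?p)" "(par T v, v) \<in> edges T"
    using p pv spath_snoc[OF ne, of T "root T" v v] by auto
  then show "rpath T v = rpath T (par T v) @ [v]" "(par T v, v) \<in> edges T"
    using rpath_unique[OF T] pv by auto
qed

lemma par_in: "rooted_tree T \<Longrightarrow> v \<in> verts T \<Longrightarrow> par T v \<in> verts T"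
  using rpath_par(2)[of T v] rooted_treeD(3)[of T] by (cases "v = root T") auto

lemma ht_par: "rooted_tree T \<Longrightarrow> v \<in> verts T \<Longrightarrow> v \<noteq> root T \<Longrightarrow> ht T v = Suc (ht T (par T v))"
  unfolding ht_def using rpath_par(1) by (metis length_append_singleton)

lemma edges_iff:
  assumes T: "rooted_tree T"
  shows "(u, v) \<in> edges T \<longleftrightarrow> u \<in> verts T \<and> v \<in> verts T \<and> (u = v \<or> u = par T v \<or> v = par T u)"
proof
  assume e: "(u, v) \<in> edges T"
  have "u = par T v \<or> v = par T u" if "u \<noteq> v"
  proof -
    have uv: "rpath T u \<noteq> []" "rpath T v \<noteq> []" "last (rpath T u) = u" "last (rpath T v) = v"
      using rpath_spath[OF T, of u] rpath_spath[OF T, of v] rooted_treeD(3,4)[OF T e] by (auto simp: spath_def)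
    from rpath_edge[OF T e that] uv show ?thesis
      by (auto simp: par_def rpath_root[OF T])
  qed
  then show "u \<in> verts T \<and> v \<in> verts T \<and> (u = v \<or> u = par T v \<or> v = par T u)"
    using rooted_treeD[OF T] e by blast
next
  assume *: "u \<in> verts T \<and> v \<in> verts T \<and> (u = v \<or> u = par T v \<or> v = par T u)"
  then show "(u, v) \<in> edges T"
    using rpath_par(2)[OF T] rooted_treeD[OF T] by (metis par_root)
qed

lemma tle_rpath: "rooted_tree T \<Longrightarrow> tle T x y \<longleftrightarrow> x \<in> verts T \<and> y \<in> verts T \<and> x \<in> set (rpath T y)"
  unfolding tle_def using rpath_spath rpath_unique by metis

lemma tleD: "tle T x y \<Longrightarrow> x \<in> verts T" "tle T x y \<Longrightarrow> y \<in> verts T"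
  by (auto simp: tle_def)

lemma tle_refl: "x \<in> verts T \<Longrightarrow> tle T x x"
  by (auto simp: tle_def spath_def)

lemma tle_root_iff: "rooted_tree T \<Longrightarrow> tle T x (root T) \<longleftrightarrow> x = root T"
  by (auto simp: tle_rpath rpath_root rooted_treeD)

lemma tle_par_iff:
  assumes T: "rooted_tree T"
  shows "tle T x y \<longleftrightarrow> x \<in> verts T \<and> y \<in> verts T \<and> (x = y \<or> (y \<noteq> root T \<and> tle T x (par T y)))"
proof (cases "y \<in> verts T \<and> y \<noteq> root T")
  case True
  then have "set (rpath T y) = insert y (set (rpath T (par T y)))"
    by (subst rpath_par(1)[OF T]) auto
  then show ?thesis
    using True by (auto simp: tle_rpath[OF T] par_in[OF T])
next
  case False
  then show ?thesis
    using rooted_treeD(2)[OF T] by (auto simp: tle_root_iff[OF T] dest: tleD)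
qed

lemma tle_par: "rooted_tree T \<Longrightarrow> v \<in> verts T \<Longrightarrow> tle T (par T v) v"
  by (metis par_in par_root tle_par_iff tle_refl)

lemma tree_induct [consumes 2, case_names root par]:
  assumes T: "rooted_tree T" and v: "v \<in> verts T"
    and r: "P (root T)" and s: "\<And>v. v \<in> verts T \<Longrightarrow> v \<noteq> root T \<Longrightarrow> P (par T v) \<Longrightarrow> P v"
  shows "P v"
  using v
proof (induction "ht T v" arbitrary: v rule: less_induct)
  case less
  then show ?case
    using r s ht_par[OF T less.prems] par_in[OF T less.prems] by (cases "v = root T") auto
qed

lemma tle_root:
  assumes T: "rooted_tree T" and v: "v \<in> verts T"
  shows "tle T (root T) v"
  using T v
proof (induction v rule: tree_induct)
  case root
  then show ?case by (simp add: tle_refl rooted_treeD[OF T])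
next
  case (par v)
  then show ?case using tle_par_iff[OF T] tleD(1) by blast
qed

lemma tle_trans:
  assumes T: "rooted_tree T" and xy: "tle T x y" and yz: "tle T y z"
  shows "tle T x z"
proof -
  have "z \<in> verts T" using yz by (rule tleD)
  with T show ?thesis using yz
  proof (induction z rule: tree_induct)
    case root
    then show ?case using xy by (simp add: tle_root_iff[OF T])
  next
    case (par v)
    then show ?case using xy tle_par_iff[OF T, of y v] tle_par_iff[OF T, of x v] tleD by blast
  qed
qed

lemma tle_ht:
  assumes T: "rooted_tree T" and xy: "tle T x y"
  shows "x = y \<or> ht T x < ht T y"
proof -
  have "y \<in> verts T" using xy by (rule tleD)
  with T show ?thesis using xy
  proof (induction y rule: tree_induct)
    case root
    then show ?case by (simp add: tle_root_iff[OF T])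
  next
    case (par v)
    then show ?case using tle_par_iff[OF T, of x v] ht_par[OF T, of v] by force
  qed
qed

lemma tle_antisym: "rooted_tree T \<Longrightarrow> tle T x y \<Longrightarrow> tle T y x \<Longrightarrow> x = y"
  by (metis less_asym tle_ht)

lemma tle_ht_le: "rooted_tree T \<Longrightarrow> tle T x y \<Longrightarrow> ht T x \<le> ht T y"
  using tle_ht by fastforce

lemma tle_chain:
  assumes T: "rooted_tree T" and xz: "tle T x z" and yz: "tle T y z"
  shows "tle T x y \<or> tle T y x"
proof -
  have "z \<in> verts T" using xz by (rule tleD)
  with T show ?thesis using xz yz
  proof (induction z rule: tree_induct)
    case root
    then show ?case by (simp add: tle_root_iff[OF T])
  next
    case (par v)
    then show ?case using tle_par_iff[OF T, of x v] tle_par_iff[OF T, of y v] by metis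
  qed
qed

lemma par_neq: "rooted_tree T \<Longrightarrow> v \<in> verts T \<Longrightarrow> v \<noteq> root T \<Longrightarrow> par T v \<noteq> v"
  using ht_par by fastforce

lemma tle_lt_par:
  "rooted_tree T \<Longrightarrow> tle T x y \<Longrightarrow> x \<noteq> y \<Longrightarrow> y \<noteq> root T \<and> tle T x (par T y)"
  using tle_par_iff by blast

lemma tle_edge:
  assumes T: "rooted_tree T" shows "tle T x y \<Longrightarrow> (x, y) \<in> edges T \<Longrightarrow> x = y \<or> (y \<noteq> root T \<and> x = par T y)"
  unfolding edges_iff[OF T] by (metis T tle_antisym tle_par tle_root_iff)

lemma edge_comparable: "rooted_tree T \<Longrightarrow> (x, y) \<in> edges T \<Longrightarrow> tle T x y \<or> tle T y x"
  by (metis edges_iff tle_par tle_refl)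

subsection \<open>Trees from parent functions\<close>

text \<open>Carries uniqueness of the paths into a new leaf over to the paths out of it.\<close>

lemma ex1_rev:
  assumes "\<exists>!p. P p" "\<And>p. P p \<Longrightarrow> Q (rev p)" "\<And>p. Q p \<Longrightarrow> P (rev p)"
  shows "\<exists>!p. Q p"
  using assms by (metis rev_rev_ident)

text \<open>A path between old vertices cannot visit \<open>y\<close>, whose only other neighbour is
  \<open>v\<close>, and a path ending in \<open>y\<close> is an old path to \<open>v\<close>
  prolonged by \<open>y\<close>. So uniqueness of paths is inherited.\<close>

lemma rooted_tree_add_leaf:
  assumes T: "rooted_tree T" and v: "v \<in> verts T" and y: "y \<notin> verts T"
    and V: "verts T' = insert y (verts T)"
    and E: "edges T' = edges T \<union> {(v, y), (y, v), (y, y)}"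
    and R: "root T' = root T"
  shows "rooted_tree T'"
proof -
  note TD = rooted_treeD[OF T]
  have "is_graph (verts T) (edges T)"
    using T by (simp add: rooted_tree_def is_tree_def)
  then have g: "is_graph (verts T') (edges T')"
    unfolding is_graph_def V E using v by auto
  have sym: "\<And>a b. (a, b) \<in> edges T' \<Longrightarrow> (b, a) \<in> edges T'"
    using g unfolding is_graph_def by blast
  have y_edge: "\<And>u. (u, y) \<in> edges T' \<Longrightarrow> u \<noteq> y \<Longrightarrow> u = v"
    unfolding E using TD(3,4) y by blast
  have old: "spath T' a b p \<longleftrightarrow> spath T a b p" if ab: "a \<in> verts T" "b \<in> verts T" for a b p
  proof
    assume "spath T a b p"
    then show "spath T' a b p"
      unfolding spath_def V E by blast
  next
    assume p: "spath T' a b p"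
    \<comment> \<open>The ends of the path are old vertices, and in its interior \<open>y\<close>
      would have two distinct neighbours besides itself.\<close>
    have "y \<notin> set p"
    proof
      assume "y \<in> set p"
      then obtain i where i: "i < length p" "p ! i = y" by (auto simp: in_set_conv_nth)
      have "i \<noteq> 0" using i p ab y unfolding spath_def by (metis hd_conv_nth)
      then obtain j where j: "i = Suc j" by (cases i) auto
      have "Suc i \<noteq> length p"
      proof
        assume "Suc i = length p"
        then have "i = length p - 1" by simp
        then show False using i p ab y unfolding spath_def by (metis last_conv_nth)
      qed
      then have l: "Suc i < length p" using i by simp
      have e: "(p ! j, y) \<in> edges T'" "(y, p ! Suc i) \<in> edges T'"
        using p i j l unfolding spath_def by auto
      have d: "p ! j \<noteq> y" "p ! Suc i \<noteq> y" "p ! j \<noteq> p ! Suc i"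
        using p i j l unfolding spath_def
        by (simp_all add: nth_eq_iff_index_eq flip: i(2))
      show False
        using y_edge[OF e(1) d(1)] y_edge[OF sym[OF e(2)] d(2)] d(3) by simp
    qed
    then have sub: "set p \<subseteq> verts T" using p V by (auto simp: spath_def)
    have "(p ! i, p ! Suc i) \<in> edges T" if "Suc i < length p" for i
    proof -
      have "p ! i \<in> set p" "p ! Suc i \<in> set p" using that by simp_all
      then have "p ! i \<noteq> y" "p ! Suc i \<noteq> y" using \<open>y \<notin> set p\<close> by metis+
      moreover have "(p ! i, p ! Suc i) \<in> edges T'" using p that by (simp add: spath_def)
      ultimately show ?thesis unfolding E by blast
    qed
    then show "spath T a b p"
      using p sub by (simp add: spath_def)
  qed
  have new: "spath T' a y p \<longleftrightarrow> (\<exists>p'. p = p' @ [y] \<and> spath T a v p')" if a: "a \<in> verts T" for a p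
  proof
    assume p: "spath T' a y p"
    then have pe: "p = butlast p @ [y]" by (metis append_butlast_last_id spath_def)
    have ne: "butlast p \<noteq> []"
      using p a y pe by (metis append_Nil list.sel(1) spath_def)
    have *: "spath T' a (last (butlast p)) (butlast p)" "y \<notin> set (butlast p)" "(last (butlast p), y) \<in> edges T'"
      using spath_snoc[OF ne, of T' a y y] p pe by auto
    then have "last (butlast p) = v"
      using y_edge ne last_in_set by metis
    then show "\<exists>p'. p = p' @ [y] \<and> spath T a v p'"
      using * old[OF a v] pe by auto
  next
    assume "\<exists>p'. p = p' @ [y] \<and> spath T a v p'"
    then obtain p' where p': "p = p' @ [y]" "spath T a v p'" by blast
    then have "p' \<noteq> []" "last p' = v" "y \<notin> set p'" using y by (auto simp: spath_def)
    then show "spath T' a y p"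
      using p' old[OF a v, of p'] spath_snoc[of p' T' a y y] V E by auto
  qed
  have T1: "\<exists>!p. spath T a b p" if "a \<in> verts T" "b \<in> verts T" for a b
    using T that by (cases "a = b") (auto simp: rooted_tree_def is_tree_def spath_refl_iff)
  have ay: "\<exists>!p. spath T' a y p" if "a \<in> verts T" for a
    unfolding new[OF that] using T1[OF that v] by auto
  have rev: "spath T' b a (rev p)" if "spath T' a b p" for a b p
  proof -
    have "successively (\<lambda>x y. (y, x) \<in> edges T') p"
      using that sym unfolding spath_iff by (metis (mono_tags, lifting) successively_mono)
    then show ?thesis
      using that unfolding spath_iff by (simp add: hd_rev last_rev)
  qed
  have ya: "\<exists>!p. spath T' y a p" if "a \<in> verts T" for a
    by (rule ex1_rev[OF ay[OF that]]) (erule rev)+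
  have "\<exists>!p. spath T' a b p" if "a \<in> verts T'" "b \<in> verts T'" "a \<noteq> b" for a b
    using that T1 old ay ya unfolding V by (metis insert_iff)
  then show ?thesis
    unfolding rooted_tree_def is_tree_def using g TD V R by auto
qed

definition par_edges :: "nat set \<Rightarrow> nat \<Rightarrow> (nat \<Rightarrow> nat) \<Rightarrow> (nat \<times> nat) set" where
  "par_edges V r p = {(u, v). u \<in> V \<and> v \<in> V \<and> (u = v \<or> (v \<noteq> r \<and> u = p v) \<or> (u \<noteq> r \<and> v = p u))}"

text \<open>The rank \<open>h\<close> excludes cycles: a non-root vertex of maximal rank is the
  parent of no non-root vertex, hence a leaf, and induction on the number of vertices
  applies.\<close>

lemma rooted_tree_par_edges:
  fixes h :: "nat \<Rightarrow> nat"
  assumes "finite V" "r \<in> V" "\<And>v. v \<in> V \<Longrightarrow> v \<noteq> r \<Longrightarrow> p v \<in> V \<and> h (p v) < h v"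
  shows "rooted_tree (V, par_edges V r p, r)"
  using assms
proof (induction "card V" arbitrary: V)
  case 0
  then show ?case by simp
next
  case (Suc n)
  show ?case
  proof (cases "V = {r}")
    case True
    have "is_tree ({r}, par_edges {r} r p, r)"
      unfolding is_tree_def is_graph_def verts_def edges_def by (auto simp: par_edges_def)
    then show ?thesis
      unfolding True rooted_tree_def by (simp add: verts_def root_def)
  next
    case False
    let ?V = "V - {r}"
    have "finite ?V" "?V \<noteq> {}" using Suc.prems False by auto
    then have "Max (h ` ?V) \<in> h ` ?V" by (intro Max_in) auto
    then obtain y where y: "y \<in> ?V" "h y = Max (h ` ?V)" by (metis (no_types, lifting) imageE)
    have ymax: "h v \<le> h y" if "v \<in> ?V" for v
      unfolding y(2) using \<open>finite ?V\<close> that by (intro Max_ge) auto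
    let ?W = "V - {y}"
    have ynp: "p v \<noteq> y" if "v \<in> V" "v \<noteq> r" for v
      using Suc.prems(3)[OF that] ymax[of v] that by auto
    have W: "rooted_tree (?W, par_edges ?W r p, r)"
      using Suc.prems Suc.hyps(2) y ynp by (intro Suc.hyps(1)) auto
    show ?thesis
      by (rule rooted_tree_add_leaf[OF W, of "p y" y])
        (use Suc.prems(2,3) y ynp in \<open>auto simp: verts_def edges_def root_def par_edges_def\<close>)
  qed
qed

text \<open>Induction on the rank: were \<open>v\<close> the parent of \<open>p v\<close>, the
  hypothesis at \<open>p v\<close> would give \<open>v = p (p v)\<close>, against the descent of
  \<open>h\<close>.\<close>

lemma par_par_edges:
  fixes h :: "nat \<Rightarrow> nat"
  assumes T: "rooted_tree T" and E: "edges T = par_edges (verts T) (root T) p"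
    and p: "\<And>v. v \<in> verts T \<Longrightarrow> v \<noteq> root T \<Longrightarrow> p v \<in> verts T \<and> h (p v) < h v"
    and v: "v \<in> verts T" "v \<noteq> root T"
  shows "par T v = p v"
  using v
proof (induction "h v" arbitrary: v rule: less_induct)
  case less
  have pv: "p v \<in> verts T" "h (p v) < h v" using p less.prems by auto
  have "(p v, v) \<in> edges T" unfolding E par_edges_def using pv less.prems by auto
  then consider "p v = par T v" | "v = par T (p v)"
    unfolding edges_iff[OF T] using pv by auto
  then show ?case
  proof cases
    case 2
    then have "p v \<noteq> root T" using less.prems by auto
    then show ?thesis
      using less.hyps[OF pv(2) pv(1)] 2 p[OF pv(1)] pv(2) by auto
  qed auto
qed

subsection \<open>Connected sets of vertices\<close>

lemma gconnectedD:
  assumes "gconnected T Q" "A \<union> B = Q" "A \<inter> B = {}" "A \<noteq> {}" "B \<noteq> {}"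
  shows "\<exists>a\<in>A. \<exists>b\<in>B. (a, b) \<in> edges T"
  using assms unfolding gconnected_def by metis

lemma gconnected_by_edges:
  assumes "Q \<subseteq> verts T"
    "\<And>A B. A \<union> B = Q \<Longrightarrow> A \<inter> B = {} \<Longrightarrow> A \<noteq> {} \<Longrightarrow> B \<noteq> {} \<Longrightarrow> \<exists>a\<in>A. \<exists>b\<in>B. (a, b) \<in> edges T"
  shows "gconnected T Q"
  using assms unfolding gconnected_def by metis

text \<open>Connectedness is recognised by parents alone: every vertex of the set can walk down
  inside it to one bottom vertex \<open>m\<close>. If the walk were blocked at \<open>u\<close>, the
  part of \<open>Q\<close> above \<open>u\<close> would be cut off from the rest.\<close>

lemma gconnected_iff:
  assumes T: "rooted_tree T" and Q: "Q \<subseteq> verts T" "Q \<noteq> {}"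
  shows "gconnected T Q \<longleftrightarrow> (\<exists>m\<in>Q. \<forall>u\<in>Q. u \<noteq> m \<longrightarrow> u \<noteq> root T \<and> par T u \<in> Q)"
proof
  assume c: "gconnected T Q"
  have "finite Q" using Q rooted_treeD[OF T] finite_subset by blast
  then obtain m where m: "m \<in> Q" "\<And>u. u \<in> Q \<Longrightarrow> ht T m \<le> ht T u"
    using arg_min_if_finite[of Q "ht T"] Q(2) by (meson not_le)
  have "u \<noteq> root T \<and> par T u \<in> Q" if u: "u \<in> Q" "u \<noteq> m" for u
  proof (rule ccontr)
    assume n: "\<not> (u \<noteq> root T \<and> par T u \<in> Q)"
    have "u \<noteq> root T"
      using u m(1) m(2)[of u] Q tle_ht[OF T tle_root[OF T, of m]] by auto
    then have np: "par T u \<notin> Q" using n by blast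
    let ?A = "{w\<in>Q. tle T u w}" and ?B = "{w\<in>Q. \<not> tle T u w}"
    have "u \<in> ?A" using u Q tle_refl[of u T] by auto
    moreover have "m \<in> ?B"
      using m u tle_ht[OF T, of u m] by fastforce
    moreover have "\<forall>a\<in>?A. \<forall>b\<in>?B. (a, b) \<notin> edges T"
    proof (intro ballI notI)
      fix a b assume ab: "a \<in> ?A" "b \<in> ?B" "(a, b) \<in> edges T"
      have "\<not> tle T a b" using ab tle_trans[OF T, of u a b] by blast
      then have "b = par T a" "a \<noteq> root T"
        using tle_edge[OF T, of b a] edge_comparable[OF T ab(3)] ab rooted_treeD(5)[OF T] by blast+
      moreover have "a = u"
        using ab tle_par_iff[OF T, of u a] \<open>b = par T a\<close> by auto
      ultimately show False using np ab by auto
    qed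
    moreover have "?A \<union> ?B = Q" "?A \<inter> ?B = {}" by blast+
    ultimately show False
      using gconnectedD[OF c, of ?A ?B] by (metis (no_types, lifting) empty_iff)
  qed
  then show "\<exists>m\<in>Q. \<forall>u\<in>Q. u \<noteq> m \<longrightarrow> u \<noteq> root T \<and> par T u \<in> Q" using m(1) by blast
next
  assume "\<exists>m\<in>Q. \<forall>u\<in>Q. u \<noteq> m \<longrightarrow> u \<noteq> root T \<and> par T u \<in> Q"
  then obtain m where m: "m \<in> Q" "\<And>u. u \<in> Q \<Longrightarrow> u \<noteq> m \<Longrightarrow> u \<noteq> root T \<and> par T u \<in> Q" by blast
  have *: False if AB: "A \<union> B = Q" "A \<inter> B = {}" "m \<in> A" "b \<in> B"
    and e: "\<And>a b. a \<in> A \<Longrightarrow> b \<in> B \<Longrightarrow> (a, b) \<notin> edges T" for A B b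
    using \<open>b \<in> B\<close>
  proof (induction "ht T b" arbitrary: b rule: less_induct)
    case less
    then have b: "b \<in> Q" "b \<noteq> m" using AB by auto
    then have r: "b \<noteq> root T" "par T b \<in> Q" using m by auto
    have "b \<in> verts T" using b Q by auto
    then have "par T b \<in> A"
      using less r AB(1) ht_par[OF T, of b] by (metis UnE lessI)
    then show False
      using e less.prems rpath_par(2)[OF T \<open>b \<in> verts T\<close> r(1)] by blast
  qed
  show "gconnected T Q"
  proof (rule gconnected_by_edges[OF Q(1)], rule ccontr)
    fix A B
    assume AB: "A \<union> B = Q" "A \<inter> B = {}" "A \<noteq> {}" "B \<noteq> {}"
      and "\<not> (\<exists>a\<in>A. \<exists>b\<in>B. (a, b) \<in> edges T)"
    then have e: "(a, b) \<notin> edges T" if "a \<in> A" "b \<in> B" for a b using that by blast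
    show False
    proof (cases "m \<in> A")
      case True
      then show ?thesis using *[of A B] AB e by blast
    next
      case False
      then have "m \<in> B" using m AB by blast
      then show ?thesis
        using *[of B A] AB e rooted_treeD(5)[OF T] by blast
    qed
  qed
qed

text \<open>The order form of connectedness, least element plus convexity;
  \<open>gconnectedI\<close> is the converse.\<close>

lemma gconnected_min:
  assumes T: "rooted_tree T" and Q: "gconnected T Q" "Q \<noteq> {}"
  obtains m where "m \<in> Q" "\<And>u. u \<in> Q \<Longrightarrow> tle T m u" "\<And>u w. u \<in> Q \<Longrightarrow> tle T m w \<Longrightarrow> tle T w u \<Longrightarrow> w \<in> Q"
proof -
  have V: "Q \<subseteq> verts T" using Q by (simp add: gconnected_def)
  obtain m where m: "m \<in> Q" "\<And>u. u \<in> Q \<Longrightarrow> u \<noteq> m \<Longrightarrow> u \<noteq> root T \<and> par T u \<in> Q"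
    using Q gconnected_iff[OF T V Q(2)] by auto
  have *: "tle T m u \<and> (\<forall>w. tle T m w \<longrightarrow> tle T w u \<longrightarrow> w \<in> Q)" if "u \<in> Q" for u
    using that
  proof (induction "ht T u" arbitrary: u rule: less_induct)
    case less
    have u: "u \<in> verts T" using V less by auto
    show ?case
    proof (cases "u = m")
      case True
      then show ?thesis using m(1) u tle_refl tle_antisym[OF T] by metis
    next
      case False
      then have r: "u \<noteq> root T" "par T u \<in> Q" using m less by auto
      then have "tle T m (par T u) \<and> (\<forall>w. tle T m w \<longrightarrow> tle T w (par T u) \<longrightarrow> w \<in> Q)"
        using less ht_par[OF T u] by auto
      then show ?thesis
        using r(1) u less.prems tle_par_iff[OF T, of _ u] tleD(1)[of T m] by metis
    qed
  qed
  show thesis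
  proof (rule that[OF m(1)])
    show "tle T m u" if "u \<in> Q" for u using *[OF that] by (rule conjunct1)
    show "w \<in> Q" if "u \<in> Q" "tle T m w" "tle T w u" for u w using *[OF that(1)] that(2,3) by metis
  qed
qed

lemma gconnectedI:
  assumes T: "rooted_tree T" and Q: "Q \<subseteq> verts T" "m \<in> Q"
    and m: "\<And>u. u \<in> Q \<Longrightarrow> tle T m u" "\<And>u w. u \<in> Q \<Longrightarrow> tle T m w \<Longrightarrow> tle T w u \<Longrightarrow> w \<in> Q"
  shows "gconnected T Q"
proof -
  have "u \<noteq> root T \<and> par T u \<in> Q" if "u \<in> Q" "u \<noteq> m" for u
    using m(1)[OF that(1)] m(2)[OF that(1), of "par T u"] that tle_lt_par[OF T, of m u] tle_par[OF T, of u] tleD by blast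
  moreover have "Q \<noteq> {}" using Q by auto
  ultimately show ?thesis
    using gconnected_iff[OF T Q(1)] Q(2) by blast
qed

lemma gconnected_empty: "gconnected T {}"
  by (simp add: gconnected_def)

text \<open>Finite form of hereditary unicoherence. The least vertices of the two sets lie below a
  common vertex, so they are comparable, and the upper one is least in the intersection.\<close>

lemma gconnected_Int:
  assumes T: "rooted_tree T" and Q: "gconnected T P" "gconnected T Q"
  shows "gconnected T (P \<inter> Q)"
proof (cases "P \<inter> Q = {}")
  case False
  then obtain z where z: "z \<in> P" "z \<in> Q" by blast
  have V: "P \<subseteq> verts T" "Q \<subseteq> verts T" using Q by (auto simp: gconnected_def)
  obtain m where m: "m \<in> P" "\<And>u. u \<in> P \<Longrightarrow> tle T m u" "\<And>u w. u \<in> P \<Longrightarrow> tle T m w \<Longrightarrow> tle T w u \<Longrightarrow> w \<in> P"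
    by (rule gconnected_min[OF T Q(1)]) (use z in blast, metis)
  obtain n where n: "n \<in> Q" "\<And>u. u \<in> Q \<Longrightarrow> tle T n u" "\<And>u w. u \<in> Q \<Longrightarrow> tle T n w \<Longrightarrow> tle T w u \<Longrightarrow> w \<in> Q"
    by (rule gconnected_min[OF T Q(2)]) (use z in blast, metis)
  have "tle T m n \<or> tle T n m" using tle_chain[OF T] m(2) n(2) z by blast
  then show ?thesis
  proof
    assume mn: "tle T m n"
    have "n \<in> P" by (rule m(3)[OF z(1) mn n(2)[OF z(2)]])
    show ?thesis
    proof (rule gconnectedI[OF T, where m = n])
      fix u w assume "u \<in> P \<inter> Q" "tle T n w" "tle T w u"
      then show "w \<in> P \<inter> Q"
        by (intro IntI m(3)[of u w] n(3)[of u w] tle_trans[OF T mn]) simp_all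
    qed (use V n(1,2) \<open>n \<in> P\<close> in auto)
  next
    assume nm: "tle T n m"
    have "m \<in> Q" by (rule n(3)[OF z(2) nm m(2)[OF z(1)]])
    show ?thesis
    proof (rule gconnectedI[OF T, where m = m])
      fix u w assume "u \<in> P \<inter> Q" "tle T m w" "tle T w u"
      then show "w \<in> P \<inter> Q"
        by (intro IntI m(3)[of u w] n(3)[of u w] tle_trans[OF T nm]) simp_all
    qed (use V m(1,2) \<open>m \<in> Q\<close> in auto)
  qed
qed (simp add: gconnected_empty)

lemma gconnected_interval:
  assumes T: "rooted_tree T" and a: "a \<in> verts T"
  shows "gconnected T {v. tle T a v \<and> tle T v b}"
proof (cases "tle T a b")
  case True
  show ?thesis
    by (rule gconnectedI[OF T, where m = a]) (use True tle_refl[OF a] tleD tle_trans[OF T] in blast)+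
next
  case False
  then have "{v. tle T a v \<and> tle T v b} = {}" using tle_trans[OF T] by blast
  then show ?thesis by (simp only: gconnected_empty)
qed

lemma gconnected_Union:
  assumes c: "\<And>Q. Q \<in> \<Q> \<Longrightarrow> gconnected T Q \<and> y \<in> Q"
  shows "gconnected T (\<Union>\<Q>)"
proof (rule gconnected_by_edges, goal_cases)
  case 1
  then show ?case using c by (auto simp: gconnected_def)
next
  case AB: (2 A B)
  show ?case
  proof (rule ccontr)
    assume ne: "\<not> ?case"
    have no: "A \<inter> Q = {} \<or> B \<inter> Q = {}" if "Q \<in> \<Q>" for Q
    proof (rule ccontr)
      assume n: "\<not> (A \<inter> Q = {} \<or> B \<inter> Q = {})"
      have "gconnected T Q" using c that by blast
      moreover have "(A \<inter> Q) \<union> (B \<inter> Q) = Q" using AB(1) that by blast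
      ultimately show False
        using gconnectedD[of T Q "A \<inter> Q" "B \<inter> Q"] n AB(2) ne by blast
    qed
    obtain a b where "a \<in> A" "b \<in> B" using AB by blast
    then obtain P Q where "P \<in> \<Q>" "Q \<in> \<Q>" "a \<in> P" "b \<in> Q" using AB(1) by blast
    then show False
      using no[of P] no[of Q] c[of P] c[of Q] AB(1,2) \<open>a \<in> A\<close> \<open>b \<in> B\<close> by blast
  qed
qed

lemma gconnected_image:
  assumes e: "\<And>a b. (a, b) \<in> edges A \<Longrightarrow> (f a, f b) \<in> edges B"
    and v: "f ` verts A \<subseteq> verts B" and Q: "gconnected A Q"
  shows "gconnected B (f ` Q)"
proof (rule gconnected_by_edges, goal_cases)
  case 1
  then show ?case using v Q by (auto simp: gconnected_def)
next
  case XY: (2 X Y)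
  let ?X = "Q \<inter> f -` X" and ?Y = "Q \<inter> f -` Y"
  obtain x y where "x \<in> X" "y \<in> Y" using XY(3,4) by blast
  moreover from this have "x \<in> f ` Q" "y \<in> f ` Q" unfolding XY(1)[symmetric] by simp_all
  ultimately have "?X \<noteq> {}" "?Y \<noteq> {}" by auto
  moreover have "?X \<inter> ?Y = {}" using XY(2) by blast
  moreover have "f q \<in> X \<union> Y" if "q \<in> Q" for q unfolding XY(1) using that by simp
  then have "?X \<union> ?Y = Q" by auto
  ultimately show ?case using gconnectedD[OF Q, of ?X ?Y] e by blast
qed

subsection \<open>Simple*-confluent maps\<close>

text \<open>Confluence stated without components, which makes closure under composition immediate.
  On a finite tree it follows from \<open>confluent\<close>, a maximal enlargement of
  \<open>C\<close> being a component.\<close>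

definition lifts_conn :: "rtree \<Rightarrow> rtree \<Rightarrow> (nat \<Rightarrow> nat) \<Rightarrow> bool" where
  "lifts_conn A B f \<longleftrightarrow> (\<forall>Q C. gconnected B Q \<longrightarrow> gconnected A C \<longrightarrow> C \<noteq> {} \<longrightarrow> f ` C \<subseteq> Q \<longrightarrow>
     (\<exists>K. C \<subseteq> K \<and> gconnected A K \<and> f ` K = Q))"

lemma lifts_connD:
  assumes "lifts_conn A B f" "gconnected B Q" "gconnected A C" "C \<noteq> {}" "f ` C \<subseteq> Q"
  obtains K where "C \<subseteq> K" "gconnected A K" "f ` K = Q"
  using assms unfolding lifts_conn_def by metis

lemma confluent_lifts_conn:
  assumes A: "finite (verts A)" and c: "confluent A B f"
  shows "lifts_conn A B f"
  unfolding lifts_conn_def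
proof (intro allI impI)
  fix Q C assume Q: "gconnected B Q" and C: "gconnected A C" "C \<noteq> {}" "f ` C \<subseteq> Q"
  let ?S = "{v \<in> verts A. f v \<in> Q}"
  let ?KK = "{K. K \<subseteq> ?S \<and> gconnected A K}"
  have "finite ?KK" by (rule finite_subset[of _ "Pow (verts A)"]) (use A in auto)
  moreover have "C \<in> ?KK" using C by (auto simp: gconnected_def)
  ultimately have "\<exists>K\<in>?KK. C \<subseteq> K \<and> (\<forall>K'\<in>?KK. K \<subseteq> K' \<longrightarrow> K = K')"
    by (rule finite_has_maximal2)
  then obtain K where K: "K \<in> ?KK" "C \<subseteq> K" and m: "\<forall>K'\<in>?KK. K \<subseteq> K' \<longrightarrow> K = K'" by (elim bexE conjE)
  have "K' = K" if "K \<subseteq> K'" "K' \<subseteq> ?S" "gconnected A K'" for K' using bspec[OF m, of K'] that by simp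
  moreover have "K \<noteq> {}" using K(2) C(2) by auto
  ultimately have "gcomponent A ?S K"
    unfolding gcomponent_def using K by simp
  then have "f ` K = Q" using c Q unfolding confluent_def by blast
  then show "\<exists>K. C \<subseteq> K \<and> gconnected A K \<and> f ` K = Q" using K by blast
qed

text \<open>Covers splitting and adding maps, whose fibres are single vertices or pairs of adjacent
  ones. Connected fibres and liftable edges make the full preimage of \<open>Q\<close> connected, so
  this preimage serves as \<open>K\<close> for every \<open>C\<close>.\<close>

lemma monotone_lifts_conn:
  assumes surj: "f ` verts A = verts B"
    and es: "\<And>u w. (u, w) \<in> edges B \<Longrightarrow> \<exists>u' w'. (u', w') \<in> edges A \<and> f u' = u \<and> f w' = w"
    and ev: "\<And>u w. (u, w) \<in> edges A \<Longrightarrow> u \<in> verts A \<and> w \<in> verts A"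
    and fib: "\<And>c. c \<in> verts B \<Longrightarrow> gconnected A {v \<in> verts A. f v = c}"
  shows "lifts_conn A B f"
  unfolding lifts_conn_def
proof (intro allI impI)
  fix Q C assume Q: "gconnected B Q" and C: "gconnected A C" "C \<noteq> {}" "f ` C \<subseteq> Q"
  have QV: "Q \<subseteq> verts B" using Q by (simp add: gconnected_def)
  let ?K = "{v \<in> verts A. f v \<in> Q}"
  have "gconnected A ?K"
  proof (rule gconnected_by_edges, goal_cases)
    case (2 X Y)
    show ?case
    \<comment> \<open>If the images are disjoint, an edge joining them inside \<open>Q\<close>
      lifts; otherwise some fibre meets both parts and is itself connected.\<close>
    proof (cases "f ` X \<inter> f ` Y = {}")
      case True
      have "f ` X \<union> f ` Y = f ` ?K" using 2(1) by (metis image_Un)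
      also have "\<dots> = Q" using surj QV by auto
      finally obtain b b' where b: "b \<in> f ` X" "b' \<in> f ` Y" "(b, b') \<in> edges B"
        using gconnectedD[OF Q _ True] 2(3,4) by blast
      then obtain a a' where a: "(a, a') \<in> edges A" "f a = b" "f a' = b'" using es by blast
      have "b \<in> Q" "b' \<in> Q" using b 2(1) by auto
      then have "a \<in> X \<union> Y" "a' \<in> X \<union> Y" unfolding 2(1) using ev[OF a(1)] a by simp_all
      moreover have "a \<notin> Y" "a' \<notin> X" using True b a by auto
      ultimately show ?thesis using a by blast
    next
      case False
      then obtain c where c: "c \<in> f ` X" "c \<in> f ` Y" by blast
      let ?F = "{v \<in> verts A. f v = c}"
      have "c \<in> Q" using c 2(1) by auto
      then have F: "gconnected A ?F" "?F \<subseteq> ?K" using fib QV by auto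
      have "(X \<inter> ?F) \<union> (Y \<inter> ?F) = ?F" using 2(1) F(2) by blast
      moreover have "X \<inter> ?F \<noteq> {}" "Y \<inter> ?F \<noteq> {}"
      proof -
        obtain x y where "x \<in> X" "y \<in> Y" "f x = c" "f y = c" using c by auto
        moreover have "x \<in> ?K" "y \<in> ?K" using 2(1) calculation by blast+
        ultimately show "X \<inter> ?F \<noteq> {}" "Y \<inter> ?F \<noteq> {}" by blast+
      qed
      ultimately show ?thesis
        using gconnectedD[OF F(1), of "X \<inter> ?F" "Y \<inter> ?F"] 2(2) by blast
    qed
  qed auto
  moreover have "C \<subseteq> ?K" using C by (auto simp: gconnected_def)
  moreover have "f ` ?K = Q" using surj QV by auto
  ultimately show "\<exists>K. C \<subseteq> K \<and> gconnected A K \<and> f ` K = Q" by blast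
qed

lemma lifts_conn_comp:
  assumes e: "\<And>a b. (a, b) \<in> edges A \<Longrightarrow> (f a, f b) \<in> edges B" "f ` verts A \<subseteq> verts B"
    and f: "lifts_conn A B f" and g: "lifts_conn B C g"
  shows "lifts_conn A C (g \<circ> f)"
  unfolding lifts_conn_def
proof (intro allI impI)
  fix Q D assume Q: "gconnected C Q" and D: "gconnected A D" "D \<noteq> {}" "(g \<circ> f) ` D \<subseteq> Q"
  have "gconnected B (f ` D)" by (rule gconnected_image[OF e D(1)])
  then obtain K where K: "f ` D \<subseteq> K" "gconnected B K" "g ` K = Q"
    using lifts_connD[OF g Q, of "f ` D"] D(2,3) by (metis image_comp image_is_empty)
  then obtain K' where "D \<subseteq> K'" "gconnected A K'" "f ` K' = K"
    using lifts_connD[OF f K(2) D(1,2)] by metis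
  then show "\<exists>K. D \<subseteq> K \<and> gconnected A K \<and> (g \<circ> f) ` K = Q"
    using K(3) by (metis image_comp)
qed

text \<open>The properties of simple*-confluent maps on which the later arguments rest. All are
  preserved by composition, so \<open>sc_epi_tmor\<close> obtains them by induction over the
  generators.\<close>

definition tmor :: "rtree \<Rightarrow> rtree \<Rightarrow> (nat \<Rightarrow> nat) \<Rightarrow> bool" where
  "tmor A B f \<longleftrightarrow> rooted_tree A \<and> rooted_tree B \<and> f ` verts A = verts B \<and> f (root A) = root B \<and>
     (\<forall>a b. (a, b) \<in> edges A \<longrightarrow> (f a, f b) \<in> edges B) \<and> (\<forall>x y. tle A x y \<longrightarrow> tle B (f x) (f y)) \<and>
     lifts_conn A B f"

lemma tmorD:
  assumes "tmor A B f"
  shows "rooted_tree A" "rooted_tree B" "f ` verts A = verts B" "f (root A) = root B"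
    "\<And>a b. (a, b) \<in> edges A \<Longrightarrow> (f a, f b) \<in> edges B" "\<And>x y. tle A x y \<Longrightarrow> tle B (f x) (f y)"
    "lifts_conn A B f" "\<And>v. v \<in> verts A \<Longrightarrow> f v \<in> verts B"
  using assms unfolding tmor_def by auto

text \<open>Induction downwards along the order: a property inherited by parents, taken as
  \<open>S\<close>, passes from \<open>w\<close> to everything below \<open>w\<close>.\<close>

lemma tle_closed:
  assumes T: "rooted_tree T" and t: "tle T t w" and w: "w \<in> S"
    and S: "\<And>v. v \<in> S \<Longrightarrow> v \<in> verts T \<Longrightarrow> v \<noteq> root T \<Longrightarrow> par T v \<in> S"
  shows "t \<in> S"
proof -
  have "w \<in> verts T" using t by (rule tleD)
  with T show ?thesis using t w
  proof (induction w rule: tree_induct)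
    case root
    then show ?case using tle_root_iff[OF T] by auto
  next
    case (par v)
    then show ?case using tle_par_iff[OF T, of t v] S by auto
  qed
qed

lemma tle_mono_by_par:
  assumes A: "rooted_tree A" and B: "rooted_tree B" and f: "\<And>v. v \<in> verts A \<Longrightarrow> f v \<in> verts B"
    and p: "\<And>v. v \<in> verts A \<Longrightarrow> v \<noteq> root A \<Longrightarrow> tle B (f (par A v)) (f v)"
    and xy: "tle A x y"
  shows "tle B (f x) (f y)"
proof -
  have y: "y \<in> verts A" using xy by (rule tleD)
  have "x \<in> {x \<in> verts A. tle B (f x) (f y)}"
  proof (rule tle_closed[OF A xy])
    show "y \<in> {x \<in> verts A. tle B (f x) (f y)}" using y f tle_refl by simp
    fix v assume "v \<in> {x \<in> verts A. tle B (f x) (f y)}" "v \<noteq> root A"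
    then show "par A v \<in> {x \<in> verts A. tle B (f x) (f y)}"
      using par_in[OF A, of v] tle_trans[OF B p[of v], of "f y"] by simp
  qed
  then show ?thesis by simp
qed

lemma gconnected_pair:
  assumes T: "rooted_tree T" and e: "(u, v) \<in> edges T"
  shows "gconnected T {u, v}"
proof (rule gconnected_by_edges)
  show "{u, v} \<subseteq> verts T" using rooted_treeD(3,4)[OF T e] by simp
  fix A B assume AB: "A \<union> B = {u, v}" "A \<inter> B = {}" "A \<noteq> {}" "B \<noteq> {}"
  then obtain a b where ab: "a \<in> A" "b \<in> B" by blast
  then have "a \<in> A \<union> B" "b \<in> A \<union> B" by simp_all
  moreover have "a \<noteq> b" using ab AB(2) by auto
  ultimately have "(a, b) \<in> edges T" unfolding AB(1) using e rooted_treeD(5)[OF T e] by auto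
  then show "\<exists>a\<in>A. \<exists>b\<in>B. (a, b) \<in> edges T" using ab by auto
qed

lemma gconnected_singleton: "rooted_tree T \<Longrightarrow> v \<in> verts T \<Longrightarrow> gconnected T {v}"
  using gconnected_pair[of T v v] rooted_treeD(6)[of T v] by simp

lemma rtree_eq: "T = (verts T, edges T, root T)"
  by (simp add: verts_def edges_def root_def)

text \<open>Describing the new tree by its parent function avoids reasoning about its paths: only
  \<open>x\<close> and \<open>b\<close> get new parents.\<close>

lemma split_par:
  assumes T: "rooted_tree T" and b: "b \<in> verts T" "b \<noteq> root T" and x: "x \<notin> verts T"
    and V: "verts T' = insert x (verts T)" and R: "root T' = root T"
    and E: "edges T' = (edges T - {(par T b, b), (b, par T b)}) \<union>
      {(par T b, x), (x, par T b), (x, b), (b, x), (x, x)}"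
  shows "rooted_tree T'" "par T' x = par T b" "par T' b = x"
    "\<And>v. v \<in> verts T \<Longrightarrow> v \<noteq> b \<Longrightarrow> par T' v = par T v"
proof -
  let ?a = "par T b"
  let ?p = "\<lambda>v. if v = x then ?a else if v = b then x else par T v"
  \<comment> \<open>Doubling the heights leaves an odd rank free for \<open>x\<close> between the
    ranks of \<open>?a\<close> and \<open>b\<close>.\<close>
  let ?h = "\<lambda>v. if v = x then 2 * ht T ?a + 1 else 2 * ht T v"
  have a: "?a \<in> verts T" "?a \<noteq> b" "?a \<noteq> x" "b \<noteq> x"
    using b x par_in[OF T b(1)] par_neq[OF T] by auto
  have rx: "root T \<noteq> x" using x rooted_treeD(2)[OF T] by auto
  have nb: "par T ?a \<noteq> b"
  proof
    assume *: "par T ?a = b"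
    then have "tle T b ?a" "tle T ?a b" using tle_par[OF T] a b by metis+
    then show False using tle_antisym[OF T] a by blast
  qed
  have px: "?p v \<in> verts T' \<and> ?h (?p v) < ?h v" if v: "v \<in> verts T'" "v \<noteq> root T'" for v
  proof -
    have "v = x \<or> v \<in> verts T" using v V by auto
    then show ?thesis
      using a ht_par[OF T, of v] ht_par[OF T b] par_in[OF T, of v] b x v R V by auto
  qed
  have E': "edges T' = par_edges (verts T') (root T') ?p"
  proof (intro set_eqI)
    fix e :: "nat \<times> nat"
    obtain u v where e: "e = (u, v)" by (cases e)
    consider "u = x" | "v = x" | "u \<noteq> x" "v \<noteq> x" "u \<in> verts T" "v \<in> verts T" | "u \<notin> verts T'" | "v \<notin> verts T'"
      using V by blast
    then show "e \<in> edges T' \<longleftrightarrow> e \<in> par_edges (verts T') (root T') ?p"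
      unfolding e
    proof cases
      case 1
      have "(x, v) \<notin> edges T" "v \<in> verts T \<Longrightarrow> par T v \<noteq> x"
        using x rooted_treeD(3)[OF T] par_in[OF T] by blast+
      then show "(u, v) \<in> edges T' \<longleftrightarrow> (u, v) \<in> par_edges (verts T') (root T') ?p"
        unfolding 1 E par_edges_def V R using a b rx by auto
    next
      case 2
      have "(u, x) \<notin> edges T" "u \<in> verts T \<Longrightarrow> par T u \<noteq> x"
        using x rooted_treeD(4)[OF T] par_in[OF T] by blast+
      then show "(u, v) \<in> edges T' \<longleftrightarrow> (u, v) \<in> par_edges (verts T') (root T') ?p"
        unfolding 2 E par_edges_def V R using a b rx by auto
    next
      case 3
      have "u = par T v \<Longrightarrow> v = root T \<Longrightarrow> u = v" "v = par T u \<Longrightarrow> u = root T \<Longrightarrow> u = v" by auto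
      then show "(u, v) \<in> edges T' \<longleftrightarrow> (u, v) \<in> par_edges (verts T') (root T') ?p"
        unfolding E par_edges_def V R using 3 a b nb edges_iff[OF T, of u v] by auto
    next
      case 4
      then have "u \<notin> verts T" "u \<noteq> x" using V by auto
      then show "(u, v) \<in> edges T' \<longleftrightarrow> (u, v) \<in> par_edges (verts T') (root T') ?p"
        unfolding E par_edges_def using 4 a b rooted_treeD(3)[OF T, of u v] by auto
    next
      case 5
      then have "v \<notin> verts T" "v \<noteq> x" using V by auto
      then show "(u, v) \<in> edges T' \<longleftrightarrow> (u, v) \<in> par_edges (verts T') (root T') ?p"
        unfolding E par_edges_def using 5 a b rooted_treeD(4)[OF T, of u v] by auto
    qed
  qed
  have "rooted_tree (verts T', par_edges (verts T') (root T') ?p, root T')"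
    by (rule rooted_tree_par_edges[where h = ?h]) (use px V R rooted_treeD(1,2)[OF T] in auto)
  then show T': "rooted_tree T'" using rtree_eq[of T'] E' by simp
  have pp: "par T' v = ?p v" if "v \<in> verts T'" "v \<noteq> root T'" for v
    by (rule par_par_edges[OF T' E', where h = ?h]) (use px that in auto)
  show "par T' x = ?a" "par T' b = x"
    using pp[of x] pp[of b] V R rx b a by auto
  show "par T' v = par T v" if "v \<in> verts T" "v \<noteq> b" for v
    using pp[of v] that V R x par_root[of T] par_root[of T'] by (cases "v = root T") auto
qed

lemma split_map_tmor:
  assumes T: "rooted_tree T" and s: "split_map T' T f"
  shows "tmor T' T f"
proof -
  obtain a b x where s: "(a, b) \<in> edges T" "tle T a b" "a \<noteq> b" and x: "x \<notin> verts T"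
    and V: "verts T' = insert x (verts T)" and E: "edges T' = (edges T - {(a, b), (b, a)}) \<union> {(a, x), (x, a), (x, b), (b, x), (x, x)}"
    and R: "root T' = root T" and f: "\<forall>v\<in>verts T. f v = v" "f x = a \<or> f x = b"
    using s unfolding split_map_def by (elim exE conjE) (rule that; assumption)
  have b: "b \<noteq> root T" "a = par T b" using tle_edge[OF T s(2,1)] s(3) by auto
  have av: "a \<in> verts T" "b \<in> verts T" using tleD[OF s(2)] by auto
  note P = split_par[OF T av(2) b(1) x V R E[unfolded b(2)]]
  have surj: "f ` verts T' = verts T" unfolding V using f av by auto
  have "f (par T' v) = f v \<or> f (par T' v) = par T (f v)" if v: "v \<in> verts T'" "v \<noteq> root T'" for v
  proof -
    have fa: "f a = a" "f b = b" using f av by auto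
    consider "v = x" | "v = b" "v \<noteq> x" | "v \<in> verts T" "v \<noteq> b" "v \<noteq> x" using v V by auto
    then show ?thesis
    proof cases
      case 1
      then show ?thesis using P(2) f(2) fa b(2) by auto
    next
      case 2
      then show ?thesis using P(3) f(2) fa b(2) by auto
    next
      case 3
      then show ?thesis using P(4)[of v] f(1) par_in[OF T, of v] by auto
    qed
  qed
  then have fpar: "tle T (f (par T' v)) (f v)" if "v \<in> verts T'" "v \<noteq> root T'" for v
  proof -
    have "f v \<in> verts T" using that(1) surj by blast
    then show ?thesis
      using \<open>\<And>v. v \<in> verts T' \<Longrightarrow> v \<noteq> root T' \<Longrightarrow> f (par T' v) = f v \<or> f (par T' v) = par T (f v)\<close>[OF that]
        tle_refl[of "f v" T] tle_par[OF T, of "f v"] by auto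
  qed
  have ord: "tle T (f u) (f v)" if "tle T' u v" for u v
    by (rule tle_mono_by_par[where f = f, OF P(1) T _ fpar that]) (use surj in auto)
  have hom: "(f u, f v) \<in> edges T" if "(u, v) \<in> edges T'" for u v
  proof -
    have ba: "(b, a) \<in> edges T" by (rule rooted_treeD(5)[OF T s(1)])
    have aa: "(a, a) \<in> edges T" "(b, b) \<in> edges T" using av rooted_treeD(6)[OF T] by auto
    from that consider "(u, v) \<in> edges T" | "(u, v) \<in> {(a, x), (x, a), (x, b), (b, x), (x, x)}"
      unfolding E by blast
    then show ?thesis
    proof cases
      case 1
      then show ?thesis using f rooted_treeD(3,4)[OF T 1] by simp
    next
      case 2
      have "f a = a" "f b = b" using f av by auto
      then show ?thesis using f(2) s(1) ba aa 2 by auto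
    qed
  qed
  have lc: "lifts_conn T' T f"
  proof (rule monotone_lifts_conn[OF surj])
    fix u w assume uw: "(u, w) \<in> edges T"
    have *: "(u, w) \<in> edges T'" if "(u, w) \<noteq> (a, b)" "(u, w) \<noteq> (b, a)"
      using uw that unfolding E by simp
    have fu: "f u = u" "f w = w" "f a = a" "f b = b" using f rooted_treeD(3,4)[OF T uw] av by auto
    consider "(u, w) \<noteq> (a, b)" "(u, w) \<noteq> (b, a)" | "u = a" "w = b" | "u = b" "w = a" by blast
    then show "\<exists>u' w'. (u', w') \<in> edges T' \<and> f u' = u \<and> f w' = w"
    proof cases
      case 2
      have "(a, x) \<in> edges T'" "(x, b) \<in> edges T'" unfolding E by auto
      then show ?thesis using 2 fu f(2) by metis
    next
      case 3
      have "(x, a) \<in> edges T'" "(b, x) \<in> edges T'" unfolding E by auto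
      then show ?thesis using 3 fu f(2) by metis
    qed (use * fu in metis)
  next
    fix c assume c: "c \<in> verts T"
    have ce: "gconnected T' {c}" by (rule gconnected_singleton[OF P(1)]) (use c V in simp)
    have xa: "gconnected T' {x, a}" "gconnected T' {x, b}" by (rule gconnected_pair[OF P(1)], simp add: E)+
    have "{v \<in> verts T'. f v = c} = (if f x = c then {x, c} else {c})"
      unfolding V using f c x by auto
    then show "gconnected T' {v \<in> verts T'. f v = c}" using ce xa f(2) by auto
  qed (rule conjI, erule rooted_treeD(3)[OF P(1)], erule rooted_treeD(4)[OF P(1)])
  show ?thesis
    unfolding tmor_def using P(1) T surj f R rooted_treeD(2)[OF T] hom ord lc by auto
qed

lemma add_map_tmor:
  assumes T: "rooted_tree T" and s: "add_map T' T f"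
  shows "tmor T' T f"
proof -
  obtain v y where v: "v \<in> verts T" and y: "y \<notin> verts T"
    and V: "verts T' = insert y (verts T)" and E: "edges T' = edges T \<union> {(v, y), (y, v), (y, y)}"
    and R: "root T' = root T" and f: "\<forall>u\<in>verts T. f u = u" "f y = v"
    using s unfolding add_map_def by (elim exE conjE) (rule that; assumption)
  have T': "rooted_tree T'" by (rule rooted_tree_add_leaf[OF T v y V E R])
  have surj: "f ` verts T' = verts T" unfolding V using f v by auto
  have vv: "(v, v) \<in> edges T" using v rooted_treeD(6)[OF T] by auto
  have hom: "(f u, f w) \<in> edges T" if "(u, w) \<in> edges T'" for u w
  proof -
    from that consider "(u, w) \<in> edges T" | "(u, w) \<in> {(v, y), (y, v), (y, y)}"
      unfolding E by blast
    then show ?thesis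
    proof cases
      case 1
      then show ?thesis using f rooted_treeD(3,4)[OF T 1] by simp
    next
      case 2
      then show ?thesis using f v vv by auto
    qed
  qed
  let ?p = "\<lambda>u. if u = y then v else par T u"
  let ?h = "\<lambda>u. if u = y then Suc (ht T v) else ht T u"
  have px: "?p u \<in> verts T' \<and> ?h (?p u) < ?h u" if u: "u \<in> verts T'" "u \<noteq> root T'" for u
  proof (cases "u = y")
    case False
    then have "u \<in> verts T" "u \<noteq> root T" using u V R by auto
    then show ?thesis using ht_par[OF T, of u] par_in[OF T, of u] y V False by auto
  qed (use v y V in auto)
  have E': "edges T' = par_edges (verts T') (root T') ?p"
  proof (intro set_eqI)
    fix e :: "nat \<times> nat"
    obtain u w where e: "e = (u, w)" by (cases e)
    have "(y, w) \<notin> edges T" "(u, y) \<notin> edges T" using y rooted_treeD(3)[OF T, of y w] rooted_treeD(4)[OF T, of u y] by auto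
    moreover have "u \<in> verts T \<Longrightarrow> par T u \<noteq> y" "w \<in> verts T \<Longrightarrow> par T w \<noteq> y" using y par_in[OF T] by metis+
    moreover have "u = par T w \<Longrightarrow> w = root T \<Longrightarrow> u = w" "w = par T u \<Longrightarrow> u = root T \<Longrightarrow> u = w" by auto
    ultimately show "e \<in> edges T' \<longleftrightarrow> e \<in> par_edges (verts T') (root T') ?p"
      unfolding e E par_edges_def V R using edges_iff[OF T, of u w] v y rooted_treeD(2)[OF T] by auto
  qed
  have pp: "par T' u = ?p u" if "u \<in> verts T'" "u \<noteq> root T'" for u
    by (rule par_par_edges[OF T' E', where h = ?h]) (use px that in auto)
  have par_old: "par T' u = par T u" if u: "u \<in> verts T" "u \<noteq> root T" for u
    using pp[of u] u V R y by auto
  have "par T' y = v"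
    using pp[of y] V R y rooted_treeD(2)[OF T] by auto
  then have fpar: "tle T (f (par T' u)) (f u)" if "u \<in> verts T'" "u \<noteq> root T'" for u
    using that V R f v tle_refl[of v T] par_old[of u] tle_par[OF T, of u] par_in[OF T, of u] by (cases "u = y") auto
  have ord: "tle T (f u) (f w)" if "tle T' u w" for u w
    by (rule tle_mono_by_par[where f = f, OF T' T _ fpar that]) (use surj in auto)
  have lc: "lifts_conn T' T f"
  proof (rule monotone_lifts_conn[OF surj])
    fix u w assume uw: "(u, w) \<in> edges T"
    then show "\<exists>u' w'. (u', w') \<in> edges T' \<and> f u' = u \<and> f w' = w"
      using f rooted_treeD(3,4)[OF T uw] E by (intro exI[of _ u] exI[of _ w]) auto
  next
    fix c assume c: "c \<in> verts T"
    have ce: "gconnected T' {c}" by (rule gconnected_singleton[OF T']) (use c V in simp)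
    have yv: "gconnected T' {y, v}" by (rule gconnected_pair[OF T'], simp add: E)
    have "{u \<in> verts T'. f u = c} = (if c = v then {y, c} else {c})"
      unfolding V using f c y by auto
    then show "gconnected T' {u \<in> verts T'. f u = c}" using ce yv by auto
  qed (rule conjI, erule rooted_treeD(3)[OF T'], erule rooted_treeD(4)[OF T'])
  show ?thesis
    unfolding tmor_def using T' T surj f R rooted_treeD(2)[OF T] hom ord lc by auto
qed

lemma tmor_cong: "tmor A B f \<Longrightarrow> \<forall>v\<in>verts A. g v = f v \<Longrightarrow> tmor A B g"
proof -
  assume f: "tmor A B f" and g: "\<forall>v\<in>verts A. g v = f v"
  note F = tmorD[OF f]
  have "lifts_conn A B g"
    unfolding lifts_conn_def
  proof (intro allI impI)
    fix Q C assume *: "gconnected B Q" "gconnected A C" "C \<noteq> {}" "g ` C \<subseteq> Q"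
    have im: "g ` K = f ` K" if "gconnected A K" for K
      using that g by (intro image_cong) (auto simp: gconnected_def)
    show "\<exists>K. C \<subseteq> K \<and> gconnected A K \<and> g ` K = Q"
      using lifts_connD[OF F(7) *(1-3)] *(4) im[OF *(2)] im by metis
  qed
  moreover have "g ` verts A = verts B" using F(3) g by auto
  ultimately show ?thesis
    unfolding tmor_def using F g rooted_treeD(2-4)[OF F(1)] tleD[of A] by metis
qed

lemma sc_epi_tmor: "sc_epi A B f \<Longrightarrow> tmor A B f"
proof (induction rule: sc_epi.induct)
  case (lc A B f)
  have "(f a, f b) \<in> edges B" if "(a, b) \<in> edges A" for a b
    using lc(3) that unfolding epi_def by (metis (no_types, lifting) case_prod_conv imageI)
  then show ?case
    using lc confluent_lifts_conn[OF rooted_treeD(1)] unfolding tmor_def epi_def by blast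
next
  case (split T T' f)
  then show ?case by (rule split_map_tmor)
next
  case (add T T' f)
  then show ?case by (rule add_map_tmor)
next
  case (comp A B f C g)
  note F = tmorD[OF comp.IH(1)] and G = tmorD[OF comp.IH(2)]
  have "lifts_conn A C (g \<circ> f)"
    by (rule lifts_conn_comp[OF F(5) _ F(7) G(7)]) (use F(3) in auto)
  moreover have "(g \<circ> f) ` verts A = verts C" using F(3) G(3) by (metis image_comp)
  ultimately show ?case unfolding tmor_def using F G by simp
next
  case (cong A B f g)
  then show ?case by (blast intro: tmor_cong)
qed

text \<open>Discrete continuity: as edges and order are both preserved, going down one edge moves
  the image down by at most one edge.\<close>

lemma tmor_par:
  assumes f: "tmor A B f" and v: "v \<in> verts A"
  shows "f (par A v) = f v \<or> (f v \<noteq> root B \<and> f (par A v) = par B (f v))"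
proof -
  note F = tmorD[OF f]
  have t: "tle A (par A v) v" by (rule tle_par[OF F(1) v])
  have "(par A v, v) \<in> edges A"
    using edges_iff[OF F(1)] v par_in[OF F(1) v] by blast
  then show ?thesis using tle_edge[OF F(2) F(6)[OF t] F(5)] by blast
qed

text \<open>Walking from \<open>a\<close> to the root moves the image to the root in steps of at
  most one edge, so no vertex below \<open>f a\<close> is skipped.\<close>

lemma tmor_down_surj:
  assumes f: "tmor A B f" and a: "a \<in> verts A" and b: "tle B b (f a)"
  shows "\<exists>a'. tle A a' a \<and> f a' = b"
  using tmorD(1)[OF f] a b
proof (induction a rule: tree_induct)
  case root
  then show ?case
    using tmorD(4)[OF f] tle_root_iff[OF tmorD(2)[OF f]] tle_refl rooted_treeD(2)[OF tmorD(1)[OF f]] by metis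
next
  case (par v)
  note F = tmorD[OF f]
  have vv: "tle A v v" "tle A (par A v) v" using par(1) tle_refl tle_par[OF F(1)] by auto
  show ?case
  proof (cases "b = f v")
    case False
    then have "tle B b (par B (f v))" using tle_lt_par[OF F(2) par(4)] by blast
    then have "tle B b (f (par A v))" using tmor_par[OF f par(1)] par(4) by metis
    then show ?thesis using par(3) tle_trans[OF F(1) _ vv(2)] by blast
  qed (use vv in auto)
qed

section \<open>Test epimorphisms: splitting an edge, adding a leaf, folding a doubled part\<close>

lemma sc_epi_id: "rooted_tree T \<Longrightarrow> sc_epi T T (\<lambda>x. x)"
proof (rule sc_epi.lc)
  assume T: "rooted_tree T"
  show "confluent T T (\<lambda>x. x)"
    unfolding confluent_def
  proof (intro allI impI)
    fix Q K assume Q: "gconnected T Q" and K: "gcomponent T {v \<in> verts T. v \<in> Q} K"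
    have "{v \<in> verts T. v \<in> Q} = Q" using Q by (auto simp: gconnected_def)
    then show "(\<lambda>x. x) ` K = Q" using K Q unfolding gcomponent_def by auto
  qed
qed (auto simp: epi_def light_def)

text \<open>The end point \<open>c\<close> to which the new vertex is sent is left open:
  \<open>E_above\<close> needs the lower one, \<open>no_E_chain\<close> the upper one, and
  \<open>subdivide_thirds\<close> both.\<close>

lemma split_ex:
  assumes T: "rooted_tree T" and b: "b \<in> verts T" "b \<noteq> root T" and c: "c = par T b \<or> c = b"
  obtains x B g where "x \<notin> verts T" "rooted_tree B" "sc_epi B T g" "verts B = insert x (verts T)" "root B = root T"
    "par B x = par T b" "par B b = x" "\<And>v. v \<in> verts T \<Longrightarrow> v \<noteq> b \<Longrightarrow> par B v = par T v"
    "\<And>v. v \<in> verts T \<Longrightarrow> g v = v" "g x = c"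
proof -
  obtain x where x: "x \<notin> verts T" using ex_new_if_finite[OF infinite_UNIV_nat rooted_treeD(1)[OF T]] by blast
  let ?a = "par T b"
  let ?B = "(insert x (verts T), (edges T - {(?a, b), (b, ?a)}) \<union> {(?a, x), (x, ?a), (x, b), (b, x), (x, x)}, root T)"
  let ?g = "\<lambda>v. if v = x then c else v"
  have V: "verts ?B = insert x (verts T)" and R: "root ?B = root T"
    and E: "edges ?B = (edges T - {(?a, b), (b, ?a)}) \<union> {(?a, x), (x, ?a), (x, b), (b, x), (x, x)}"
    by (simp_all add: verts_def edges_def root_def)
  have "(?a, b) \<in> edges T" "tle T ?a b" "?a \<noteq> b"
    using rpath_par(2)[OF T b] tle_par[OF T b(1)] par_neq[OF T b] by auto
  moreover have "\<forall>v\<in>verts T. ?g v = v" "?g x = ?a \<or> ?g x = b" using x c by auto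
  ultimately have "split_map ?B T ?g"
    unfolding split_map_def using x V E R by (intro exI[of _ ?a] exI[of _ b] exI[of _ x] conjI) assumption+
  then have "sc_epi ?B T ?g" by (rule sc_epi.split[OF T])
  then show thesis
    by (rule that[OF x split_par(1)[OF T b x V R E] _ V R split_par(2,3,4)[OF T b x V R E]]) (use x in auto)
qed

lemma leaf_ex:
  assumes T: "rooted_tree T" and v: "v \<in> verts T"
  obtains y B g where "rooted_tree B" "sc_epi B T g" "y \<in> verts B" "g y = v" "\<And>w. tle B y w \<Longrightarrow> w = y"
proof -
  obtain y where y: "y \<notin> verts T" using ex_new_if_finite[OF infinite_UNIV_nat rooted_treeD(1)[OF T]] by blast
  let ?B = "(insert y (verts T), edges T \<union> {(v, y), (y, v), (y, y)}, root T)"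
  let ?g = "\<lambda>u. if u = y then v else u"
  have V: "verts ?B = insert y (verts T)" and R: "root ?B = root T"
    and E: "edges ?B = edges T \<union> {(v, y), (y, v), (y, y)}"
    by (simp_all add: verts_def edges_def root_def)
  have B: "rooted_tree ?B" by (rule rooted_tree_add_leaf[OF T v y V E R])
  have "\<forall>u\<in>verts T. ?g u = u" "?g y = v" using y by auto
  then have "add_map ?B T ?g"
    unfolding add_map_def using v y V E R by (intro exI[of _ v] exI[of _ y] conjI) assumption+
  then have sc: "sc_epi ?B T ?g" by (rule sc_epi.add[OF T])
  have ye: "u = v" if "(y, u) \<in> edges ?B" "u \<noteq> y" for u
    using that rooted_treeD(3)[OF T, of y u] y unfolding E by auto
  have yV: "y \<in> verts ?B" "y \<noteq> root ?B" using V R y rooted_treeD(2)[OF T] by auto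
  have py: "par ?B y = v"
    using ye[OF rooted_treeD(5)[OF B rpath_par(2)[OF B yV]]] par_neq[OF B yV] by auto
  have pne: "par ?B u \<noteq> y" if u: "u \<in> verts T" "u \<noteq> root ?B" for u
  proof
    assume p: "par ?B u = y"
    have uV: "u \<in> verts ?B" "u \<noteq> y" using u V y by auto
    have "u = v" using ye[of u] rpath_par(2)[OF B uV(1) u(2)] uV p by auto
    then show False using p py ht_par[OF B uV(1) u(2)] ht_par[OF B yV] by simp
  qed
  have "w = y" if w: "tle ?B y w" for w
  proof (rule ccontr)
    assume "w \<noteq> y"
    then have "w \<in> verts T" using tleD(2)[OF w] V by auto
    have "y \<in> verts T"
      by (rule tle_closed[OF B w \<open>w \<in> verts T\<close>]) (use par_in[OF B] pne V in blast)
    then show False using y by simp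
  qed
  then show thesis using that[OF B sc yV(1)] by auto
qed

text \<open>A map under which parents correspond and all children lift behaves like a covering. If
  the image of a component missed part of \<open>Q\<close>, an edge leaving the image would lift at
  a vertex of the component and enlarge it.\<close>

lemma child_lifting_confluent:
  assumes A: "rooted_tree A" and B: "rooted_tree B" and g: "\<And>v. v \<in> verts A \<Longrightarrow> g v \<in> verts B"
    and par: "\<And>v. v \<in> verts A \<Longrightarrow> g (par A v) = par B (g v)"
    and ch: "\<And>w c. w \<in> verts A \<Longrightarrow> c \<in> verts B \<Longrightarrow> par B c = g w \<Longrightarrow> c \<noteq> root B \<Longrightarrow>
      \<exists>w'\<in>verts A. par A w' = w \<and> g w' = c"
  shows "confluent A B g"
  unfolding confluent_def
proof (intro allI impI)
  fix Q K assume Q: "gconnected B Q" and K: "gcomponent A {v \<in> verts A. g v \<in> Q} K"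
  have KV: "K \<subseteq> {v \<in> verts A. g v \<in> Q}" "K \<noteq> {}" "gconnected A K"
    and max: "\<And>K'. K \<subseteq> K' \<Longrightarrow> K' \<subseteq> {v \<in> verts A. g v \<in> Q} \<Longrightarrow> gconnected A K' \<Longrightarrow> K' = K"
    using K unfolding gcomponent_def by simp_all
  have ext: "w' \<in> K" if w: "w \<in> K" "(w, w') \<in> edges A" "g w' \<in> Q" for w w'
  proof -
    have "gconnected A (\<Union>{K, {w, w'}})"
      by (rule gconnected_Union[where y = w]) (use KV gconnected_pair[OF A w(2)] w in auto)
    moreover have "w' \<in> verts A" using rooted_treeD(4)[OF A w(2)] .
    ultimately have "\<Union>{K, {w, w'}} = K"
      using KV w by (intro max) auto
    then show ?thesis by blast
  qed
  show "g ` K = Q"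
  proof (rule ccontr)
    assume "g ` K \<noteq> Q"
    moreover have "g ` K \<subseteq> Q" using KV by auto
    ultimately have "g ` K \<union> (Q - g ` K) = Q" "Q - g ` K \<noteq> {}" by auto
    then obtain q q' where q: "q \<in> g ` K" "q' \<in> Q - g ` K" "(q, q') \<in> edges B"
      using gconnectedD[OF Q, of "g ` K" "Q - g ` K"] KV(2) by auto
    then obtain w where w: "w \<in> K" "q = g w" by blast
    have wA: "w \<in> verts A" using w KV by auto
    have q': "q' \<in> verts B" "q \<noteq> q'" using rooted_treeD(4)[OF B q(3)] q by auto
    have "\<exists>w'. (w, w') \<in> edges A \<and> g w' = q'"
    proof (cases "q' = par B q")
      case True
      have "(w, par A w) \<in> edges A" using edges_iff[OF A] wA par_in[OF A wA] by blast
      then show ?thesis using par[OF wA] True w by auto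
    next
      case False
      then have "q = par B q'" using q(3) q' edges_iff[OF B] by blast
      moreover from this have "q' \<noteq> root B" using q' by auto
      ultimately obtain w' where "w' \<in> verts A" "par A w' = w" "g w' = q'"
        using ch[OF wA q'(1)] w by auto
      then show ?thesis using edges_iff[OF A] wA by blast
    qed
    then obtain w' where "(w, w') \<in> edges A" "g w' = q'" by blast
    then show False using ext[OF w(1)] q(2) by blast
  qed
qed

text \<open>A second copy of everything strictly above \<open>u\<close> is attached at \<open>u\<close>; folding the two copies
  together is light and confluent.\<close>

lemma double_ex:
  assumes T: "rooted_tree T" and u: "u \<in> verts T"
  obtains B g where "rooted_tree B" "sc_epi B T g" "u \<in> verts B" "g u = u"
    "\<And>v. v \<in> verts B \<Longrightarrow> g v = u \<Longrightarrow> v = u"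
    "\<And>y z. y \<in> verts B \<Longrightarrow> tle T u z \<Longrightarrow> u \<noteq> z \<Longrightarrow>
      \<exists>z'\<in>verts B. g z' = z \<and> (\<forall>t. tle B t y \<longrightarrow> tle B t z' \<longrightarrow> tle T (g t) u)"
proof -
  let ?V = "verts T" and ?r = "root T"
  \<comment> \<open>Shifting by \<open>N\<close>, which exceeds every vertex, codes the second copy
    by fresh numbers.\<close>
  define N where "N = Suc (Max ?V)"
  have N: "v < N" if "v \<in> ?V" for v
    unfolding N_def using Max_ge[OF rooted_treeD(1)[OF T] that] by simp
  define U where "U = {v \<in> ?V. tle T u v \<and> v \<noteq> u}"
  define W where "W = ?V \<union> (\<lambda>v. v + N) ` U"
  \<comment> \<open>The copy of a child of \<open>u\<close> is attached to \<open>u\<close> itself,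
    every other copy to the copy of its parent.\<close>
  define p where "p w = (if w < N then par T w else if par T (w - N) = u then u else par T (w - N) + N)" for w
  define g where "g w = (if w < N then w else w - N)" for w
  define B where "B = (W, par_edges W ?r p, ?r)"
  have BV: "verts B = W" "root B = ?r" "edges B = par_edges W ?r p"
    by (simp_all add: B_def verts_def edges_def root_def)
  have rV: "?r \<in> ?V" using rooted_treeD(2)[OF T] .
  have UD: "v \<in> ?V" "v \<noteq> ?r" "v \<noteq> u" "par T v = u \<or> par T v \<in> U" if "v \<in> U" for v
  proof -
    have v: "v \<in> ?V" "tle T u v" "v \<noteq> u" using that by (auto simp: U_def)
    then show "v \<in> ?V" "v \<noteq> u" by auto
    from v tle_lt_par[OF T v(2)] have "v \<noteq> ?r" "tle T u (par T v)" by auto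
    then show "v \<noteq> ?r" "par T v = u \<or> par T v \<in> U" using par_in[OF T v(1)] by (auto simp: U_def)
  qed
  have Wcases: "(w < N \<and> w \<in> ?V) \<or> (\<not> w < N \<and> w - N \<in> U)" if "w \<in> W" for w
    using that N by (auto simp: W_def)
  have pW: "p w \<in> W" "g (p w) = par T (g w)" if w: "w \<in> W" for w
  proof -
    consider "w < N" "w \<in> ?V" | "\<not> w < N" "w - N \<in> U" using Wcases[OF w] by blast
    then have "p w \<in> W \<and> g (p w) = par T (g w)"
    proof cases
      case 1
      then show ?thesis using par_in[OF T] N by (auto simp: p_def g_def W_def)
    next
      case 2
      then show ?thesis using UD(4)[OF 2(2)] N[OF u] u by (auto simp: p_def g_def W_def)
    qed
    then show "p w \<in> W" "g (p w) = par T (g w)" by auto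
  qed
  have gV: "g w \<in> ?V" "w \<noteq> ?r \<Longrightarrow> g w \<noteq> ?r" if "w \<in> W" for w
    using Wcases[OF that] UD by (auto simp: g_def)
  have hp: "p w \<in> W \<and> ht T (g (p w)) < ht T (g w)" if "w \<in> W" "w \<noteq> ?r" for w
    using pW[OF that(1)] gV[OF that(1)] that(2) ht_par[OF T] by auto
  have "finite W" unfolding W_def U_def using rooted_treeD(1)[OF T] by simp
  then have RB: "rooted_tree B"
    unfolding B_def by (rule rooted_tree_par_edges[where h = "\<lambda>w. ht T (g w)"]) (use rV hp in \<open>auto simp: W_def\<close>)
  have pB: "par B w = p w" if "w \<in> W" for w
  proof (cases "w = ?r")
    case True
    then show ?thesis using par_root[of B] BV N[OF rV] by (simp add: p_def)
  next
    case False
    show ?thesis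
      by (rule par_par_edges[OF RB, where h = "\<lambda>w. ht T (g w)"]) (use BV hp that False in auto)
  qed
  have VW: "?V \<subseteq> W" by (auto simp: W_def)
  have gid: "g v = v" if "v \<in> ?V" for v using N[OF that] by (simp add: g_def)
  have surj: "g ` W = ?V" using gV gid VW by force
  have gpar: "g (par B v) = par T (g v)" if "v \<in> W" for v
    using pB[OF that] pW(2)[OF that] by simp
  have hom: "(g v, g w) \<in> edges T" if e: "(v, w) \<in> edges B" for v w
  proof -
    have "v \<in> W" "w \<in> W" "v = w \<or> v = par B w \<or> w = par B v" using e edges_iff[OF RB] BV by auto
    then show ?thesis using gpar gV edges_iff[OF T] by metis
  qed
  have eim: "(\<lambda>(a, b). (g a, g b)) ` edges B = edges T"
  proof
    show "(\<lambda>(a, b). (g a, g b)) ` edges B \<subseteq> edges T" using hom by auto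
    show "edges T \<subseteq> (\<lambda>(a, b). (g a, g b)) ` edges B"
    proof
      fix e assume "e \<in> edges T"
      moreover obtain v w where e: "e = (v, w)" by (cases e)
      ultimately have vw: "v \<in> ?V" "w \<in> ?V" "v = w \<or> v = par T w \<or> w = par T v" using edges_iff[OF T] by auto
      then have "v = w \<or> v = par B w \<or> w = par B v"
        using pB VW N by (auto simp: p_def)
      then have "(v, w) \<in> edges B" using edges_iff[OF RB] BV VW vw by auto
      then show "e \<in> (\<lambda>(a, b). (g a, g b)) ` edges B" by (rule rev_image_eqI) (use gid vw e in auto)
    qed
  qed
  have ord: "tle T (g x) (g y)" if "tle B x y" for x y
    by (rule tle_mono_by_par[where f = g, OF RB T _ _ that])
      (use gV gpar BV tle_par[OF T] in auto)
  have epi: "epi B T g"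
    unfolding epi_def using surj eim ord gid[OF rV] BV by auto
  have light: "light B g"
    unfolding light_def
  proof (intro ballI impI notI)
    fix a b assume ab: "a \<in> verts B" "b \<in> verts B" "a \<noteq> b \<and> g a = g b" "(a, b) \<in> edges B"
    have ne: False if v: "v \<in> W" "par B v \<noteq> v" "g (par B v) = g v" for v
    proof -
      have "v \<noteq> ?r" using v BV par_root[of B] by auto
      then show False using hp[OF v(1)] pB[OF v(1)] v(3) by auto
    qed
    have "a = par B b \<or> b = par B a" using ab edges_iff[OF RB] by blast
    then show False using ne[of a] ne[of b] ab BV by auto
  qed
  have conf: "confluent B T g"
  proof (rule child_lifting_confluent[OF RB T])
    fix w c assume w: "w \<in> verts B" and c: "c \<in> ?V" "par T c = g w" "c \<noteq> ?r"
    show "\<exists>w'\<in>verts B. par B w' = w \<and> g w' = c"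
    proof (cases "w < N")
      case True
      then have "par B c = w" using pB[of c] c VW N[OF c(1)] by (auto simp: p_def g_def)
      then show ?thesis using c VW BV gid by auto
    next
      case False
      then have wU: "w - N \<in> U" using Wcases w BV by auto
      have pc: "par T c = w - N" using c False by (simp add: g_def)
      then have "tle T u (par T c)" "par T c \<noteq> u" using wU by (auto simp: U_def)
      moreover have "tle T (par T c) c" by (rule tle_par[OF T c(1)])
      ultimately have "tle T u c" "c \<noteq> u" using tle_trans[OF T] tle_antisym[OF T] by metis+
      then have "c \<in> U" using c by (simp add: U_def)
      then have cW: "c + N \<in> W" by (auto simp: W_def)
      have "par B (c + N) = w"
        using pB[OF cW] pc \<open>par T c \<noteq> u\<close> False by (simp add: p_def)
      then show ?thesis using cW BV by (intro bexI[of _ "c + N"]) (auto simp: g_def)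
    qed
  qed (use gV gpar BV in auto)
  have sc: "sc_epi B T g" by (rule sc_epi.lc[OF RB T epi light conf])
  have u1: "v = u" if "v \<in> verts B" "g v = u" for v
    using Wcases[of v] that BV UD(3)[of "v - N"] by (auto simp: g_def)
  \<comment> \<open>Below an original there are only originals; below a copy there are only copies
    and vertices over the part up to \<open>u\<close>. So an original and a copy have common lower
    bounds only over that part.\<close>
  have low: "t < N" if "tle B t w" "w < N" "w \<in> W" for t w
  proof -
    have "t \<in> {t \<in> ?V. t < N}"
    proof (rule tle_closed[OF RB that(1)])
      show "w \<in> {t \<in> ?V. t < N}" using Wcases that by auto
      fix v assume "v \<in> {t \<in> ?V. t < N}"
      then show "par B v \<in> {t \<in> ?V. t < N}" using pB[of v] VW par_in[OF T, of v] N by (auto simp: p_def)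
    qed
    then show ?thesis by simp
  qed
  have high: "\<not> t < N \<or> tle T (g t) u" if t: "tle B t w" "\<not> w < N" "w \<in> W" for t w
  proof -
    have "t \<in> {t \<in> W. \<not> t < N \<or> tle T (g t) u}"
    proof (rule tle_closed[OF RB t(1)])
      show "w \<in> {t \<in> W. \<not> t < N \<or> tle T (g t) u}" using t by auto
      fix v assume v: "v \<in> {t \<in> W. \<not> t < N \<or> tle T (g t) u}"
      have pv: "par B v \<in> W" using pW pB v by auto
      show "par B v \<in> {t \<in> W. \<not> t < N \<or> tle T (g t) u}"
      proof (cases "v < N")
        case True
        then have "tle T (g v) u" using v by simp
        then have "tle T (par T (g v)) u"
          using tle_trans[OF T tle_par[OF T]] tleD(1) by metis
        then show ?thesis using pv gpar v by auto
      next
        case False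
        then show ?thesis using pv pB[of v] v tle_refl[OF u] gid[OF u] by (auto simp: p_def)
      qed
    qed
    then show ?thesis by simp
  qed
  have sep: "\<exists>z'\<in>verts B. g z' = z \<and> (\<forall>t. tle B t y \<longrightarrow> tle B t z' \<longrightarrow> tle T (g t) u)"
    if y: "y \<in> verts B" and z: "tle T u z" "u \<noteq> z" for y z
  proof -
    have zV: "z \<in> ?V" "z \<in> U" using z tleD(2)[OF z(1)] by (auto simp: U_def)
    have zW: "z \<in> W" "z + N \<in> W" using zV VW by (auto simp: W_def)
    show ?thesis
    \<comment> \<open>The preimage of \<open>z\<close> is taken of the other kind than
      \<open>y\<close>: a copy if \<open>y\<close> is an original, an original if \<open>y\<close>
      is a copy.\<close>
    proof (cases "y < N")
      case True
      show ?thesis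
        using zW BV low[OF _ True] high[of _ "z + N"] y
        by (intro bexI[of _ "z + N"]) (auto simp: g_def)
    next
      case False
      show ?thesis
        using zW BV low[of _ z] high[OF _ False] y N[OF zV(1)] gid[OF zV(1)]
        by (intro bexI[of _ z]) auto
    qed
  qed
  show thesis
    by (rule that[OF RB sc _ gid[OF u] u1 sep]) (use u VW BV in auto)
qed

subsection \<open>Threads of the inverse sequence\<close>

text \<open>The composite bonding map from level \<open>m\<close> down to level \<open>n\<close>,
  with default value \<open>id\<close> for \<open>m < n\<close>.\<close>

primrec bond :: "(nat \<Rightarrow> nat \<Rightarrow> nat) \<Rightarrow> nat \<Rightarrow> nat \<Rightarrow> nat \<Rightarrow> nat" where
  "bond \<alpha> n 0 = id"
| "bond \<alpha> n (Suc m) = (if n \<le> m then bond \<alpha> n m \<circ> \<alpha> m else id)"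

lemma bond_refl [simp]: "bond \<alpha> n n = id"
  by (cases n) auto

lemma bond_Suc: "n \<le> m \<Longrightarrow> bond \<alpha> n (Suc m) v = bond \<alpha> n m (\<alpha> m v)"
  by simp

declare bond.simps(2) [simp del]

lemma bond_bond: "n \<le> m \<Longrightarrow> m \<le> k \<Longrightarrow> bond \<alpha> n m (bond \<alpha> m k v) = bond \<alpha> n k v"
proof (induction k arbitrary: v)
  case (Suc k)
  show ?case
  proof (cases "m \<le> k")
    case True
    then show ?thesis using Suc by (simp add: bond_Suc)
  next
    case False
    then have "m = Suc k" using Suc by simp
    then show ?thesis by simp
  qed
qed simp

lemma bond_one: "bond \<alpha> n (Suc n) v = \<alpha> n v"
  by (simp add: bond_Suc)

lemma bond_first: "Suc n \<le> m \<Longrightarrow> \<alpha> n (bond \<alpha> (Suc n) m v) = bond \<alpha> n m v"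
  using bond_bond[of n "Suc n" m \<alpha> v] by (simp add: bond_one)

locale tc_limit =
  fixes F :: "nat \<Rightarrow> rtree" and \<alpha> :: "nat \<Rightarrow> nat \<Rightarrow> nat"
  assumes lim: "is_TC_limit F \<alpha>"
begin

abbreviation "L \<equiv> lim_verts F \<alpha>"
abbreviation "E \<equiv> lim_edges F \<alpha>"
abbreviation "bnd \<equiv> bond \<alpha>"

lemma TC: "in_TC (F n)" and RT: "rooted_tree (F n)" and sc_step: "sc_epi (F (Suc n)) (F n) (\<alpha> n)"
  using lim unfolding is_TC_limit_def in_TC_def by simp_all

lemma sc_bnd: "n \<le> m \<Longrightarrow> sc_epi (F m) (F n) (bnd n m)"
proof (induction m)
  case 0
  then show ?case using sc_epi_id[OF RT[of 0]] by (simp add: id_def)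
next
  case (Suc m)
  show ?case
  proof (cases "n \<le> m")
    case True
    then show ?thesis using sc_epi.comp[OF sc_step Suc.IH] by (simp add: bond.simps(2) comp_def)
  next
    case False
    then have "n = Suc m" using Suc by simp
    then show ?thesis using sc_epi_id[OF RT] by (simp add: id_def)
  qed
qed

lemma tm_bnd: "n \<le> m \<Longrightarrow> tmor (F m) (F n) (bnd n m)"
  by (rule sc_epi_tmor[OF sc_bnd])

lemma tm_step: "tmor (F (Suc n)) (F n) (\<alpha> n)"
  by (rule sc_epi_tmor[OF sc_step])

lemma LD: "x \<in> L \<Longrightarrow> x n \<in> verts (F n)" "x \<in> L \<Longrightarrow> \<alpha> n (x (Suc n)) = x n"
  by (simp_all add: lim_verts_def)

lemma L_bnd: "x \<in> L \<Longrightarrow> n \<le> m \<Longrightarrow> bnd n m (x m) = x n"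
proof (induction m)
  case (Suc m)
  then show ?case by (cases "n \<le> m") (simp_all add: LD bond_Suc le_Suc_eq)
qed simp

lemma L_eq_down: "x \<in> L \<Longrightarrow> y \<in> L \<Longrightarrow> n \<le> m \<Longrightarrow> x m = y m \<Longrightarrow> x n = y n"
  using L_bnd by metis

lemma L_neq_up: "x \<in> L \<Longrightarrow> y \<in> L \<Longrightarrow> n \<le> m \<Longrightarrow> x n \<noteq> y n \<Longrightarrow> x m \<noteq> y m"
  using L_eq_down by metis

lemma L_eqI: "x \<in> L \<Longrightarrow> y \<in> L \<Longrightarrow> (\<And>m. m \<ge> n \<Longrightarrow> x m = y m) \<Longrightarrow> x = y"
  using L_eq_down by (metis ext nle_le)

lemma thread_ex:
  assumes w: "\<And>i. w i \<in> verts (F (m + i))" "\<And>i. \<alpha> (m + i) (w (Suc i)) = w i"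
  obtains z where "z \<in> L" "\<And>i. z (m + i) = w i"
proof -
  \<comment> \<open>Level \<open>m + j\<close> is at least both \<open>m\<close> and
    \<open>j\<close>, so one formula covers the coordinates below and beyond
    \<open>m\<close>.\<close>
  define z where "z j = bnd j (m + j) (w j)" for j
  have *: "bnd (m + i) (m + i + d) (w (i + d)) = w i" for i d
  proof (induction d)
    case (Suc d)
    then show ?case using w(2)[of "i + d"] by (simp add: bond_Suc add.assoc)
  qed simp
  have "z j \<in> verts (F j)" for j
    unfolding z_def using tmorD(8)[OF tm_bnd[of j "m + j"] w(1)[of j]] by simp
  moreover have "\<alpha> j (z (Suc j)) = z j" for j
    unfolding z_def using bond_first[of j "m + Suc j" \<alpha>] w(2)[of j] by (simp add: bond_Suc)
  ultimately have "z \<in> L" by (simp add: lim_verts_def)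
  moreover have "z (m + i) = w i" for i
    unfolding z_def using *[of i m] by (simp add: add.commute add.left_commute)
  ultimately show thesis using that by blast
qed

text \<open>A Mittag-Leffler argument. The images of \<open>C k\<close> at level \<open>m\<close>
  decrease with \<open>k\<close> and are finite, so they stabilise. The bonding maps send the stable
  images onto each other, and therefore each of their points is a coordinate of a thread in the
  limit.\<close>

lemma lim_image:
  assumes C: "\<And>m. m \<ge> n \<Longrightarrow> C m \<subseteq> verts (F m)" "\<And>m. m \<ge> n \<Longrightarrow> \<alpha> m ` C (Suc m) \<subseteq> C m"
    and m: "m \<ge> n"
  shows "\<exists>k\<ge>m. (\<lambda>z. z m) ` {z \<in> L. \<forall>m\<ge>n. z m \<in> C m} = bnd m k ` C k"
proof -
  let ?I = "\<lambda>m k. bnd m k ` C k"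
  have dec: "?I m k' \<subseteq> ?I m k" if "n \<le> m" "m \<le> k" "k \<le> k'" for m k k'
    using that(3)
  proof (induction k' rule: dec_induct)
    case (step j)
    have "?I m (Suc j) = bnd m j ` (\<alpha> j ` C (Suc j))"
      using step that by (simp add: image_image bond_Suc)
    also have "\<dots> \<subseteq> ?I m j" by (rule image_mono, rule C(2)) (use step that in simp)
    finally show ?case using step by simp
  qed simp
  have fin: "finite (?I m k)" if "m \<ge> n" "k \<ge> m" for m k
    using C(1)[of k] rooted_treeD(1)[OF RT, of k] that by (meson finite_imageI finite_subset le_trans)
  have stab: "\<exists>K\<ge>m. \<forall>k\<ge>K. ?I m k = ?I m K" if m: "m \<ge> n" for m
  proof -
    \<comment> \<open>From a \<open>k\<close> at which the cardinality is least, the decreasing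
      images can no longer change.\<close>
    define K where "K = arg_min (\<lambda>k. card (?I m k)) (\<lambda>k. k \<ge> m)"
    have K: "K \<ge> m" "\<And>k. k \<ge> m \<Longrightarrow> card (?I m K) \<le> card (?I m k)"
      unfolding K_def by (rule arg_min_natI[of "\<lambda>k. k \<ge> m" m], simp, rule arg_min_nat_le, simp)
    have "?I m k = ?I m K" if "k \<ge> K" for k
      using dec[OF m K(1) that] fin[OF m K(1)] K(2)[of k] K(1) that
      by (intro card_subset_eq) (auto intro: antisym card_mono)
    then show ?thesis using K(1) by blast
  qed
  define K where "K m = (SOME K. K \<ge> m \<and> (\<forall>k\<ge>K. ?I m k = ?I m K))" for m
  have K: "K m \<ge> m" "\<And>k. k \<ge> K m \<Longrightarrow> ?I m k = ?I m (K m)" if "m \<ge> n" for m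
  proof -
    have "K m \<ge> m \<and> (\<forall>k\<ge>K m. ?I m k = ?I m (K m))"
      unfolding K_def by (rule someI_ex) (use stab[OF that] in blast)
    then show "K m \<ge> m" "\<And>k. k \<ge> K m \<Longrightarrow> ?I m k = ?I m (K m)" by blast+
  qed
  define D where "D m = ?I m (K m)" for m
  have DC: "D m \<subseteq> C m" if "m \<ge> n" for m
    unfolding D_def using dec[OF that le_refl K(1)[OF that]] by simp
  have Dstep: "D m = \<alpha> m ` D (Suc m)" if "m \<ge> n" for m
  proof -
    let ?J = "max (K m) (K (Suc m))"
    have "D m = ?I m ?J" unfolding D_def using K(2)[OF that, of ?J] by simp
    also have "\<dots> = \<alpha> m ` ?I (Suc m) ?J"
      using K(1)[of "Suc m"] that by (auto simp: image_image bond_first le_max_iff_disj)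
    also have "\<dots> = \<alpha> m ` D (Suc m)" unfolding D_def using K(2)[of "Suc m" ?J] that by simp
    finally show ?thesis .
  qed
  have "(\<lambda>z. z m) ` {z \<in> L. \<forall>m\<ge>n. z m \<in> C m} = D m"
  proof
    show "(\<lambda>z. z m) ` {z \<in> L. \<forall>m\<ge>n. z m \<in> C m} \<subseteq> D m"
    proof
      fix v assume "v \<in> (\<lambda>z. z m) ` {z \<in> L. \<forall>m\<ge>n. z m \<in> C m}"
      then obtain z where z: "z \<in> L" "\<forall>m\<ge>n. z m \<in> C m" "v = z m" by auto
      have "v = bnd m (K m) (z (K m))" using L_bnd[OF z(1) K(1)[OF m]] z(3) by simp
      moreover have "K m \<ge> n" using K(1)[OF m] m by simp
      ultimately show "v \<in> D m" unfolding D_def using z(2) by blast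
    qed
    show "D m \<subseteq> (\<lambda>z. z m) ` {z \<in> L. \<forall>m\<ge>n. z m \<in> C m}"
    proof
      fix v assume v: "v \<in> D m"
      have "\<exists>f. \<forall>i. (f i \<in> D (m + i) \<and> (i = 0 \<longrightarrow> f i = v)) \<and> \<alpha> (m + i) (f (Suc i)) = f i"
      proof (rule dependent_nat_choice)
        show "\<exists>x. x \<in> D (m + 0) \<and> (0 = 0 \<longrightarrow> x = v)" using v by simp
        fix x i assume "x \<in> D (m + i) \<and> (i = 0 \<longrightarrow> x = v)"
        then have "x \<in> \<alpha> (m + i) ` D (Suc (m + i))" using Dstep[of "m + i"] m by simp
        then show "\<exists>y. (y \<in> D (m + Suc i) \<and> (Suc i = 0 \<longrightarrow> y = v)) \<and> \<alpha> (m + i) y = x" by auto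
      qed
      then obtain w where w: "\<And>i. w i \<in> D (m + i)" "w 0 = v" "\<And>i. \<alpha> (m + i) (w (Suc i)) = w i" by metis
      have "w i \<in> verts (F (m + i))" for i using w(1)[of i] DC[of "m + i"] C(1)[of "m + i"] m by auto
      then obtain z where z: "z \<in> L" "\<And>i. z (m + i) = w i" using thread_ex[of w m] w(3) by metis
      have "z j \<in> C j" if j: "j \<ge> n" for j
      proof (cases "j \<ge> m")
        case True
        then show ?thesis using z(2)[of "j - m"] w(1)[of "j - m"] DC[OF j] by auto
      next
        case False
        then have "z j = bnd j m (z m)" using L_bnd[OF z(1), of j m] by simp
        moreover have "z m \<in> C m" using z(2)[of 0] w(1)[of 0] DC[OF m] by auto
        ultimately show ?thesis using dec[OF j le_refl, of m] False by auto
      qed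
      then show "v \<in> (\<lambda>z. z m) ` {z \<in> L. \<forall>m\<ge>n. z m \<in> C m}"
        using z(1) z(2)[of 0] w(2) by (intro image_eqI[of _ _ z]) auto
    qed
  qed
  then show ?thesis unfolding D_def using K(1)[OF m] by blast
qed

lemma L_surj:
  assumes "v \<in> verts (F m)"
  obtains x where "x \<in> L" "x m = v"
proof -
  have st: "\<alpha> k ` verts (F (Suc k)) \<subseteq> verts (F k)" for k using tmorD(3)[OF tm_step] by simp
  obtain k where "k \<ge> m" "(\<lambda>z. z m) ` {z \<in> L. \<forall>m\<ge>0. z m \<in> verts (F m)} = bnd m k ` verts (F k)"
    using lim_image[of 0 "\<lambda>m. verts (F m)" m] st by auto
  then have "v \<in> (\<lambda>z. z m) ` {z \<in> L. \<forall>m\<ge>0. z m \<in> verts (F m)}"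
    using tmorD(3)[OF tm_bnd] assms by simp
  then show thesis using that by auto
qed

text \<open>The extension property of the limit, applied to the projection to \<open>F n\<close>.\<close>

lemma extension:
  assumes B: "rooted_tree B" and g: "sc_epi B (F n) g"
  obtains m h where "m \<ge> n" "tmor (F m) B h" "sc_epi (F m) B h" "\<And>v. v \<in> verts (F m) \<Longrightarrow> g (h v) = bnd n m v"
proof -
  \<comment> \<open>Surjectivity of \<open>g\<close> gives \<open>B\<close> at least two vertices,
    so it belongs to the family.\<close>
  have "verts (F n) = g ` verts B" using tmorD(3)[OF sc_epi_tmor[OF g]] by simp
  then have "card (verts (F n)) \<le> card (verts B)" using card_image_le[OF rooted_treeD(1)[OF B]] by metis
  then have "in_TC B" using TC[of n] B unfolding in_TC_def by auto
  moreover have "admissible F \<alpha> (F n) (\<lambda>x. x n)"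
    unfolding admissible_def using sc_epi_id[OF RT] by (intro exI[of _ n] exI[of _ "\<lambda>x. x"]) auto
  ultimately have "\<exists>f. admissible F \<alpha> B f \<and> (\<forall>x\<in>L. x n = g (f x))"
    using lim[unfolded is_TC_limit_def, THEN conjunct2, THEN conjunct2, THEN conjunct2, rule_format,
        of "F n" B "\<lambda>x. x n" g] TC[of n] g by simp
  then obtain f where f: "admissible F \<alpha> B f" "\<forall>x\<in>L. x n = g (f x)" by (elim exE conjE)
  obtain k h where h: "sc_epi (F k) B h" "\<forall>x\<in>L. f x = h (x k)"
    using f(1) unfolding admissible_def by (elim exE conjE) (rule that)
  \<comment> \<open>A bonding map moves the domain of the factor map above level \<open>n\<close>.
    As every vertex of \<open>F ?m\<close> lies on a thread, the identity known for threads then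
    holds for vertices.\<close>
  let ?m = "max n k"
  have sc: "sc_epi (F ?m) B (h \<circ> bnd k ?m)" by (rule sc_epi.comp[OF sc_bnd h(1)]) simp
  have "g ((h \<circ> bnd k ?m) v) = bnd n ?m v" if "v \<in> verts (F ?m)" for v
  proof -
    obtain x where x: "x \<in> L" "x ?m = v" using L_surj \<open>v \<in> verts (F ?m)\<close> by blast
    then show ?thesis using f(2) h(2) L_bnd[OF x(1), of k ?m] L_bnd[OF x(1), of n ?m] by auto
  qed
  then show thesis using that[OF _ sc_epi_tmor[OF sc] sc] by simp
qed

subsection \<open>The order on threads\<close>

definition le :: "(nat \<Rightarrow> nat) \<Rightarrow> (nat \<Rightarrow> nat) \<Rightarrow> bool" (infix "\<sqsubseteq>" 50) where
  "x \<sqsubseteq> y \<longleftrightarrow> x \<in> L \<and> y \<in> L \<and> (\<forall>n. tle (F n) (x n) (y n))"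

lemma leD: "x \<sqsubseteq> y \<Longrightarrow> x \<in> L" "x \<sqsubseteq> y \<Longrightarrow> y \<in> L" "x \<sqsubseteq> y \<Longrightarrow> tle (F n) (x n) (y n)"
  by (simp_all add: le_def)

lemma le_refl': "x \<in> L \<Longrightarrow> x \<sqsubseteq> x"
  by (simp add: le_def tle_refl LD)

lemma le_trans': "x \<sqsubseteq> y \<Longrightarrow> y \<sqsubseteq> z \<Longrightarrow> x \<sqsubseteq> z"
  unfolding le_def using tle_trans[OF RT] by metis

lemma le_antisym': "x \<sqsubseteq> y \<Longrightarrow> y \<sqsubseteq> x \<Longrightarrow> x = y"
  unfolding le_def using tle_antisym[OF RT] by (metis ext)

lemma tle_down:
  assumes "x \<in> L" "y \<in> L" "n \<le> m" "tle (F m) (x m) (y m)"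
  shows "tle (F n) (x n) (y n)"
  using tmorD(6)[OF tm_bnd[OF assms(3)] assms(4)] L_bnd assms by simp

text \<open>Bonding maps preserve the order, so relations at high levels descend to all lower
  ones.\<close>

lemma le_cofinal:
  assumes "x \<in> L" "y \<in> L" "\<And>n. \<exists>m\<ge>n. tle (F m) (x m) (y m)"
  shows "x \<sqsubseteq> y"
  unfolding le_def using assms tle_down by metis

text \<open>One of the two relations must hold at infinitely many levels.\<close>

lemma le_comparable:
  assumes "x \<in> L" "y \<in> L" "\<And>n. tle (F n) (x n) (y n) \<or> tle (F n) (y n) (x n)"
  shows "x \<sqsubseteq> y \<or> y \<sqsubseteq> x"
proof (cases "\<forall>n. \<exists>m\<ge>n. tle (F m) (x m) (y m)")
  case True
  then show ?thesis using le_cofinal assms by blast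
next
  case False
  then obtain N where "\<And>m. m \<ge> N \<Longrightarrow> tle (F m) (y m) (x m)" using assms(3) by blast
  then have "\<exists>m\<ge>n. tle (F m) (y m) (x m)" for n by (meson max.cobounded1 max.cobounded2)
  then show ?thesis using le_cofinal assms by blast
qed

lemma le_chain: "x \<sqsubseteq> z \<Longrightarrow> y \<sqsubseteq> z \<Longrightarrow> x \<sqsubseteq> y \<or> y \<sqsubseteq> x"
  by (rule le_comparable) (use leD tle_chain[OF RT] in blast)+

lemma ED: "(x, y) \<in> E \<Longrightarrow> x \<in> L" "(x, y) \<in> E \<Longrightarrow> y \<in> L" "(x, y) \<in> E \<Longrightarrow> (x n, y n) \<in> edges (F n)"
  by (simp_all add: lim_edges_def)

lemma E_refl: "x \<in> L \<Longrightarrow> (x, x) \<in> E"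
  by (simp add: lim_edges_def LD rooted_treeD(6)[OF RT])

lemma E_sym: "(x, y) \<in> E \<Longrightarrow> (y, x) \<in> E"
  by (simp add: lim_edges_def rooted_treeD(5)[OF RT])

lemma E_comparable: "(x, y) \<in> E \<Longrightarrow> x \<sqsubseteq> y \<or> y \<sqsubseteq> x"
  by (rule le_comparable) (use ED edge_comparable[OF RT] in blast)+

definition rt :: "nat \<Rightarrow> nat" where "rt n = root (F n)"

lemma rt_L: "rt \<in> L"
  unfolding rt_def lim_verts_def using rooted_treeD(2)[OF RT] tmorD(4)[OF tm_step] by simp

lemma rt_le: "x \<in> L \<Longrightarrow> rt \<sqsubseteq> x"
  unfolding le_def rt_def using rt_L tle_root[OF RT] LD by (simp add: rt_def[abs_def])

lemma E_par:
  assumes "(x, y) \<in> E" "x \<sqsubseteq> y" "x n \<noteq> y n"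
  shows "y n \<noteq> root (F n)" "x n = par (F n) (y n)"
  using tle_edge[OF RT leD(3)[OF assms(2)] ED(3)[OF assms(1)]] assms(3) by auto

text \<open>At a level where \<open>x\<close> and \<open>y\<close> differ, \<open>x\<close> is the
  parent of \<open>y\<close>, so a vertex below \<open>y\<close> but not below \<open>x\<close> is
  \<open>y\<close> itself.\<close>

lemma E_below:
  assumes xy: "(x, y) \<in> E" "x \<sqsubseteq> y" and t: "t \<sqsubseteq> y"
  shows "t = y \<or> t \<sqsubseteq> x"
proof (cases "\<forall>n. \<exists>m\<ge>n. tle (F m) (t m) (x m)")
  case True
  then show ?thesis using le_cofinal leD xy t by metis
next
  case False
  then obtain N where N: "\<And>m. m \<ge> N \<Longrightarrow> \<not> tle (F m) (t m) (x m)" by blast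
  have "t m = y m" if "m \<ge> N" for m
  proof (rule ccontr)
    assume "t m \<noteq> y m"
    then have tp: "tle (F m) (t m) (par (F m) (y m))" using tle_lt_par[OF RT leD(3)[OF t]] by blast
    moreover have "x m \<noteq> y m" using N[OF that] leD(3)[OF t, of m] by auto
    ultimately show False using E_par[OF xy, of m] N[OF that] by simp
  qed
  then show ?thesis using L_eqI[of t y N] leD t by blast
qed

text \<open>False in a finite tree, where \<open>x\<close> may have other children; the extension
  property forces it. Split the edge from \<open>x n\<close> to \<open>y n\<close> by a vertex
  \<open>w\<close> over \<open>x n\<close>. The factor map must send \<open>x\<close> to
  \<open>w\<close>, whose only child is \<open>y n\<close>, so whatever lies above \<open>x\<close>
  is sent to \<open>w\<close> or above \<open>y n\<close>.\<close>

lemma E_above: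
  assumes xy: "(x, y) \<in> E" "x \<sqsubseteq> y" "x \<noteq> y" and z: "x \<sqsubseteq> z"
  shows "z = x \<or> y \<sqsubseteq> z"
proof -
  obtain n0 where n0: "x n0 \<noteq> y n0" using xy(3) by (meson ext)
  have L: "x \<in> L" "y \<in> L" "z \<in> L" using leD xy z by auto
  have key: "z n = x n \<or> tle (F n) (y n) (z n)" if n: "n \<ge> n0" for n
  proof -
    let ?T = "F n"
    have ne: "x n \<noteq> y n" using L_neq_up[OF L(1,2) n n0] .
    note yp = E_par[OF xy(1,2) ne]
    obtain w B g where w: "w \<notin> verts ?T" and B: "rooted_tree B" "sc_epi B ?T g" "verts B = insert w (verts ?T)"
      "root B = root ?T" "par B w = par ?T (y n)" "par B (y n) = w"
      and pB: "\<And>v. v \<in> verts ?T \<Longrightarrow> v \<noteq> y n \<Longrightarrow> par B v = par ?T v"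
      and g: "\<And>v. v \<in> verts ?T \<Longrightarrow> g v = v" "g w = x n"
      using split_ex[OF RT LD(1)[OF L(2), of n] yp(1), of "x n"] yp(2) by metis
    obtain m h where h: "m \<ge> n" "tmor (F m) B h" "\<And>v. v \<in> verts (F m) \<Longrightarrow> g (h v) = bnd n m v"
      using extension[OF B(1,2)] by metis
    have hB: "h (u m) \<in> verts B" "g (h (u m)) = u n" if "u \<in> L" for u
      using tmorD(8)[OF h(2) LD(1)[OF that]] h(3)[OF LD(1)[OF that]] L_bnd[OF that h(1)] by auto
    \<comment> \<open>Only \<open>y n\<close> itself lies over \<open>y n\<close> in
      \<open>B\<close>, and its parent there is \<open>w\<close>. Adjacency of the threads therefore
      leaves \<open>w\<close> as the only possible image of \<open>x m\<close>.\<close>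
    have hy: "h (y m) = y n" using hB[OF L(2)] B(3) g ne by force
    have hx: "h (x m) \<noteq> y n" using hB[OF L(1)] g(1)[OF LD(1)[OF L(2)]] ne by force
    have "tle B (h (x m)) (h (y m))" "(h (x m), h (y m)) \<in> edges B"
      using tmorD(5,6)[OF h(2)] leD(3)[OF xy(2)] ED(3)[OF xy(1)] by auto
    then have hxw: "h (x m) = w" using tle_edge[OF B(1)] hx hy B(6) by metis
    have wz: "tle B w (h (z m))" using tmorD(6)[OF h(2) leD(3)[OF z]] hxw by simp
    have "h (z m) = w \<or> tle B (y n) (h (z m))"
    proof (rule ccontr)
      assume c: "\<not> (h (z m) = w \<or> tle B (y n) (h (z m)))"
      have yB: "y n \<in> verts B" using hB(1)[OF L(2)] hy by simp
      \<comment> \<open>The vertices different from \<open>w\<close> and not above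
        \<open>y n\<close> are closed under parents, so none of them lies above
        \<open>w\<close>.\<close>
      have "w \<in> {v \<in> verts B. v \<noteq> w \<and> \<not> tle B (y n) v}"
      proof (rule tle_closed[OF B(1) wz])
        show "h (z m) \<in> {v \<in> verts B. v \<noteq> w \<and> \<not> tle B (y n) v}" using c hB(1)[OF L(3)] by auto
        fix v assume v: "v \<in> {v \<in> verts B. v \<noteq> w \<and> \<not> tle B (y n) v}" "v \<in> verts B" "v \<noteq> root B"
        then have v': "v \<in> verts ?T" "v \<noteq> y n" using B(3) tle_refl[OF yB] by auto
        have "par B v \<noteq> w" using pB[OF v'] par_in[OF RT v'(1)] w by metis
        moreover have "\<not> tle B (y n) (par B v)"
          using v tle_trans[OF B(1) _ tle_par[OF B(1) v(2)], of "y n"] by blast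
        ultimately show "par B v \<in> {v \<in> verts B. v \<noteq> w \<and> \<not> tle B (y n) v}"
          using par_in[OF B(1) v(2)] by simp
      qed
      then show False by simp
    qed
    then show ?thesis
    proof
      assume "h (z m) = w"
      then show ?thesis using hB(2)[OF L(3)] g(2) by simp
    next
      assume "tle B (y n) (h (z m))"
      then have "tle ?T (g (y n)) (g (h (z m)))" by (rule tmorD(6)[OF sc_epi_tmor[OF B(2)]])
      then show ?thesis using hB(2)[OF L(3)] g(1)[OF LD(1)[OF L(2)]] by simp
    qed
  qed
  show ?thesis
  proof (cases "\<forall>n. \<exists>m\<ge>n. tle (F m) (y m) (z m)")
    case True
    then show ?thesis using le_cofinal[OF L(2,3)] by blast
  next
    case False
    then obtain N where N: "\<And>m. m \<ge> N \<Longrightarrow> \<not> tle (F m) (y m) (z m)" by blast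
    have "z m = x m" if "m \<ge> max N n0" for m using key[of m] N[of m] that by auto
    then show ?thesis using L_eqI[OF L(3,1)] by blast
  qed
qed

text \<open>Split the lower edge by a vertex \<open>w\<close> over \<open>y n\<close>. Adjacency to
  the image of \<open>x\<close> forces the factor map to send \<open>y\<close> to \<open>w\<close>,
  while adjacency to the image of \<open>z\<close> would require \<open>y n\<close>, the parent of
  \<open>z n\<close>.\<close>

lemma no_E_chain:
  assumes xy: "(x, y) \<in> E" "x \<sqsubseteq> y" "x \<noteq> y" and yz: "(y, z) \<in> E" "y \<sqsubseteq> z" "y \<noteq> z"
  shows False
proof -
  obtain n1 n2 where n12: "x n1 \<noteq> y n1" "y n2 \<noteq> z n2" using xy(3) yz(3) by (meson ext)
  define n where "n = max n1 n2"
  let ?T = "F n"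
  have L: "x \<in> L" "y \<in> L" "z \<in> L" using leD xy yz by auto
  have ne: "x n \<noteq> y n" "y n \<noteq> z n"
    using L_neq_up[OF L(1,2) _ n12(1)] L_neq_up[OF L(2,3) _ n12(2)] unfolding n_def by auto
  note yp = E_par[OF xy(1,2) ne(1)] and zp = E_par[OF yz(1,2) ne(2)]
  obtain w B g where w: "w \<notin> verts ?T" and B: "rooted_tree B" "sc_epi B ?T g" "verts B = insert w (verts ?T)"
    "root B = root ?T" "par B w = par ?T (y n)" "par B (y n) = w"
    and pB: "\<And>v. v \<in> verts ?T \<Longrightarrow> v \<noteq> y n \<Longrightarrow> par B v = par ?T v"
    and g: "\<And>v. v \<in> verts ?T \<Longrightarrow> g v = v" "g w = y n"
    using split_ex[OF RT LD(1)[OF L(2), of n] yp(1), of "y n"] by metis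
  obtain m h where h: "m \<ge> n" "tmor (F m) B h" "\<And>v. v \<in> verts (F m) \<Longrightarrow> g (h v) = bnd n m v"
    using extension[OF B(1,2)] by metis
  have hB: "h (u m) \<in> verts B" "g (h (u m)) = u n" if "u \<in> L" for u
    using tmorD(8)[OF h(2) LD(1)[OF that]] h(3)[OF LD(1)[OF that]] L_bnd[OF that h(1)] by auto
  have hx: "h (x m) = x n" using hB[OF L(1)] B(3) g ne by force
  have hz: "h (z m) = z n" using hB[OF L(3)] B(3) g ne by force
  have hy: "h (y m) = y n \<or> h (y m) = w" using hB[OF L(2)] B(3) g ne by force
  have Lv: "x n \<in> verts ?T" "y n \<in> verts ?T" "z n \<in> verts ?T" using LD L by auto
  have tl: "tle B (h (x m)) (h (y m))" "(h (x m), h (y m)) \<in> edges B"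
    "tle B (h (y m)) (h (z m))" "(h (y m), h (z m)) \<in> edges B"
    using tmorD(5,6)[OF h(2)] leD(3)[OF xy(2)] ED(3)[OF xy(1)] leD(3)[OF yz(2)] ED(3)[OF yz(1)] by auto
  have "h (y m) \<noteq> y n"
    using tle_edge[OF B(1) tl(1,2)] hx ne w Lv B(6) by metis
  then have "h (y m) = w" using hy by simp
  then have "w = z n \<or> w = par B (z n)"
    using tle_edge[OF B(1) tl(3,4)] hz by metis
  moreover have "par B (z n) = y n" using pB[OF Lv(3)] ne zp by simp
  ultimately show False using w Lv by auto
qed

text \<open>Two neighbours of \<open>y\<close> on the same side coincide by \<open>E_below\<close>
  or \<open>E_above\<close>; neighbours on opposite sides are excluded by
  \<open>no_E_chain\<close>.\<close>

lemma E_trans: "trans E"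
proof (rule transI)
  fix x y z assume xy: "(x, y) \<in> E" and yz: "(y, z) \<in> E"
  note L = ED(1,2)[OF xy] ED(2)[OF yz]
  show "(x, z) \<in> E"
  proof (cases "x = y \<or> y = z \<or> x = z")
    case True
    then show ?thesis using xy yz E_refl L by auto
  next
    case False
    consider "x \<sqsubseteq> y" "y \<sqsubseteq> z" | "x \<sqsubseteq> y" "z \<sqsubseteq> y" | "y \<sqsubseteq> x" "y \<sqsubseteq> z" | "y \<sqsubseteq> x" "z \<sqsubseteq> y"
      using E_comparable[OF xy] E_comparable[OF yz] by blast
    then show ?thesis
    proof cases
      case 1
      then show ?thesis using no_E_chain[OF xy 1(1) _ yz 1(2)] False by blast
    next
      case 2
      then have "z \<sqsubseteq> x" "x \<sqsubseteq> z"
        using E_below[OF xy 2(1,2)] E_below[OF E_sym[OF yz] 2(2,1)] False by auto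
      then show ?thesis using le_antisym' False by blast
    next
      case 3
      then have "x \<sqsubseteq> z" "z \<sqsubseteq> x"
        using E_above[OF E_sym[OF xy] 3(1) _ 3(2)] E_above[OF yz 3(2) _ 3(1)] False by auto
      then show ?thesis using le_antisym' False by blast
    next
      case 4
      then show ?thesis using no_E_chain[OF E_sym[OF yz] 4(2) _ E_sym[OF xy] 4(1)] False by blast
    qed
  qed
qed

lemma E_equiv: "equiv L E"
proof (rule equivI)
  show "E \<subseteq> L \<times> L" by (auto simp: lim_edges_def)
  show "refl_on L E" by (auto simp: refl_on_def E_refl)
  show "sym E" using E_sym by (auto simp: sym_def)
qed (rule E_trans)

end

section \<open>Closed connected sets of threads and the lifting of subtrees\<close>

lemma gconnected_subset: "gconnected T Q \<Longrightarrow> Q \<subseteq> verts T"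
  unfolding gconnected_def by (rule conjunct1)

context tc_limit
begin

abbreviation level :: "nat \<Rightarrow> (nat \<Rightarrow> nat) set \<Rightarrow> nat set" where "level m Z \<equiv> (\<lambda>z. z m) ` Z"

text \<open>Closedness in terms of levels, which suits the finite trees;
  \<open>thread_closed_iff\<close> identifies it with topological closedness in
  \<open>L\<close>.\<close>

definition thread_closed :: "(nat \<Rightarrow> nat) set \<Rightarrow> bool" where
  "thread_closed Z \<longleftrightarrow> Z \<subseteq> L \<and> (\<forall>x\<in>L. (\<forall>m. x m \<in> level m Z) \<longrightarrow> x \<in> Z)"

text \<open>By \<open>connectedin_q\<close> and \<open>thread_conn_preim\<close>, this is what
  connectedness of a closed subset of the quotient amounts to for threads.\<close>

definition thread_conn :: "(nat \<Rightarrow> nat) set \<Rightarrow> bool" where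
  "thread_conn Z \<longleftrightarrow> (\<forall>m. gconnected (F m) (level m Z))"

lemma thread_closedI: "thread_closed {z \<in> L. \<forall>m\<ge>n. z m \<in> C m}"
  unfolding thread_closed_def by (auto simp: image_iff) metis

lemma gconnected_bnd: "n \<le> m \<Longrightarrow> gconnected (F m) Q \<Longrightarrow> gconnected (F n) (bnd n m ` Q)"
  using tmorD(3,5)[OF tm_bnd] by (intro gconnected_image[where A = "F m"]) auto

lemma level_bnd: "Z \<subseteq> L \<Longrightarrow> n \<le> m \<Longrightarrow> bnd n m ` level m Z = level n Z"
  unfolding image_image by (rule image_cong[OF refl]) (use L_bnd in blast)

text \<open>The sets \<open>C m\<close> may be larger than the levels of the limit set, but by
  \<open>lim_image\<close> each such level is the image of some \<open>C k\<close> and hence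
  connected.\<close>

lemma lim_conn:
  assumes C: "\<And>m. m \<ge> n \<Longrightarrow> gconnected (F m) (C m)" "\<And>m. m \<ge> n \<Longrightarrow> \<alpha> m ` C (Suc m) \<subseteq> C m"
  shows "thread_conn {z \<in> L. \<forall>m\<ge>n. z m \<in> C m}"
  unfolding thread_conn_def
proof
  fix m
  let ?Z = "{z \<in> L. \<forall>m\<ge>n. z m \<in> C m}"
  have CV: "C m \<subseteq> verts (F m)" if "m \<ge> n" for m by (rule gconnected_subset[OF C(1)[OF that]])
  have ge: "gconnected (F m) (level m ?Z)" if m: "m \<ge> n" for m
  proof -
    have "\<exists>k\<ge>m. level m ?Z = bnd m k ` C k" by (rule lim_image) (use CV C(2) m in auto)
    then obtain k where "k \<ge> m" "level m ?Z = bnd m k ` C k" by (elim exE conjE)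
    then show ?thesis using gconnected_bnd[of m k "C k"] C(1)[of k] m by simp
  qed
  show "gconnected (F m) (level m ?Z)"
  proof (cases "m \<ge> n")
    case False
    have "level m ?Z = bnd m n ` level n ?Z" using level_bnd[of ?Z m n] False by auto
    then show ?thesis using gconnected_bnd[of m n] ge[of n] False by simp
  qed (rule ge)
qed

lemma interval_eq: "{t. s \<sqsubseteq> t \<and> t \<sqsubseteq> x} = {z \<in> L. \<forall>m\<ge>0. z m \<in> {v. tle (F m) (s m) v \<and> tle (F m) v (x m)}}"
  if "s \<in> L" "x \<in> L"
  using that by (auto simp: le_def)

lemma interval_closed_conn:
  assumes "s \<in> L" "x \<in> L"
  shows "thread_closed {t. s \<sqsubseteq> t \<and> t \<sqsubseteq> x}" "thread_conn {t. s \<sqsubseteq> t \<and> t \<sqsubseteq> x}"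
proof -
  show "thread_closed {t. s \<sqsubseteq> t \<and> t \<sqsubseteq> x}"
    unfolding interval_eq[OF assms] by (rule thread_closedI)
  show "thread_conn {t. s \<sqsubseteq> t \<and> t \<sqsubseteq> x}"
    unfolding interval_eq[OF assms]
  proof (rule lim_conn)
    fix m
    show "gconnected (F m) {v. tle (F m) (s m) v \<and> tle (F m) v (x m)}"
      by (rule gconnected_interval[OF RT]) (use LD assms in auto)
    show "\<alpha> m ` {v. tle (F (Suc m)) (s (Suc m)) v \<and> tle (F (Suc m)) v (x (Suc m))}
        \<subseteq> {v. tle (F m) (s m) v \<and> tle (F m) v (x m)}"
      using tmorD(6)[OF tm_step, of m] LD(2) assms by fastforce
  qed
qed

text \<open>By \<open>tmor_down_surj\<close>, the vertices below \<open>y k\<close> are mapped onto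
  those below \<open>y m\<close>, so \<open>v\<close> survives in the limit of these
  down-sets.\<close>

lemma down_level:
  assumes y: "y \<in> L" and v: "tle (F m) v (y m)"
  obtains t where "t \<sqsubseteq> y" "t m = v"
proof -
  let ?C = "\<lambda>m. {v. tle (F m) v (y m)}"
  let ?Z = "{z \<in> L. \<forall>m\<ge>0. z m \<in> ?C m}"
  have "\<exists>k\<ge>m. level m ?Z = bnd m k ` ?C k"
  proof (rule lim_image)
    fix m
    show "?C m \<subseteq> verts (F m)" using tleD(1) by blast
    show "\<alpha> m ` ?C (Suc m) \<subseteq> ?C m"
      using tmorD(6)[OF tm_step, of m] LD(2)[OF y] by fastforce
  qed simp
  then obtain k where k: "k \<ge> m" "level m ?Z = bnd m k ` ?C k" by (elim exE conjE)
  have "tle (F m) v (bnd m k (y k))" using L_bnd[OF y k(1)] v by simp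
  then obtain a where "tle (F k) a (y k)" "bnd m k a = v"
    using tmor_down_surj[OF tm_bnd[OF k(1)] LD(1)[OF y]] by blast
  then have "v \<in> level m ?Z" unfolding k(2) by blast
  then obtain t where "t \<in> ?Z" "t m = v" by blast
  then show thesis using that[of t] y by (simp add: le_def)
qed

text \<open>Confluence of the bonding maps passes to the limit. \<open>C m\<close> is the component
  of \<open>y m\<close> in the preimage of \<open>T\<close>, and lifting \<open>T\<close> from
  \<open>y m\<close> shows that it is mapped onto \<open>T\<close>.\<close>

lemma confluent_thread:
  assumes T: "gconnected (F n) T" and y: "y \<in> L" "y n \<in> T"
  obtains Z where "thread_closed Z" "thread_conn Z" "y \<in> Z" "level n Z = T"
proof -
  define C where "C m = \<Union>{K. gconnected (F m) K \<and> y m \<in> K \<and> bnd n m ` K \<subseteq> T}" for m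
  let ?Z = "{z \<in> L. \<forall>m\<ge>n. z m \<in> C m}"
  have C: "gconnected (F m) (C m)" for m
    unfolding C_def by (rule gconnected_Union[where y = "y m"]) blast
  have st: "\<alpha> m ` C (Suc m) \<subseteq> C m" if m: "m \<ge> n" for m
  proof
    fix v assume "v \<in> \<alpha> m ` C (Suc m)"
    then obtain K where K: "gconnected (F (Suc m)) K" "y (Suc m) \<in> K" "bnd n (Suc m) ` K \<subseteq> T" "v \<in> \<alpha> m ` K"
      unfolding C_def by blast
    have "gconnected (F m) (\<alpha> m ` K)"
      using gconnected_bnd[of m "Suc m" K] K(1) by (simp add: bond_one[abs_def])
    moreover have "y m \<in> \<alpha> m ` K" using K(2) LD(2)[OF y(1), of m] by (metis imageI)
    moreover have "bnd n m ` \<alpha> m ` K \<subseteq> T" using K(3) m by (simp add: image_image bond_Suc)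
    ultimately show "v \<in> C m" unfolding C_def using K(4) by blast
  qed
  have yC: "y m \<in> C m" if m: "m \<ge> n" for m
  proof -
    have "gconnected (F m) {y m}" by (rule gconnected_singleton[OF RT LD(1)[OF y(1)]])
    then show ?thesis unfolding C_def using L_bnd[OF y(1) m] y(2) by auto
  qed
  have onto: "bnd n m ` C m = T" if m: "m \<ge> n" for m
  proof
    show "bnd n m ` C m \<subseteq> T" unfolding C_def by blast
    obtain K where K: "{y m} \<subseteq> K" "gconnected (F m) K" "bnd n m ` K = T"
      by (rule lifts_connD[OF tmorD(7)[OF tm_bnd[OF m]] T gconnected_singleton[OF RT LD(1)[OF y(1)]]])
        (use L_bnd[OF y(1) m] y(2) in auto)
    then have "K \<subseteq> C m" unfolding C_def by blast
    then show "T \<subseteq> bnd n m ` C m" using K(3) by blast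
  qed
  have "\<exists>k\<ge>n. level n ?Z = bnd n k ` C k"
    by (rule lim_image) (use gconnected_subset[OF C] st in auto)
  then have "level n ?Z = T" using onto by auto
  moreover have "thread_conn ?Z" by (rule lim_conn) (use C st in auto)
  moreover have "y \<in> ?Z" using y yC by simp
  ultimately show thesis using that[OF thread_closedI] by blast
qed

text \<open>Above a thread sent to an added leaf, no thread can leave the fibre of \<open>v\<close>.
  In particular a maximal thread above \<open>z\<close> stays there, which puts end points into
  every cylinder.\<close>

lemma leaf_thread:
  assumes v: "v \<in> verts (F n)"
  obtains z where "z \<in> L" "z n = v" "\<And>z'. z \<sqsubseteq> z' \<Longrightarrow> z' n = v"
proof -
  obtain y B g where B: "rooted_tree B" "sc_epi B (F n) g" "y \<in> verts B" "g y = v" and leaf: "\<And>w. tle B y w \<Longrightarrow> w = y"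
    using leaf_ex[OF RT v] by metis
  obtain m h where h: "m \<ge> n" "tmor (F m) B h" "\<And>v. v \<in> verts (F m) \<Longrightarrow> g (h v) = bnd n m v"
    using extension[OF B(1,2)] by metis
  have "y \<in> h ` verts (F m)" using tmorD(3)[OF h(2)] B(3) by simp
  then obtain u where u: "u \<in> verts (F m)" "h u = y" by auto
  then obtain z where z: "z \<in> L" "z m = u" using L_surj by blast
  have up: "z' n = v" if "z \<sqsubseteq> z'" for z'
  proof -
    have "tle B (h (z m)) (h (z' m))" by (rule tmorD(6)[OF h(2) leD(3)[OF that]])
    then have "h (z' m) = y" using leaf z(2) u(2) by simp
    then show ?thesis using h(3)[OF LD(1)[OF leD(2)[OF that]]] L_bnd[OF leD(2)[OF that] h(1)] B(4) by simp
  qed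
  show thesis
    by (rule that[OF z(1) up[OF le_refl'[OF z(1)]]]) (rule up)
qed

section \<open>Threads branching off at a given thread\<close>

text \<open>The upper thread of its edge class, which need not be maximal. All threads strictly
  above it lie in other classes.\<close>

definition top_thread :: "(nat \<Rightarrow> nat) \<Rightarrow> bool" where
  "top_thread x \<longleftrightarrow> x \<in> L \<and> (\<forall>c. (x, c) \<in> E \<longrightarrow> x \<sqsubseteq> c \<longrightarrow> c = x)"

lemma child_below:
  assumes T: "rooted_tree T" and xy: "tle T x y" "x \<noteq> y"
  obtains c where "tle T c y" "c \<noteq> root T" "par T c = x"
proof -
  have "y \<in> verts T" using xy by (auto dest: tleD)
  with T have "tle T x y \<longrightarrow> x \<noteq> y \<longrightarrow> (\<exists>c. tle T c y \<and> c \<noteq> root T \<and> par T c = x)"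
  proof (induction y rule: tree_induct)
    case root
    then show ?case by (simp add: tle_root_iff[OF T])
  next
    case (par v)
    show ?case
    proof (cases "par T v = x")
      case True
      then show ?thesis using par(1,2) tle_refl by blast
    next
      case False
      then show ?thesis
        using par tle_lt_par[OF T, of x v] tle_trans[OF T _ tle_par[OF T par(1)]] by metis
    qed
  qed
  then show thesis using xy that by blast
qed

lemma child_unique:
  assumes T: "rooted_tree T" and c: "tle T c y" "c \<noteq> root T" and d: "tle T d y" "d \<noteq> root T" and e: "par T c = par T d"
  shows "c = d"
proof -
  have h: "ht T c = ht T d"
    using ht_par[OF T tleD(1)[OF c(1)] c(2)] ht_par[OF T tleD(1)[OF d(1)] d(2)] e by simp
  then show ?thesis using tle_chain[OF T c(1) d(1)] tle_ht[OF T] by fastforce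
qed

text \<open>Otherwise the successors of \<open>x m\<close> towards \<open>y m\<close> would form a thread adjacent to \<open>x\<close>.\<close>

lemma fibre_gap:
  assumes x: "top_thread x" and xy: "x \<sqsubseteq> y" and n: "x n \<noteq> y n"
  obtains m u where "m \<ge> n" "tle (F m) (x m) u" "u \<noteq> x m" "tle (F m) u (y m)" "bnd n m u = x n"
proof (rule ccontr)
  assume "\<not> thesis"
  then have no: "bnd n m u \<noteq> x n" if "m \<ge> n" "tle (F m) (x m) u" "u \<noteq> x m" "tle (F m) u (y m)" for m u
    using that \<open>\<And>m u. m \<ge> n \<Longrightarrow> tle (F m) (x m) u \<Longrightarrow> u \<noteq> x m \<Longrightarrow> tle (F m) u (y m) \<Longrightarrow> bnd n m u = x n \<Longrightarrow> thesis\<close> by blast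
  have xL: "x \<in> L" and yL: "y \<in> L" using leD[OF xy] by auto
  have "\<exists>c. tle (F m) c (y m) \<and> c \<noteq> root (F m) \<and> par (F m) c = x m" if "m \<ge> n" for m
    using child_below[OF RT leD(3)[OF xy] L_neq_up[OF xL yL that n]] by metis
  then obtain c where c: "\<And>m. m \<ge> n \<Longrightarrow> tle (F m) (c m) (y m)" "\<And>m. m \<ge> n \<Longrightarrow> c m \<noteq> root (F m)"
    "\<And>m. m \<ge> n \<Longrightarrow> par (F m) (c m) = x m"
    by metis
  have cV: "c m \<in> verts (F m)" if "m \<ge> n" for m using tleD(1)[OF c(1)[OF that]] .
  have xc: "tle (F m) (x m) (c m)" "c m \<noteq> x m" if "m \<ge> n" for m
    using tle_par[OF RT cV[OF that]] par_neq[OF RT cV[OF that] c(2)[OF that]] c(3)[OF that] by auto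
  \<comment> \<open>The image of the successor is not \<open>x m\<close>, for otherwise the
    successor would lie over \<open>x n\<close>. Its parent is sent to \<open>x m\<close>, so the
    image is again the child of \<open>x m\<close> towards \<open>y m\<close>.\<close>
  have step: "\<alpha> m (c (Suc m)) = c m" if m: "m \<ge> n" for m
  proof -
    have m': "Suc m \<ge> n" using m by simp
    have "bnd n (Suc m) (c (Suc m)) \<noteq> x n" using no[OF m' xc[OF m'] c(1)[OF m']] .
    then have "\<alpha> m (c (Suc m)) \<noteq> x m" using L_bnd[OF xL m] m by (auto simp: bond_Suc)
    moreover have "\<alpha> m (par (F (Suc m)) (c (Suc m))) = x m" using c(3)[OF m'] LD(2)[OF xL] by simp
    ultimately have "\<alpha> m (c (Suc m)) \<noteq> root (F m)" "par (F m) (\<alpha> m (c (Suc m))) = x m"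
      using tmor_par[OF tm_step cV[OF m']] by auto
    moreover have "tle (F m) (\<alpha> m (c (Suc m))) (y m)"
      using tmorD(6)[OF tm_step c(1)[OF m']] LD(2)[OF yL] by simp
    ultimately show ?thesis
      using child_unique[OF RT _ _ c(1)[OF m] c(2)[OF m]] c(3)[OF m] by metis
  qed
  obtain z where z: "z \<in> L" "\<And>i. z (n + i) = c (n + i)"
    using thread_ex[of "\<lambda>i. c (n + i)" n] cV step by auto
  have zc: "z m = c m" if "m \<ge> n" for m using z(2)[of "m - n"] that by simp
  have xz: "x \<sqsubseteq> z"
    by (rule le_cofinal[OF xL z(1)]) (metis max.cobounded1 max.cobounded2 xc(1) zc)
  have "(x m, z m) \<in> edges (F m)" for m
  proof -
    let ?k = "max n m"
    have "(x ?k, z ?k) \<in> edges (F ?k)"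
      using zc[of ?k] c(3)[of ?k] cV[of ?k] LD(1)[OF xL, of ?k] by (simp add: edges_iff[OF RT])
    then have "(bnd m ?k (x ?k), bnd m ?k (z ?k)) \<in> edges (F m)"
      using tmorD(5)[OF tm_bnd, of m ?k] by simp
    then show ?thesis using L_bnd[OF xL, of m ?k] L_bnd[OF z(1), of m ?k] by simp
  qed
  then have "(x, z) \<in> E" using xL z(1) by (simp add: lim_edges_def)
  then have "z = x" using x xz unfolding top_thread_def by blast
  then show False using xc(2)[of n] zc[of n] by simp
qed

text \<open>For fixed \<open>n\<close> this is an open condition on \<open>z\<close>, because each
  witness \<open>m\<close> involves only the coordinate \<open>z m\<close>. Required for all large
  \<open>n\<close>, it says that common lower bounds of \<open>y\<close> and \<open>z\<close> lie
  below \<open>x\<close>; see \<open>branches_off_meet\<close>.\<close>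

definition branches_off :: "(nat \<Rightarrow> nat) \<Rightarrow> (nat \<Rightarrow> nat) \<Rightarrow> nat \<Rightarrow> (nat \<Rightarrow> nat) \<Rightarrow> bool" where
  "branches_off x y n z \<longleftrightarrow> (\<exists>m\<ge>n. \<forall>t. tle (F m) t (y m) \<longrightarrow> tle (F m) t (z m) \<longrightarrow> tle (F n) (bnd n m t) (x n))"

text \<open>Above a fibre vertex \<open>u > x m\<close> over \<open>x n\<close> the tree is doubled; confluence then moves \<open>z\<close>
  to the copy avoiding \<open>y\<close>, and \<open>u > x m\<close> keeps the new thread above \<open>x\<close>.\<close>

lemma branches_off_dense:
  assumes x: "top_thread x" and xy: "x \<sqsubseteq> y" and xz: "x \<sqsubseteq> z" and n: "x n \<noteq> y n"
  obtains z' where "x \<sqsubseteq> z'" "z' n = z n" "branches_off x y n z'"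
proof (cases "branches_off x y n z")
  case True
  then show thesis using that xz by blast
next
  case False
  have L: "x \<in> L" "y \<in> L" "z \<in> L" using leD xy xz by auto
  obtain m u where m: "m \<ge> n" and u: "tle (F m) (x m) u" "u \<noteq> x m" "tle (F m) u (y m)" "bnd n m u = x n"
    by (rule fibre_gap[OF x xy n])
  obtain t where t: "tle (F m) t (y m)" "tle (F m) t (z m)" "\<not> tle (F n) (bnd n m t) (x n)"
    using False m unfolding branches_off_def by blast
  \<comment> \<open>A common lower bound \<open>t\<close> violating the condition cannot lie below
    \<open>u\<close>, so \<open>u\<close> is strictly below \<open>z m\<close> and the doubling
    above \<open>u\<close> offers a choice of preimages for \<open>z m\<close>.\<close>
  have ntu: "\<not> tle (F m) t u" using tmorD(6)[OF tm_bnd[OF m], of t u] u(4) t(3) by auto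
  then have ut: "tle (F m) u t" using tle_chain[OF RT u(3) t(1)] by blast
  then have uz: "tle (F m) u (z m)" "u \<noteq> z m" using tle_trans[OF RT ut t(2)] ntu t(2) by auto
  have uV: "u \<in> verts (F m)" using u(1) by (rule tleD)
  obtain B g where B: "rooted_tree B" "sc_epi B (F m) g" "u \<in> verts B" "g u = u"
    and gu: "\<And>v. v \<in> verts B \<Longrightarrow> g v = u \<Longrightarrow> v = u"
    and sep: "\<And>y z. y \<in> verts B \<Longrightarrow> tle (F m) u z \<Longrightarrow> u \<noteq> z \<Longrightarrow>
      \<exists>z'\<in>verts B. g z' = z \<and> (\<forall>t. tle B t y \<longrightarrow> tle B t z' \<longrightarrow> tle (F m) (g t) u)"
    using double_ex[OF RT uV] by metis
  note tg = sc_epi_tmor[OF B(2)]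
  obtain k h where k: "k \<ge> m" and h: "tmor (F k) B h" "\<And>v. v \<in> verts (F k) \<Longrightarrow> g (h v) = bnd m k v"
    using extension[OF B(1,2)] by metis
  have gh: "g (h (w k)) = w m" if "w \<in> L" for w using h(2)[OF LD(1)[OF that]] L_bnd[OF that k] by simp
  have hyB: "h (y k) \<in> verts B" by (rule tmorD(8)[OF h(1) LD(1)[OF L(2)]])
  \<comment> \<open>A preimage of \<open>z m\<close> that shares with the image of \<open>y\<close>
    only lower bounds over the part up to \<open>u\<close>.\<close>
  obtain zs where zs: "zs \<in> verts B" "g zs = z m" "\<And>t. tle B t (h (y k)) \<Longrightarrow> tle B t zs \<Longrightarrow> tle (F m) (g t) u"
    using sep[OF hyB uz] by blast
  have below: "tle B u b" if b: "b \<in> verts B" "tle (F m) u (g b)" for b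
  proof -
    obtain a where a: "tle B a b" "g a = u" using tmor_down_surj[OF tg b] by blast
    then show ?thesis using gu[OF tleD(1)[OF a(1)] a(2)] by simp
  qed
  have "tle B u (h (y k))" by (rule below[OF hyB]) (use gh[OF L(2)] u(3) in simp)
  then obtain v where v: "tle (F k) v (y k)" "h v = u"
    using tmor_down_surj[OF h(1) LD(1)[OF L(2)]] by blast
  \<comment> \<open>The lifting starts at a thread below \<open>y\<close> that is sent to
    \<open>u\<close>. From there the interval between \<open>u\<close> and \<open>zs\<close> lifts
    to a closed connected set of threads, which contains the desired \<open>z'\<close>.\<close>
  obtain y' where y': "y' \<sqsubseteq> y" "y' k = v" by (rule down_level[OF L(2) v(1)])
  have y'L: "y' \<in> L" using leD y' by blast
  have uzs: "tle B u zs" by (rule below[OF zs(1)]) (use zs(2) uz in simp)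
  let ?Q = "{t. tle B u t \<and> tle B t zs}"
  have Q: "gconnected B ?Q" by (rule gconnected_interval[OF B(1,3)])
  have uQ: "u \<in> ?Q" using uzs tle_refl[OF B(3)] by simp
  obtain K where K: "{v} \<subseteq> K" "gconnected (F k) K" "h ` K = ?Q"
    by (rule lifts_connD[OF tmorD(7)[OF h(1)] Q gconnected_singleton[OF RT tleD(1)[OF v(1)]]])
      (use uQ v(2) in auto)
  have "y' k \<in> K" using y'(2) K(1) by simp
  then obtain Z where Z: "thread_closed Z" "thread_conn Z" "y' \<in> Z" "level k Z = K"
    by (rule confluent_thread[OF K(2) y'L])
  have ZL: "Z \<subseteq> L" using Z(1) by (simp add: thread_closed_def)
  have "zs \<in> h ` level k Z" unfolding Z(4) K(3) using uzs tle_refl[OF zs(1)] by simp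
  then obtain z' where z': "z' \<in> Z" "h (z' k) = zs" by auto
  have z'L: "z' \<in> L" using z' ZL by auto
  have notle: "\<not> tle (F m) u (x m)" using tle_antisym[OF RT u(1)] u(2) by auto
  have xy': "x \<sqsubseteq> y'"
  proof (rule ccontr)
    assume "\<not> x \<sqsubseteq> y'"
    then have "y' \<sqsubseteq> x" using le_chain[OF xy y'(1)] by blast
    then have "tle (F m) (y' m) (x m)" by (rule leD)
    moreover have "y' m = u" using gh[OF y'L] y'(2) v(2) B(4) by simp
    ultimately show False using notle by simp
  qed
  have xz': "x \<sqsubseteq> z'"
  proof (rule le_cofinal[OF L(1) z'L])
    fix i
    let ?j = "max i k"
    have jk: "?j \<ge> k" "?j \<ge> m" using k by auto
    \<comment> \<open>The least vertex of a level of \<open>Z\<close> lies over a vertex above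
      \<open>u\<close>, so it is not below \<open>x\<close>. Both it and \<open>x\<close> are below
      \<open>y'\<close>, hence \<open>x\<close> is below it and so below \<open>z'\<close>.\<close>
    have conn: "gconnected (F ?j) (level ?j Z)" using Z(2) by (simp add: thread_conn_def)
    obtain \<mu> where \<mu>: "\<mu> \<in> level ?j Z" "\<And>w. w \<in> level ?j Z \<Longrightarrow> tle (F ?j) \<mu> w"
      by (rule gconnected_min[OF RT conn]) (use Z(3) in blast, metis)
    obtain \<zeta> where \<zeta>: "\<zeta> \<in> Z" "\<mu> = \<zeta> ?j" using \<mu>(1) by auto
    have \<zeta>L: "\<zeta> \<in> L" using \<zeta> ZL by auto
    have "h (\<zeta> k) \<in> ?Q" using K(3) Z(4) \<zeta>(1) by blast
    then have "tle (F m) (g u) (g (h (\<zeta> k)))" using tmorD(6)[OF tg] by blast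
    then have u\<zeta>: "tle (F m) u (\<zeta> m)" using gh[OF \<zeta>L] B(4) by simp
    have "tle (F ?j) \<mu> (y' ?j)" "tle (F ?j) \<mu> (z' ?j)" using \<mu>(2)[of "y' ?j"] \<mu>(2)[of "z' ?j"] Z(3) z'(1) by simp_all
    moreover have "\<not> tle (F ?j) \<mu> (x ?j)"
    proof
      assume "tle (F ?j) \<mu> (x ?j)"
      then have "tle (F m) (\<zeta> m) (x m)" using tle_down[OF \<zeta>L L(1) jk(2)] \<zeta>(2) by simp
      then show False using tle_trans[OF RT u\<zeta>] notle by blast
    qed
    ultimately have "tle (F ?j) (x ?j) (z' ?j)"
      using tle_chain[OF RT leD(3)[OF xy', of ?j]] tle_trans[OF RT] by metis
    then show "\<exists>m\<ge>i. tle (F m) (x m) (z' m)" by (intro exI[of _ ?j]) simp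
  qed
  have "z' m = z m" using gh[OF z'L] z'(2) zs(2) by simp
  then have "z' n = z n" using L_eq_down[OF z'L L(3) m] by simp
  moreover have "branches_off x y n z'"
    unfolding branches_off_def
  proof (intro exI[of _ k] conjI allI impI)
    show "n \<le> k" using m k by simp
    fix t assume t: "tle (F k) t (y k)" "tle (F k) t (z' k)"
    have "tle (F m) (g (h t)) u"
      using zs(3) tmorD(6)[OF h(1) t(1)] tmorD(6)[OF h(1) t(2)] z'(2) by simp
    then have "tle (F m) (bnd m k t) u" using h(2)[OF tleD(1)[OF t(1)]] by simp
    then have "tle (F n) (bnd n m (bnd m k t)) (bnd n m u)" by (rule tmorD(6)[OF tm_bnd[OF m]])
    then show "tle (F n) (bnd n k t) (x n)" using bond_bond[OF m k] u(4) by simp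
  qed
  ultimately show thesis using that xz' by blast
qed

lemma branches_off_meet:
  assumes xz: "x \<in> L" and n: "\<And>n. n \<ge> n0 \<Longrightarrow> branches_off x y n z" and t: "t \<sqsubseteq> y" "t \<sqsubseteq> z"
  shows "t \<sqsubseteq> x"
proof (rule le_cofinal[OF leD(1)[OF t(1)] xz])
  fix i
  obtain m where "m \<ge> max i n0" "\<And>t. tle (F m) t (y m) \<Longrightarrow> tle (F m) t (z m) \<Longrightarrow> tle (F (max i n0)) (bnd (max i n0) m t) (x (max i n0))"
    using n[of "max i n0"] unfolding branches_off_def by auto
  then have "tle (F (max i n0)) (t (max i n0)) (x (max i n0))"
    using leD(3)[OF t(1)] leD(3)[OF t(2)] L_bnd[OF leD(1)[OF t(1)]] by metis
  then show "\<exists>m\<ge>i. tle (F m) (t m) (x m)" by (intro exI[of _ "max i n0"]) simp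
qed

end

subsection \<open>Continuous functions on the threads\<close>

text \<open>Edges are coded by their upper end points.\<close>

definition big_step :: "rtree \<Rightarrow> (nat \<Rightarrow> real) \<Rightarrow> real \<Rightarrow> nat set" where
  "big_step T \<phi> e = {b \<in> verts T. b \<noteq> root T \<and> e < \<bar>\<phi> b - \<phi> (par T b)\<bar>}"

text \<open>Every edge along which \<open>\<phi>\<close> varies by more than \<open>d / 3\<close> is split into three edges. The two new vertices
  carry the intermediate values and are mapped to the nearer end point. That only end points of such edges are
  affected keeps the errors from accumulating in the induction.\<close>

lemma subdivide_thirds:
  assumes "rooted_tree T" and "\<forall>b\<in>verts T. \<bar>\<phi> b - \<phi> (par T b)\<bar> \<le> d"
  shows "\<exists>B g \<psi>. rooted_tree B \<and> sc_epi B T g \<and> (\<forall>b\<in>verts B. \<bar>\<psi> b - \<psi> (par B b)\<bar> \<le> d / 3) \<and>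
    (\<forall>b\<in>verts B. \<psi> b = \<phi> (g b) \<or> \<bar>\<psi> b - \<phi> (g b)\<bar> \<le> d / 3 \<and>
       g b \<in> big_step T \<phi> (d / 3) \<union> par T ` big_step T \<phi> (d / 3)) \<and>
    ((\<forall>b\<in>verts T. \<phi> (par T b) \<le> \<phi> b) \<longrightarrow> (\<forall>b\<in>verts B. \<psi> (par B b) \<le> \<psi> b))"
  using assms
proof (induction "card (big_step T \<phi> (d / 3))" arbitrary: T \<phi>)
  case 0
  have fin: "finite (big_step T \<phi> (d / 3))" unfolding big_step_def using rooted_treeD(1)[OF 0(2)] by simp
  then have empty: "big_step T \<phi> (d / 3) = {}" using 0 by simp
  have d0: "0 \<le> d" using bspec[OF 0(3) rooted_treeD(2)[OF 0(2)]] by simp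
  have "\<bar>\<phi> b - \<phi> (par T b)\<bar> \<le> d / 3" if "b \<in> verts T" for b
  proof (cases "b = root T")
    case True
    then show ?thesis using d0 by simp
  next
    case False
    then have "b \<notin> big_step T \<phi> (d / 3) \<Longrightarrow> ?thesis" using that unfolding big_step_def by auto
    then show ?thesis using empty by simp
  qed
  then show ?case
    using 0(2) by (intro exI[of _ T] exI[of _ "\<lambda>x. x"] exI[of _ \<phi>]) (simp add: sc_epi_id)
next
  case (Suc k)
  note T = Suc.prems(1)
  let ?bad = "big_step T \<phi> (d / 3)"
  have fin: "finite ?bad" unfolding big_step_def using rooted_treeD(1)[OF T] by simp
  obtain b where bb: "b \<in> ?bad" using Suc.hyps(2) by fastforce
  then have b: "b \<in> verts T" "b \<noteq> root T" by (auto simp: big_step_def)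
  let ?a = "par T b"
  have a: "?a \<in> verts T" "?a \<noteq> b" using par_in[OF T b(1)] par_neq[OF T b] by auto
  define \<delta> where "\<delta> = \<phi> b - \<phi> ?a"
  have d: "\<bar>\<delta>\<bar> \<le> d" using bspec[OF Suc.prems(2) b(1)] by (simp add: \<delta>_def)
  obtain x S f where x: "x \<notin> verts T" and S: "rooted_tree S" "sc_epi S T f" "verts S = insert x (verts T)" "root S = root T"
      "par S x = ?a" "par S b = x" and pS: "\<And>v. v \<in> verts T \<Longrightarrow> v \<noteq> b \<Longrightarrow> par S v = par T v"
      and f: "\<And>v. v \<in> verts T \<Longrightarrow> f v = v" "f x = ?a"
    using split_ex[OF T b, of ?a] by metis
  have bS: "b \<in> verts S" "b \<noteq> root S" using b S by auto
  obtain y B g where y: "y \<notin> verts S" and B: "rooted_tree B" "sc_epi B S g" "verts B = insert y (verts S)" "root B = root S"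
      "par B y = par S b" "par B b = y" and pB: "\<And>v. v \<in> verts S \<Longrightarrow> v \<noteq> b \<Longrightarrow> par B v = par S v"
      and g: "\<And>v. v \<in> verts S \<Longrightarrow> g v = v" "g y = b"
    using split_ex[OF S(1) bS, of b] by metis
  \<comment> \<open>Two splittings turn the edge into the path \<open>?a\<close>, \<open>x\<close>,
    \<open>y\<close>, \<open>b\<close>, with \<open>x\<close> over \<open>?a\<close> and
    \<open>y\<close> over \<open>b\<close>. Linear interpolation gives three steps of
    \<open>\<delta> / 3\<close>.\<close>
  define \<psi> where "\<psi> v = (if v = x then \<phi> ?a + \<delta> / 3 else if v = y then \<phi> ?a + 2 * \<delta> / 3 else \<phi> v)" for v
  have xb: "x \<noteq> b" "x \<noteq> ?a" "x \<noteq> y" "y \<noteq> b" "y \<noteq> ?a" "x \<in> verts S" using x y S(3) a b(1) by auto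
  have VB: "verts B = insert y (insert x (verts T))" using B(3) S(3) by simp
  have parB: "par B y = x" "par B x = ?a" "par B b = y" using B(5,6) S(5,6) pB[of x] xb by auto
  have parB': "par B v = par T v" if "v \<in> verts T" "v \<noteq> b" for v using pB[of v] pS[of v] that S(3) by auto
  have \<psi>: "\<psi> x = \<phi> ?a + \<delta> / 3" "\<psi> y = \<phi> ?a + 2 * \<delta> / 3" using xb by (auto simp: \<psi>_def)
  have \<psi>T: "\<psi> v = \<phi> v" if "v \<in> verts T" for v using that x y S(3) by (auto simp: \<psi>_def)
  have st3: "\<psi> y - \<psi> (par B y) = \<delta> / 3" "\<psi> x - \<psi> (par B x) = \<delta> / 3" "\<psi> b - \<psi> (par B b) = \<delta> / 3"
    using \<psi> \<psi>T[OF a(1)] \<psi>T[OF b(1)] parB by (auto simp: \<delta>_def field_simps)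
  have stT: "\<psi> v - \<psi> (par B v) = \<phi> v - \<phi> (par T v)" if "v \<in> verts T" "v \<noteq> b" for v
    using parB'[OF that] \<psi>T[OF that(1)] \<psi>T[OF par_in[OF T that(1)]] by simp
  have step: "\<forall>v\<in>verts B. \<bar>\<psi> v - \<psi> (par B v)\<bar> \<le> d"
  proof
    fix v assume v: "v \<in> verts B"
    consider "v = x" | "v = y" | "v = b" | "v \<in> verts T" "v \<noteq> b" using v VB by blast
    then show "\<bar>\<psi> v - \<psi> (par B v)\<bar> \<le> d" using st3 stT[of v] bspec[OF Suc.prems(2), of v] d by cases auto
  qed
  have nb: "\<not> d / 3 < \<bar>\<psi> v - \<psi> (par B v)\<bar>" if "v = x \<or> v = y \<or> v = b" for v
  proof -
    have "\<psi> v - \<psi> (par B v) = \<delta> / 3" using that st3 by metis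
    then show ?thesis using d by linarith
  qed
  \<comment> \<open>The three new edges have steps of at most \<open>d / 3\<close>, so exactly one
    large edge disappears.\<close>
  have bad': "big_step B \<psi> (d / 3) = ?bad - {b}"
  proof (intro set_eqI)
    fix v
    consider "v = x" | "v = y" | "v = b" | "v \<in> verts T" "v \<noteq> b" "v \<noteq> x" "v \<noteq> y" | "v \<notin> verts B" using VB by blast
    then show "v \<in> big_step B \<psi> (d / 3) \<longleftrightarrow> v \<in> ?bad - {b}"
    proof cases
      case 4
      then show ?thesis using stT[of v] VB B(4) S(4) by (auto simp: big_step_def)
    next
      case 5
      then show ?thesis using VB by (auto simp: big_step_def)
    qed (use nb[of v] x y S(3) in \<open>auto simp: big_step_def\<close>)
  qed
  have "card (big_step B \<psi> (d / 3)) = k" unfolding bad' using bb fin Suc.hyps(2) by simp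
  from Suc.hyps(1)[OF this[symmetric] B(1) step] obtain C h \<omega> where C: "rooted_tree C" "sc_epi C B h"
    and \<omega>: "\<forall>c\<in>verts C. \<bar>\<omega> c - \<omega> (par C c)\<bar> \<le> d / 3"
    and err: "\<forall>c\<in>verts C. \<omega> c = \<psi> (h c) \<or> \<bar>\<omega> c - \<psi> (h c)\<bar> \<le> d / 3 \<and>
       h c \<in> big_step B \<psi> (d / 3) \<union> par B ` big_step B \<psi> (d / 3)"
    and mono: "(\<forall>b\<in>verts B. \<psi> (par B b) \<le> \<psi> b) \<longrightarrow> (\<forall>c\<in>verts C. \<omega> (par C c) \<le> \<omega> c)"
    by (elim exE conjE) (rule that)
  let ?G = "(f \<circ> g) \<circ> h"
  have fg: "(f \<circ> g) v = v" if "v \<in> verts T" for v using f(1) g(1) that S(3) by simp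
  have fgxy: "(f \<circ> g) x = ?a" "(f \<circ> g) y = b" using f g(1)[of x] g(2) f(1)[OF b(1)] xb by simp_all
  \<comment> \<open>The induction hypothesis adds errors only at end points of the remaining large
    edges. These are old vertices, where \<open>\<psi>\<close> equals \<open>\<phi>\<close>, so no
    vertex collects two errors.\<close>
  have err': "\<omega> c = \<phi> (?G c) \<or> \<bar>\<omega> c - \<phi> (?G c)\<bar> \<le> d / 3 \<and> ?G c \<in> ?bad \<union> par T ` ?bad" if c: "c \<in> verts C" for c
  proof -
    have hc: "h c \<in> verts B" by (rule tmorD(8)[OF sc_epi_tmor[OF C(2)] c])
    consider "\<omega> c = \<psi> (h c)" | "\<bar>\<omega> c - \<psi> (h c)\<bar> \<le> d / 3" "h c \<in> big_step B \<psi> (d / 3) \<union> par B ` big_step B \<psi> (d / 3)"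
      using err c by blast
    then show ?thesis
    proof cases
      case 1
      consider "h c = x" | "h c = y" | "h c \<in> verts T" using hc VB by blast
      then show ?thesis
      proof cases
        assume "h c = x"
        then show ?thesis using 1 \<psi> fgxy d bb by auto
      next
        assume "h c = y"
        then have G: "?G c = b" using fgxy by simp
        have "\<omega> c - \<phi> b = - \<delta> / 3" using 1 \<psi>(2) \<open>h c = y\<close> by (simp add: \<delta>_def field_simps)
        then have "\<bar>\<omega> c - \<phi> b\<bar> \<le> d / 3" using d by linarith
        then show ?thesis unfolding G using bb by blast
      next
        assume "h c \<in> verts T"
        then show ?thesis using 1 \<psi>T fg by simp
      qed
    next
      case 2
      have badT: "v \<in> verts T" "v \<noteq> b" if "v \<in> ?bad - {b}" for v using that by (auto simp: big_step_def)
      have "h c \<in> (?bad - {b}) \<union> par T ` (?bad - {b})"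
        using 2(2) parB'[OF badT] unfolding bad' by (auto simp: image_iff)
      moreover have "big_step T \<phi> (d / 3) \<subseteq> verts T" by (auto simp: big_step_def)
      then have "?bad \<union> par T ` ?bad \<subseteq> verts T" using par_in[OF T] by blast
      ultimately have "h c \<in> verts T" "h c \<in> ?bad \<union> par T ` ?bad" by blast+
      then show ?thesis using 2(1) \<psi>T[of "h c"] fg[of "h c"] by auto
    qed
  qed
  have mono': "\<psi> (par B v) \<le> \<psi> v" if m: "\<forall>b\<in>verts T. \<phi> (par T b) \<le> \<phi> b" and v: "v \<in> verts B" for v
  proof -
    have d0: "\<delta> \<ge> 0" using bspec[OF m b(1)] by (simp add: \<delta>_def)
    consider "v = x \<or> v = y \<or> v = b" | "v \<in> verts T" "v \<noteq> b" using v VB by blast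
    then show ?thesis
    proof cases
      case 1
      then have "\<psi> v - \<psi> (par B v) = \<delta> / 3" using st3 by metis
      then show ?thesis using d0 by simp
    next
      case 2
      then show ?thesis using stT[of v] bspec[OF m, of v] by simp
    qed
  qed
  have "sc_epi C T ?G" by (rule sc_epi.comp[OF C(2) sc_epi.comp[OF B(2) S(2)]])
  then show ?case
    using C(1) \<omega> err' mono mono'
    by (intro exI[of _ C] exI[of _ ?G] exI[of _ \<omega>] conjI ballI) (assumption | blast)+
qed

lemma continuous_coord: "continuous_on S (\<lambda>x::nat \<Rightarrow> nat. \<phi> (x n) :: 'b::topological_space)"
proof -
  have "continuous_on S (\<lambda>x::nat \<Rightarrow> nat. x n)" by (rule continuous_on_subset[OF continuous_on_product_coordinates]) simp
  moreover have "continuous_on UNIV \<phi>" by (simp add: continuous_on_open_vimage open_discrete)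
  ultimately show ?thesis using continuous_on_compose2[of UNIV \<phi> S "\<lambda>x. x n"] by simp
qed

context tc_limit
begin

definition variation :: "nat \<Rightarrow> (nat \<Rightarrow> real) \<Rightarrow> real \<Rightarrow> bool" where
  "variation n \<phi> d \<longleftrightarrow> (\<forall>v\<in>verts (F n). \<bar>\<phi> v - \<phi> (par (F n) v)\<bar> \<le> d)"

definition height_mono :: "nat \<Rightarrow> (nat \<Rightarrow> real) \<Rightarrow> bool" where
  "height_mono n \<phi> \<longleftrightarrow> (\<forall>v\<in>verts (F n). \<phi> (par (F n) v) \<le> \<phi> v)"

text \<open>The interpolating function on the subdivided tree is pulled back along the factor map,
  which moves by at most one edge per edge and so does not increase the variation.\<close>

lemma refine_function:
  assumes \<phi>: "variation n \<phi> d"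
  shows "\<exists>m \<phi>'. n \<le> m \<and> variation m \<phi>' (d / 3) \<and> (\<forall>v\<in>verts (F m). \<bar>\<phi>' v - \<phi> (bnd n m v)\<bar> \<le> d / 3) \<and>
    (height_mono n \<phi> \<longrightarrow> height_mono m \<phi>')"
proof -
  have "0 \<le> d" using \<phi> rooted_treeD(2)[OF RT, of n] unfolding variation_def by force
  have step: "\<forall>b\<in>verts (F n). \<bar>\<phi> b - \<phi> (par (F n) b)\<bar> \<le> d"
    using \<phi> unfolding variation_def .
  obtain B g \<psi> where B: "rooted_tree B" "sc_epi B (F n) g" "\<forall>b\<in>verts B. \<bar>\<psi> b - \<psi> (par B b)\<bar> \<le> d / 3"
    "\<forall>b\<in>verts B. \<psi> b = \<phi> (g b) \<or> \<bar>\<psi> b - \<phi> (g b)\<bar> \<le> d / 3 \<and>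
       g b \<in> big_step (F n) \<phi> (d / 3) \<union> par (F n) ` big_step (F n) \<phi> (d / 3)"
    "height_mono n \<phi> \<longrightarrow> (\<forall>b\<in>verts B. \<psi> (par B b) \<le> \<psi> b)"
    using subdivide_thirds[OF RT step, folded height_mono_def] by (elim exE conjE) (rule that)
  obtain m h where h: "m \<ge> n" "tmor (F m) B h" "\<And>v. v \<in> verts (F m) \<Longrightarrow> g (h v) = bnd n m v"
    using extension[OF B(1,2)] by metis
  have hv: "h v \<in> verts B" if "v \<in> verts (F m)" for v by (rule tmorD(8)[OF h(2) that])
  have "\<bar>\<psi> (h v) - \<psi> (h (par (F m) v))\<bar> \<le> d / 3" if "v \<in> verts (F m)" for v
    using tmor_par[OF h(2) that] B(3) hv[OF that] \<open>0 \<le> d\<close> by auto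
  moreover have "\<bar>\<psi> (h v) - \<phi> (bnd n m v)\<bar> \<le> d / 3" if "v \<in> verts (F m)" for v
    using bspec[OF B(4) hv[OF that]] h(3)[OF that] \<open>0 \<le> d\<close> by auto
  moreover have "\<psi> (h (par (F m) v)) \<le> \<psi> (h v)" if "height_mono n \<phi>" "v \<in> verts (F m)" for v
    using tmor_par[OF h(2) that(2)] B(5) hv[OF that(2)] that(1) by auto
  ultimately show ?thesis
    unfolding variation_def height_mono_def using h(1)
    by (intro exI[of _ m] exI[of _ "\<psi> \<circ> h"]) (simp add: height_mono_def)
qed

lemma height_mono_tle: "height_mono n \<phi> \<Longrightarrow> tle (F n) u v \<Longrightarrow> \<phi> u \<le> \<phi> v"
proof -
  assume m: "height_mono n \<phi>" and t: "tle (F n) u v"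
  have "u \<in> {u \<in> verts (F n). \<phi> u \<le> \<phi> v}"
  proof (rule tle_closed[OF RT t])
    fix w assume "w \<in> {u \<in> verts (F n). \<phi> u \<le> \<phi> v}"
    then show "par (F n) w \<in> {u \<in> verts (F n). \<phi> u \<le> \<phi> v}"
      using m par_in[OF RT] unfolding height_mono_def by force
  qed (use tleD(2)[OF t] in simp)
  then show ?thesis by simp
qed

lemma variation_edge: "variation n \<phi> d \<Longrightarrow> (u, v) \<in> edges (F n) \<Longrightarrow> \<bar>\<phi> u - \<phi> v\<bar> \<le> d"
proof -
  assume a: "variation n \<phi> d" "(u, v) \<in> edges (F n)"
  have u: "u \<in> verts (F n)" "v \<in> verts (F n)" "u = v \<or> u = par (F n) v \<or> v = par (F n) u"
    using a(2) edges_iff[OF RT] by blast+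
  have "\<bar>\<phi> u - \<phi> (par (F n) u)\<bar> \<le> d" "\<bar>\<phi> v - \<phi> (par (F n) v)\<bar> \<le> d"
    using a(1) u(1,2) unfolding variation_def by blast+
  then show ?thesis using u(3) by auto
qed

text \<open>Iterated refinement gives functions of variation \<open>d / 3 ^ j\<close>, consecutive
  ones differing by at most \<open>d / 3 ^ Suc j\<close>. They converge uniformly with total error
  \<open>d / 2\<close>, and adjacent threads get equal limits because the variation tends to
  zero.\<close>

lemma extend_function:
  assumes \<phi>: "variation k \<phi> d"
  obtains G where "continuous_on L G" "\<And>x y. (x, y) \<in> E \<Longrightarrow> G x = G y" "\<And>x. x \<in> L \<Longrightarrow> \<bar>G x - \<phi> (x k)\<bar> \<le> d / 2"
    "\<And>x y. height_mono k \<phi> \<Longrightarrow> x \<sqsubseteq> y \<Longrightarrow> G x \<le> (G y :: real)"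
proof -
  have "\<exists>f. \<forall>j. (variation (fst (f j)) (snd (f j)) (d / 3 ^ j) \<and> (height_mono k \<phi> \<longrightarrow> height_mono (fst (f j)) (snd (f j))) \<and> (j = 0 \<longrightarrow> f j = (k, \<phi>)))
    \<and> (fst (f j) \<le> fst (f (Suc j)) \<and> (\<forall>v\<in>verts (F (fst (f (Suc j)))). \<bar>snd (f (Suc j)) v - snd (f j) (bnd (fst (f j)) (fst (f (Suc j))) v)\<bar> \<le> d / 3 ^ Suc j))"
  proof (rule dependent_nat_choice)
    show "\<exists>x. variation (fst x) (snd x) (d / 3 ^ 0) \<and> (height_mono k \<phi> \<longrightarrow> height_mono (fst x) (snd x)) \<and> (0 = 0 \<longrightarrow> x = (k, \<phi>))"
      using \<phi> by (intro exI[of _ "(k, \<phi>)"]) simp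
    fix x j assume "variation (fst x) (snd x) (d / 3 ^ j) \<and> (height_mono k \<phi> \<longrightarrow> height_mono (fst x) (snd x)) \<and> (j = 0 \<longrightarrow> x = (k, \<phi>))"
    then have v: "variation (fst x) (snd x) (d / 3 ^ j)" "height_mono k \<phi> \<longrightarrow> height_mono (fst x) (snd x)" by auto
    obtain m \<phi>' where "fst x \<le> m" "variation m \<phi>' (d / 3 ^ j / 3)"
      "\<forall>v\<in>verts (F m). \<bar>\<phi>' v - snd x (bnd (fst x) m v)\<bar> \<le> d / 3 ^ j / 3" "height_mono (fst x) (snd x) \<longrightarrow> height_mono m \<phi>'"
      using refine_function[OF v(1)] by (elim exE conjE)
    then show "\<exists>y. (variation (fst y) (snd y) (d / 3 ^ Suc j) \<and> (height_mono k \<phi> \<longrightarrow> height_mono (fst y) (snd y)) \<and> (Suc j = 0 \<longrightarrow> y = (k, \<phi>)))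
      \<and> (fst x \<le> fst y \<and> (\<forall>v\<in>verts (F (fst y)). \<bar>snd y v - snd x (bnd (fst x) (fst y) v)\<bar> \<le> d / 3 ^ Suc j))"
      using v by (intro exI[of _ "(m, \<phi>')"]) (simp add: field_simps)
  qed
  then obtain s where s: "\<And>j. variation (fst (s j)) (snd (s j)) (d / 3 ^ j)" "\<And>j. height_mono k \<phi> \<Longrightarrow> height_mono (fst (s j)) (snd (s j))"
    "s 0 = (k, \<phi>)" "\<And>j. fst (s j) \<le> fst (s (Suc j))"
    "\<And>j v. v \<in> verts (F (fst (s (Suc j)))) \<Longrightarrow> \<bar>snd (s (Suc j)) v - snd (s j) (bnd (fst (s j)) (fst (s (Suc j))) v)\<bar> \<le> d / 3 ^ Suc j"
    by metis
  define f where "f j x = snd (s j) (x (fst (s j)))" for j and x :: "nat \<Rightarrow> nat"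
  define g where "g j x = f (Suc j) x - f j x" for j x
  have gb: "norm (g j x) \<le> d / 3 ^ Suc j" if "x \<in> L" for j x
    using s(5)[OF LD(1)[OF that], of j] L_bnd[OF that s(4)[of j]] by (simp add: g_def f_def)
  have sm: "(\<lambda>j. d / 3 ^ Suc j) sums (d / 2)"
  proof -
    have "(\<lambda>j. (d / 3) * (1 / 3) ^ j) sums ((d / 3) * (1 / (1 - 1 / 3)))"
      by (intro sums_mult geometric_sums) simp
    then show ?thesis by (simp add: power_divide field_simps)
  qed
  define G where "G x = f 0 x + (\<Sum>j. g j x)" for x
  have fsum: "f j x = f 0 x + (\<Sum>i<j. g i x)" for j x
    by (induction j) (simp_all add: g_def)
  have ul: "uniform_limit L (\<lambda>n x. \<Sum>i<n. g i x) (\<lambda>x. \<Sum>j. g j x) sequentially"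
    by (rule Weierstrass_m_test[OF gb sums_summable[OF sm]])
  have cg: "continuous_on L (\<lambda>x. \<Sum>i<n. g i x)" for n
    unfolding g_def f_def by (intro continuous_intros continuous_coord)
  have "continuous_on L (\<lambda>x. \<Sum>j. g j x)"
    by (rule uniform_limit_theorem[OF _ ul]) (simp_all add: cg)
  then have cont: "continuous_on L G"
    unfolding G_def f_def by (intro continuous_intros continuous_coord)
  have fG: "(\<lambda>j. f j x) \<longlonglongrightarrow> G x" if "x \<in> L" for x
    unfolding G_def by (subst fsum) (intro tendsto_intros tendsto_uniform_limitI[OF ul that])
  have inv: "G x = G y" if xy: "(x, y) \<in> E" for x y
  proof -
    have "\<bar>f j x - f j y\<bar> \<le> d / 3 ^ j" for j
      unfolding f_def by (rule variation_edge[OF s(1) ED(3)[OF xy]])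
    then have "\<forall>\<^sub>F j in sequentially. norm (f j x - f j y) \<le> d / 3 ^ j" by simp
    moreover have "(\<lambda>j. d * (1 / 3) ^ j) \<longlonglongrightarrow> 0" by (intro tendsto_mult_right_zero LIMSEQ_realpow_zero) auto
    then have "(\<lambda>j. d / 3 ^ j) \<longlonglongrightarrow> 0" by (simp add: power_divide)
    ultimately have "(\<lambda>j. f j x - f j y) \<longlonglongrightarrow> 0"
      by (rule Lim_null_comparison)
    moreover have "(\<lambda>j. f j x - f j y) \<longlonglongrightarrow> G x - G y"
      by (intro tendsto_diff fG ED[OF xy])
    ultimately show ?thesis using LIMSEQ_unique by fastforce
  qed
  have err: "\<bar>G x - \<phi> (x k)\<bar> \<le> d / 2" if "x \<in> L" for x
  proof -
    have "norm (\<Sum>j. g j x) \<le> (\<Sum>j. d / 3 ^ Suc j)"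
      by (rule norm_suminf_le[OF gb[OF that] sums_summable[OF sm]])
    then show ?thesis using sums_unique[OF sm] by (simp add: G_def f_def s(3))
  qed
  have mono: "G x \<le> G y" if "height_mono k \<phi>" "x \<sqsubseteq> y" for x y
  proof (rule LIMSEQ_le[OF fG fG])
    show "\<exists>N. \<forall>n\<ge>N. f n x \<le> f n y"
      unfolding f_def using height_mono_tle[OF s(2)[OF that(1)] leD(3)[OF that(2)]] by blast
  qed (use leD that in auto)
  show thesis by (rule that[OF cont inv err mono])
qed

lemma separating_function:
  obtains G where "continuous_on L G" "\<And>x y. (x, y) \<in> E \<Longrightarrow> G x = G y"
    "\<And>x y. x \<in> L \<Longrightarrow> y \<in> L \<Longrightarrow> x k = v \<Longrightarrow> (x k, y k) \<notin> edges (F k) \<Longrightarrow> G x < (G y :: real)"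
proof -
  \<comment> \<open>The distance to \<open>v\<close>, cut off at 2. Its variation is at most 1, so
    the extension errs by at most 1/2 and still separates the values 0 and 2.\<close>
  define \<phi> :: "nat \<Rightarrow> real" where "\<phi> u = (if u = v then 0 else if (v, u) \<in> edges (F k) then 1 else 2)" for u
  have var: "variation k \<phi> 1"
    unfolding variation_def
  proof
    fix u assume u: "u \<in> verts (F k)"
    have "(u, par (F k) u) \<in> edges (F k)" "(par (F k) u, u) \<in> edges (F k)"
      using u par_in[OF RT u] by (simp_all add: edges_iff[OF RT])
    then show "\<bar>\<phi> u - \<phi> (par (F k) u)\<bar> \<le> 1" unfolding \<phi>_def by auto
  qed
  obtain G where G: "continuous_on L G" "\<And>x y. (x, y) \<in> E \<Longrightarrow> G x = G y" "\<And>x. x \<in> L \<Longrightarrow> \<bar>G x - \<phi> (x k)\<bar> \<le> 1 / 2"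
    using extend_function[OF var] by metis
  have "G x < G y" if xy: "x \<in> L" "y \<in> L" "x k = v" "(x k, y k) \<notin> edges (F k)" for x y
  proof -
    have "y k \<noteq> v" using xy rooted_treeD(6)[OF RT LD(1)[OF xy(1), of k]] by auto
    then have "\<phi> (x k) = 0" "\<phi> (y k) = 2" using xy by (auto simp: \<phi>_def)
    then show ?thesis using G(3)[OF xy(1)] G(3)[OF xy(2)] unfolding abs_le_iff by linarith
  qed
  then show thesis using that G(1,2) by blast
qed

text \<open>The weighted sum over all \<open>k\<close> of the continuous extensions of the height functions of \<open>F k\<close>.\<close>

lemma height_function:
  obtains H where "continuous_on L H" "\<And>x y. (x, y) \<in> E \<Longrightarrow> H x = H y"
    "\<And>x y. x \<sqsubseteq> y \<Longrightarrow> H x \<le> (H y :: real)" "\<And>x y. x \<sqsubseteq> y \<Longrightarrow> H x = H y \<Longrightarrow> (x, y) \<in> E"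
proof -
  let ?h = "\<lambda>k v. real (ht (F k) v)"
  have mon: "height_mono k (?h k)" for k
    unfolding height_mono_def using tle_ht_le[OF RT tle_par[OF RT]] by simp
  have var: "variation k (?h k) 1" for k
    unfolding variation_def
  proof
    fix v assume "v \<in> verts (F k)"
    then show "\<bar>?h k v - ?h k (par (F k) v)\<bar> \<le> 1" using ht_par[OF RT] by (cases "v = root (F k)") auto
  qed
  have "\<exists>G. continuous_on L G \<and> (\<forall>x y. (x, y) \<in> E \<longrightarrow> G x = G y) \<and> (\<forall>x\<in>L. \<bar>G x - ?h k (x k)\<bar> \<le> 1 / 2) \<and>
    (\<forall>x y. x \<sqsubseteq> y \<longrightarrow> G x \<le> (G y :: real))" for k
    using extend_function[OF var[of k]] mon[of k] by metis
  then obtain G where G: "\<And>k. continuous_on L (G k)" "\<And>k x y. (x, y) \<in> E \<Longrightarrow> G k x = G k y"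
    "\<And>k x. x \<in> L \<Longrightarrow> \<bar>G k x - ?h k (x k)\<bar> \<le> 1 / 2" "\<And>k x y. x \<sqsubseteq> y \<Longrightarrow> G k x \<le> (G k y :: real)"
    by metis
  \<comment> \<open>A positive bound for \<open>G k\<close>: the summand 1 absorbs the extension
    error 1/2. After division by it a geometric series dominates.\<close>
  define c where "c k = real (Max (ht (F k) ` verts (F k))) + 1" for k
  have c: "c k > 0" "x \<in> L \<Longrightarrow> \<bar>G k x\<bar> \<le> c k" for k x
  proof -
    show "c k > 0" by (simp add: c_def)
    assume "x \<in> L"
    then have "ht (F k) (x k) \<le> Max (ht (F k) ` verts (F k))"
      using rooted_treeD(1)[OF RT] LD(1) by (intro Max_ge) auto
    then have "?h k (x k) \<le> c k - 1" by (simp add: c_def)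
    then show "\<bar>G k x\<bar> \<le> c k" using G(3)[OF \<open>x \<in> L\<close>, of k] by (smt (verit) of_nat_0_le_iff field_sum_of_halves)
  qed
  define g where "g k x = (1 / 2) ^ k * (G k x / c k)" for k x
  have sm: "summable (\<lambda>k. (1 / 2 :: real) ^ k)" by (rule summable_geometric) simp
  have gb: "norm (g k x) \<le> (1 / 2) ^ k" if "x \<in> L" for k x
  proof -
    have "\<bar>G k x / c k\<bar> \<le> 1" using c(1)[of k] c(2)[OF that, of k] by (simp add: abs_divide)
    then have "(1 / 2) ^ k * \<bar>G k x / c k\<bar> \<le> (1 / 2) ^ k * 1" by (intro mult_left_mono) auto
    moreover have "norm (g k x) = (1 / 2) ^ k * \<bar>G k x / c k\<bar>" unfolding g_def real_norm_def abs_mult by simp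
    ultimately show ?thesis by simp
  qed
  have gs: "summable (\<lambda>k. g k x)" if "x \<in> L" for x
    by (rule summable_comparison_test'[OF sm, of 0]) (rule gb[OF that])
  define H where "H x = (\<Sum>k. g k x)" for x
  have ul: "uniform_limit L (\<lambda>n x. \<Sum>i<n. g i x) H sequentially"
    unfolding H_def by (rule Weierstrass_m_test[OF gb sm])
  have "continuous_on L (\<lambda>x. \<Sum>i<n. g i x)" for n
  proof -
    have "c i \<noteq> 0" for i using c(1)[of i] by simp
    then show ?thesis unfolding g_def by (intro continuous_intros G(1)) auto
  qed
  then have cont: "continuous_on L H"
    by (intro uniform_limit_theorem[OF _ ul]) simp_all
  have gm: "g k x \<le> g k y" if "x \<sqsubseteq> y" for k x y
    unfolding g_def using G(4)[OF that, of k] c(1)[of k] by (intro mult_left_mono divide_right_mono) auto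
  have mono: "H x \<le> H y" if "x \<sqsubseteq> y" for x y
    unfolding H_def by (rule suminf_le[OF gm[OF that] gs[OF leD(1)[OF that]] gs[OF leD(2)[OF that]]])
  have strict: "(x, y) \<in> E" if xy: "x \<sqsubseteq> y" "H x = H y" for x y
  proof (rule ccontr)
    assume "(x, y) \<notin> E"
    then obtain k where k: "(x k, y k) \<notin> edges (F k)" using leD xy by (auto simp: lim_edges_def)
    have t: "tle (F k) (x k) (y k)" using leD xy by blast
    have V: "x k \<in> verts (F k)" "y k \<in> verts (F k)" using tleD[OF t] by auto
    have "x k \<noteq> y k" "x k \<noteq> par (F k) (y k)" using k V edges_iff[OF RT] by blast+
    then have "y k \<noteq> root (F k)" "tle (F k) (x k) (par (F k) (y k))" "x k \<noteq> par (F k) (y k)"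
      using tle_lt_par[OF RT t] by auto
    \<comment> \<open>Non-adjacent comparable vertices differ in height by at least 2, more than
      twice the error 1/2. So the \<open>k\<close>-th term increases strictly, while no term
      decreases.\<close>
    then have "?h k (x k) + 2 \<le> ?h k (y k)"
      using tle_ht[OF RT, of k "x k" "par (F k) (y k)"] ht_par[OF RT V(2)] by auto
    then have "G k x < G k y" using G(3)[of x k] G(3)[of y k] leD xy by (smt (verit) field_sum_of_halves)
    then have "g k x < g k y"
      unfolding g_def using c(1)[of k] by (intro mult_strict_left_mono divide_strict_right_mono) auto
    moreover have "(\<Sum>k. g k y - g k x) = 0"
      using suminf_diff[OF gs gs, of y x] leD xy by (simp add: H_def)
    moreover have "summable (\<lambda>k. g k y - g k x)"
      by (rule summable_diff[OF gs gs]) (use leD xy in blast)+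
    ultimately show False
      using suminf_pos2[of "\<lambda>k. g k y - g k x" k] gm[OF xy(1)] by fastforce
  qed
  have inv: "H x = H y" if "(x, y) \<in> E" for x y
    using G(2)[OF that] by (simp add: H_def g_def)
  show thesis by (rule that[OF cont inv mono strict])
qed

end

subsection \<open>The thread space and its quotient\<close>

lemma compact_decreasing:
  fixes C :: "nat \<Rightarrow> 'a::topological_space set"
  assumes K: "compact K" and C: "\<And>n. closed (C n)" "\<And>n. C (Suc n) \<subseteq> C n" "\<And>n. K \<inter> C n \<noteq> {}"
  shows "K \<inter> (\<Inter>n. C n) \<noteq> {}"
proof (rule compact_imp_fip[OF K])
  fix T assume "T \<in> range C"
  then show "closed T" using C(1) by auto
next
  fix F' assume F': "finite F'" "F' \<subseteq> range C"
  then obtain I where I: "finite I" "F' = C ` I" by (meson finite_subset_image)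
  have dec: "C m \<subseteq> C n" if "n \<le> m" for n m
    using that by (induction m rule: dec_induct) (use C(2) in auto)
  have "C (Max (insert 0 I)) \<subseteq> \<Inter>F'"
    unfolding I(2) using I(1) by (intro INT_greatest dec) simp
  then show "K \<inter> \<Inter>F' \<noteq> {}" using C(3)[of "Max (insert 0 I)"] by blast
qed

lemma discrete_topology_nat: "discrete_topology (S :: nat set) = top_of_set S"
  by (auto simp: topology_eq openin_open open_discrete)

lemma closed_coord: "closed {x :: nat \<Rightarrow> nat. x n \<in> S}"
proof -
  have "closed ((\<lambda>x :: nat \<Rightarrow> nat. x n) -` S)"
    by (rule closed_vimage) (simp_all add: closed_def open_discrete continuous_coord[of UNIV "\<lambda>x. x"])
  then show ?thesis by (simp add: vimage_def)
qed

lemma closed_coord_pair: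
  assumes "finite R"
  shows "closed {p :: (nat \<Rightarrow> nat) \<times> (nat \<Rightarrow> nat). (fst p n, snd p n) \<in> R}"
proof -
  have "continuous_on UNIV (\<lambda>p :: (nat \<Rightarrow> nat) \<times> (nat \<Rightarrow> nat). (fst p n, snd p n))"
    using continuous_on_compose2[OF continuous_coord[of UNIV "\<lambda>x. x" n] continuous_on_fst[OF continuous_on_id]]
      continuous_on_compose2[OF continuous_coord[of UNIV "\<lambda>x. x" n] continuous_on_snd[OF continuous_on_id]]
    by (intro continuous_on_Pair) auto
  then have "closed ((\<lambda>p :: (nat \<Rightarrow> nat) \<times> (nat \<Rightarrow> nat). (fst p n, snd p n)) -` R)"
    by (intro closed_vimage finite_imp_closed assms)
  then show ?thesis by (simp add: vimage_def)
qed

text \<open>The quotient is built with \<open>topology\<close>, whose open sets are known only after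
  this check. Disjointness of classes makes taking unions commute with intersections.\<close>

lemma istopology_quotient:
  assumes R: "equiv (topspace X) R"
  shows "istopology (\<lambda>U. U \<subseteq> topspace X // R \<and> openin X (\<Union>U))"
  unfolding istopology_def
proof (intro conjI allI impI)
  fix S T assume S: "S \<subseteq> topspace X // R \<and> openin X (\<Union>S)" and T: "T \<subseteq> topspace X // R \<and> openin X (\<Union>T)"
  have "\<Union>(S \<inter> T) = \<Union>S \<inter> \<Union>T"
  proof
    show "\<Union>S \<inter> \<Union>T \<subseteq> \<Union>(S \<inter> T)"
    proof
      fix x assume "x \<in> \<Union>S \<inter> \<Union>T"
      then obtain A B where "A \<in> S" "x \<in> A" "B \<in> T" "x \<in> B" by blast
      moreover from this have "A = B" using quotient_disj[OF R, of A B] S T by blast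
      ultimately show "x \<in> \<Union>(S \<inter> T)" by blast
    qed
  qed blast
  then show "openin X (\<Union>(S \<inter> T))" using S T by auto
  show "S \<inter> T \<subseteq> topspace X // R" using S by blast
next
  fix \<K> assume K: "\<forall>K\<in>\<K>. K \<subseteq> topspace X // R \<and> openin X (\<Union>K)"
  show "\<Union>\<K> \<subseteq> topspace X // R" using K by blast
  have "\<Union>(\<Union>\<K>) = \<Union>(Union ` \<K>)" by blast
  then show "openin X (\<Union>(\<Union>\<K>))" using K by (metis (no_types, lifting) imageE openin_Union)
qed

lemma connectedin_closed_cases:
  assumes "connectedin X K" "closedin X A" "closedin X B" "A \<union> B = K" "A \<inter> B = {}"
  shows "A = {} \<or> B = {}"
proof (rule ccontr)
  assume n: "\<not> (A = {} \<or> B = {})"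
  have "A \<inter> K = A" "B \<inter> K = B" "A \<inter> B \<inter> K = {}" "K \<subseteq> A \<union> B" using assms(4,5) by auto
  then show False using assms(1-3) n unfolding connectedin_closedin by metis
qed

context tc_limit
begin

lemma closed_L: "closed L"
proof -
  have L: "L = (\<Inter>n. {x. x n \<in> verts (F n)} \<inter> {x. \<alpha> n (x (Suc n)) = x n})" by (auto simp: lim_verts_def)
  show ?thesis
    unfolding L by (intro closed_INT ballI closed_Int closed_coord closed_Collect_eq continuous_coord continuous_coord[of _ "\<lambda>x. x"])
qed

lemma compact_L: "compact L"
proof -
  have "compactin (product_topology (\<lambda>i. euclidean) UNIV) (PiE UNIV (\<lambda>n. verts (F n)))"
    unfolding compactin_PiE using rooted_treeD(1)[OF RT] by (simp add: finite_imp_compact)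
  then have "compact (PiE UNIV (\<lambda>n. verts (F n)))" by (simp add: euclidean_product_topology)
  moreover have "L \<subseteq> PiE UNIV (\<lambda>n. verts (F n))" by (auto simp: lim_verts_def)
  ultimately show ?thesis using closed_L compact_Int_closed by (metis inf.absorb_iff2)
qed

text \<open>Replaces the product of discrete spaces by a subspace of a function type, so that
  \<open>closed\<close>, \<open>compact\<close> and \<open>continuous_on\<close> become
  available.\<close>

lemma lim_top_eq: "lim_top F \<alpha> = top_of_set L"
proof -
  have "product_topology (\<lambda>n. discrete_topology (verts (F n))) UNIV = top_of_set (PiE UNIV (\<lambda>n. verts (F n)))"
    by (simp add: discrete_topology_nat euclidean_product_topology flip: subtopology_product_topology)
  moreover have "PiE UNIV (\<lambda>n. verts (F n)) \<inter> L = L" by (auto simp: lim_verts_def)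
  ultimately show ?thesis unfolding lim_top_def by (simp add: subtopology_subtopology)
qed

lemma compact_thread: "closed Z \<Longrightarrow> Z \<subseteq> L \<Longrightarrow> compact Z"
  using compact_L compact_Int_closed by (metis inf.absorb_iff2)

text \<open>A coordinate determines all lower ones, so the cylinders around \<open>x\<close>
  decrease, with intersection \<open>{x}\<close>. By compactness one of them fits into
  \<open>U\<close>.\<close>

lemma cylinder_nhd:
  assumes "open U" "x \<in> U" "x \<in> L"
  obtains n where "\<And>y. y \<in> L \<Longrightarrow> y n = x n \<Longrightarrow> y \<in> U"
proof (rule ccontr)
  assume no: "\<not> thesis"
  have ex: "\<exists>y\<in>L. y n = x n \<and> y \<notin> U" for n
  proof (rule ccontr)
    assume "\<not> ?thesis"
    then have "\<And>y. y \<in> L \<Longrightarrow> y n = x n \<Longrightarrow> y \<in> U" by blast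
    then show False using that no by blast
  qed
  have c: "compact (L - U)" using compact_L \<open>open U\<close> by (rule compact_diff)
  have "(L - U) \<inter> (\<Inter>n. L \<inter> {y. y n \<in> {x n}}) \<noteq> {}"
  proof (rule compact_decreasing[OF c])
    show "closed (L \<inter> {y. y n \<in> {x n}})" for n by (intro closed_Int closed_L closed_coord)
    show "L \<inter> {y. y (Suc n) \<in> {x (Suc n)}} \<subseteq> L \<inter> {y. y n \<in> {x n}}" for n
      using L_eq_down[OF _ assms(3), of _ n "Suc n"] by auto
    show "(L - U) \<inter> (L \<inter> {y. y n \<in> {x n}}) \<noteq> {}" for n using ex[of n] by blast
  qed
  then obtain y where "y \<in> L - U" "\<And>n. y n = x n" by auto
  then have "y = x" by blast
  then show False using \<open>y \<in> L - U\<close> assms(2) by blast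
qed

lemma thread_closed_iff: "thread_closed Z \<longleftrightarrow> Z \<subseteq> L \<and> closed Z"
proof
  assume Z: "thread_closed Z"
  then have "Z = L \<inter> (\<Inter>n. {x. x n \<in> level n Z})" unfolding thread_closed_def by auto
  moreover have "closed (L \<inter> (\<Inter>n. {x. x n \<in> level n Z}))"
    by (intro closed_Int closed_L closed_INT ballI closed_coord)
  ultimately show "Z \<subseteq> L \<and> closed Z" using Z unfolding thread_closed_def by simp
next
  assume Z: "Z \<subseteq> L \<and> closed Z"
  show "thread_closed Z"
    unfolding thread_closed_def
  proof (intro conjI ballI impI)
    fix x assume x: "x \<in> L" "\<forall>m. x m \<in> level m Z"
    show "x \<in> Z"
    proof (rule ccontr)
      assume "x \<notin> Z"
      then obtain n where n: "\<And>y. y \<in> L \<Longrightarrow> y n = x n \<Longrightarrow> y \<in> - Z"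
        using cylinder_nhd[of "- Z" x] x Z by (auto simp: open_Compl)
      obtain z where "z \<in> Z" "z n = x n" using x(2)[rule_format, of n] by (metis imageE)
      then show False using n[of z] Z by auto
    qed
  qed (use Z in simp)
qed

text \<open>The edges may join different threads at different levels. The sets of pairs adjacent at
  level \<open>n\<close> are compact and decreasing, and a pair common to all of them is an edge of
  the limit.\<close>

lemma E_compact:
  assumes Z: "closed Z1" "Z1 \<subseteq> L" "closed Z2" "Z2 \<subseteq> L"
    and e: "\<And>n. \<exists>x\<in>Z1. \<exists>y\<in>Z2. (x n, y n) \<in> edges (F n)"
  shows "\<exists>x\<in>Z1. \<exists>y\<in>Z2. (x, y) \<in> E"
proof -
  let ?C = "\<lambda>n. (Z1 \<times> Z2) \<inter> {p. (fst p n, snd p n) \<in> edges (F n)}"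
  have fe: "finite (edges (F n))" for n
    by (rule finite_subset[of _ "verts (F n) \<times> verts (F n)"])
      (use rooted_treeD(3,4)[OF RT] in \<open>auto simp: rooted_treeD(1)[OF RT]\<close>)
  have "(Z1 \<times> Z2) \<inter> (\<Inter>n. ?C n) \<noteq> {}"
  proof (rule compact_decreasing)
    show "compact (Z1 \<times> Z2)" by (intro compact_Times compact_thread Z)
    show "closed (?C n)" for n by (intro closed_Int closed_Times Z closed_coord_pair fe)
    show "?C (Suc n) \<subseteq> ?C n" for n
    proof
      fix p assume p: "p \<in> ?C (Suc n)"
      then have "(fst p (Suc n), snd p (Suc n)) \<in> edges (F (Suc n))" "fst p \<in> L" "snd p \<in> L" using Z by auto
      then have "(fst p n, snd p n) \<in> edges (F n)" using tmorD(5)[OF tm_step, of "fst p (Suc n)" "snd p (Suc n)" n] LD(2) by simp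
      then show "p \<in> ?C n" using p by simp
    qed
    show "(Z1 \<times> Z2) \<inter> ?C n \<noteq> {}" for n
    proof -
      obtain x y where "x \<in> Z1" "y \<in> Z2" "(x n, y n) \<in> edges (F n)" using e by blast
      then have "(x, y) \<in> (Z1 \<times> Z2) \<inter> ?C n" by simp
      then show ?thesis by blast
    qed
  qed
  then obtain p where "p \<in> Z1 \<times> Z2" "\<And>n. (fst p n, snd p n) \<in> edges (F n)" by auto
  then have "fst p \<in> Z1" "snd p \<in> Z2" "(fst p, snd p) \<in> E" using Z unfolding lim_edges_def by auto
  then show ?thesis by blast
qed

lemma compact_le: "compact {(x, y). x \<sqsubseteq> y}"
proof -
  have ft: "finite {(a, b). tle (F n) a b}" for n
    by (rule finite_subset[of _ "verts (F n) \<times> verts (F n)"]) (auto dest: tleD simp: rooted_treeD(1)[OF RT])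
  have "{(x, y). x \<sqsubseteq> y} = (L \<times> L) \<inter> (\<Inter>n. {p. (fst p n, snd p n) \<in> {(a, b). tle (F n) a b}})"
    by (auto simp: le_def)
  moreover have "closed (\<Inter>n. {p. (fst p n, snd p n) \<in> {(a, b). tle (F n) a b}})"
    by (intro closed_INT ballI closed_coord_pair ft)
  ultimately show ?thesis using compact_Int_closed[OF compact_Times[OF compact_L compact_L]] by simp
qed

abbreviation "M \<equiv> realization F \<alpha>"

definition q :: "(nat \<Rightarrow> nat) \<Rightarrow> (nat \<Rightarrow> nat) set" where "q x = E `` {x}"

lemma topspace_lim_top: "topspace (lim_top F \<alpha>) = L"
  by (simp add: lim_top_eq)

lemma q_eq_iff: "x \<in> L \<Longrightarrow> y \<in> L \<Longrightarrow> q x = q y \<longleftrightarrow> (x, y) \<in> E"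
  unfolding q_def by (rule eq_equiv_class_iff[OF E_equiv])

lemma quotient_q: "L // E = q ` L"
  by (auto simp: quotient_def q_def)

lemma openin_M: "openin M U \<longleftrightarrow> U \<subseteq> q ` L \<and> openin (top_of_set L) {x \<in> L. q x \<in> U}"
proof -
  have "openin M U \<longleftrightarrow> U \<subseteq> L // E \<and> openin (top_of_set L) (\<Union>U)"
    unfolding realization_def quotient_top_def
    using topology_inverse'[OF istopology_quotient, of "lim_top F \<alpha>" E] E_equiv
    by (simp add: topspace_lim_top lim_top_eq)
  moreover have "\<Union>U = {x \<in> L. q x \<in> U}" if U: "U \<subseteq> q ` L"
  proof
    show "\<Union>U \<subseteq> {x \<in> L. q x \<in> U}"
    proof
      fix x assume "x \<in> \<Union>U"
      then obtain A where A: "A \<in> U" "x \<in> A" by blast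
      then obtain y where y: "y \<in> L" "A = q y" using U by blast
      then have "(y, x) \<in> E" using A by (simp add: q_def)
      then show "x \<in> {x \<in> L. q x \<in> U}" using ED(2)[of y x] q_eq_iff[of y x] y A by auto
    qed
    show "{x \<in> L. q x \<in> U} \<subseteq> \<Union>U" using E_refl by (auto simp: q_def)
  qed
  ultimately show ?thesis unfolding quotient_q by auto
qed

lemma topspace_M: "topspace M = q ` L"
proof
  show "topspace M \<subseteq> q ` L" using openin_topspace[of M] unfolding openin_M by blast
  have "{x \<in> L. q x \<in> q ` L} = L" by blast
  then have "openin M (q ` L)" unfolding openin_M by simp
  then show "q ` L \<subseteq> topspace M" by (rule openin_subset)
qed

lemma quotient_map_q: "quotient_map (top_of_set L) M q"
  unfolding quotient_map_def topspace_M by (auto simp: openin_M)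

lemma continuous_map_q: "continuous_map (top_of_set L) M q"
  by (rule quotient_imp_continuous_map[OF quotient_map_q])

lemma function_on_M:
  assumes f: "continuous_on L f" "\<And>x y. (x, y) \<in> E \<Longrightarrow> f x = (f y :: real)"
  obtains g where "continuous_map M euclideanreal g" "\<And>x. x \<in> L \<Longrightarrow> g (q x) = f x"
proof -
  have "continuous_map (top_of_set L) euclideanreal f" using f(1) by simp
  then show thesis
    by (rule quotient_map_lift_exists[OF quotient_map_q]) (use f(2) q_eq_iff that in auto)
qed

lemma compact_space_M: "compact_space M"
  using image_compactin[OF _ continuous_map_q, of L] compact_L
  by (simp add: compact_space_def topspace_M compactin_subtopology)

lemma metrizable_M: "metrizable_space M"
proof -
  have "\<exists>g. continuous_map M euclideanreal g \<and>
    (\<forall>x\<in>L. \<forall>y\<in>L. x k = v \<longrightarrow> (x k, y k) \<notin> edges (F k) \<longrightarrow> g (q x) \<noteq> g (q y))" for k v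
  proof -
    obtain G where G: "continuous_on L G" "\<And>x y. (x, y) \<in> E \<Longrightarrow> G x = G y"
      "\<And>x y. x \<in> L \<Longrightarrow> y \<in> L \<Longrightarrow> x k = v \<Longrightarrow> (x k, y k) \<notin> edges (F k) \<Longrightarrow> G x < (G y :: real)"
      using separating_function[of k v] by metis
    obtain g where "continuous_map M euclideanreal g" "\<And>x. x \<in> L \<Longrightarrow> g (q x) = G x"
      using function_on_M[OF G(1,2)] by metis
    then show ?thesis using G(3) by (metis less_irrefl)
  qed
  then obtain g where g: "\<And>k v. continuous_map M euclideanreal (g k v)"
    "\<And>k v x y. x \<in> L \<Longrightarrow> y \<in> L \<Longrightarrow> x k = v \<Longrightarrow> (x k, y k) \<notin> edges (F k) \<Longrightarrow> g k v (q x) \<noteq> g k v (q y)"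
    by metis
  let ?P = "product_topology (\<lambda>i :: nat \<times> nat. euclideanreal) UNIV"
  define \<Phi> where "\<Phi> p = (\<lambda>i. g (fst i) (snd i) p)" for p
  have mP: "metrizable_space ?P"
    by (rule metrizable_topology_D) (simp_all add: metrizable_space_euclidean)
  have c: "continuous_map M ?P \<Phi>"
    unfolding continuous_map_componentwise_UNIV \<Phi>_def using g(1) by simp
  have inj: "inj_on \<Phi> (topspace M)"
  proof (rule inj_onI)
    fix p p' assume p: "p \<in> topspace M" "p' \<in> topspace M" "\<Phi> p = \<Phi> p'"
    then obtain x y where xy: "x \<in> L" "y \<in> L" "p = q x" "p' = q y" unfolding topspace_M by blast
    have "(x k, y k) \<in> edges (F k)" for k
      using g(2)[OF xy(1,2) refl, of k] fun_cong[OF p(3), of "(k, x k)"] xy(3,4) by (auto simp: \<Phi>_def)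
    then have "(x, y) \<in> E" using xy by (simp add: lim_edges_def)
    then show "p = p'" using q_eq_iff xy by blast
  qed
  have "homeomorphic_map M (subtopology ?P (\<Phi> ` topspace M)) \<Phi>"
  proof (rule continuous_imp_homeomorphic_map[OF _ compact_space_M])
    show "continuous_map M (subtopology ?P (\<Phi> ` topspace M)) \<Phi>"
      using c by (simp add: continuous_map_in_subtopology)
    show "Hausdorff_space (subtopology ?P (\<Phi> ` topspace M))"
      by (intro Hausdorff_space_subtopology metrizable_imp_Hausdorff_space mP)
    show "\<Phi> ` topspace M = topspace (subtopology ?P (\<Phi> ` topspace M))" by simp
  qed (rule inj)
  then have "M homeomorphic_space subtopology ?P (\<Phi> ` topspace M)"
    by (rule homeomorphic_map_imp_homeomorphic_space)
  then show ?thesis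
    using homeomorphic_metrizable_space metrizable_space_subtopology[OF mP] by blast
qed

lemma Hausdorff_M: "Hausdorff_space M"
  by (rule metrizable_imp_Hausdorff_space[OF metrizable_M])

lemma compactin_M_iff: "compactin M K \<longleftrightarrow> closedin M K"
  using compactin_imp_closedin[OF Hausdorff_M] closedin_compact_space[OF compact_space_M] by blast

lemma compactin_q: "closed Z \<Longrightarrow> Z \<subseteq> L \<Longrightarrow> compactin M (q ` Z)"
  by (rule image_compactin[OF _ continuous_map_q]) (simp add: compactin_subtopology compact_thread)

section \<open>Subcontinua of the quotient and closed connected sets of threads\<close>

definition preim :: "(nat \<Rightarrow> nat) set set \<Rightarrow> (nat \<Rightarrow> nat) set" where "preim K = {x \<in> L. q x \<in> K}"

lemma preim_sub: "preim K \<subseteq> L" and q_preim: "K \<subseteq> topspace M \<Longrightarrow> q ` preim K = K"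
  unfolding preim_def topspace_M by auto

lemma closed_preim:
  assumes "closedin M K"
  shows "closed (preim K)"
proof -
  have "closedin (top_of_set L) {x \<in> topspace (top_of_set L). q x \<in> K}"
    by (rule closedin_continuous_map_preimage[OF continuous_map_q assms])
  then have "closedin (top_of_set L) (preim K)" by (simp add: preim_def)
  then show ?thesis using closed_L closedin_closed_trans by blast
qed

text \<open>A separation of the image would pull back to two closed sets of threads without an edge
  between them, since adjacent threads have the same image. But connected levels give an edge or a
  common vertex at every level, and \<open>E_compact\<close> turns these into an edge of the
  limit.\<close>

lemma connectedin_q:
  assumes Z: "closed Z" "Z \<subseteq> L" "thread_conn Z"
  shows "connectedin M (q ` Z)"
  unfolding connectedin_closedin
proof (intro conjI notI)
  show "q ` Z \<subseteq> topspace M" using Z unfolding topspace_M by blast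
  assume "\<exists>E1 E2. closedin M E1 \<and> closedin M E2 \<and> q ` Z \<subseteq> E1 \<union> E2 \<and> E1 \<inter> E2 \<inter> q ` Z = {} \<and>
    E1 \<inter> q ` Z \<noteq> {} \<and> E2 \<inter> q ` Z \<noteq> {}"
  then obtain A B where AB: "closedin M A" "closedin M B" "q ` Z \<subseteq> A \<union> B" "A \<inter> B \<inter> q ` Z = {}"
    "A \<inter> q ` Z \<noteq> {}" "B \<inter> q ` Z \<noteq> {}" by blast
  let ?A = "Z \<inter> preim A" and ?B = "Z \<inter> preim B"
  have cl: "closed ?A" "closed ?B" using closed_preim[OF AB(1)] closed_preim[OF AB(2)] Z(1) by auto
  have cov: "?A \<union> ?B = Z" "?A \<noteq> {}" "?B \<noteq> {}" using AB Z(2) unfolding preim_def by auto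
  have noE: "\<not> (\<exists>x\<in>?A. \<exists>y\<in>?B. (x, y) \<in> E)"
  proof
    assume "\<exists>x\<in>?A. \<exists>y\<in>?B. (x, y) \<in> E"
    then obtain x y where "x \<in> ?A" "y \<in> ?B" "q x = q y" using q_eq_iff Z(2) by blast
    then show False using AB(4) unfolding preim_def by auto
  qed
  have "\<exists>x\<in>?A. \<exists>y\<in>?B. (x n, y n) \<in> edges (F n)" for n
  proof (cases "level n ?A \<inter> level n ?B = {}")
    case True
    have "gconnected (F n) (level n Z)" using Z(3) by (simp add: thread_conn_def)
    moreover have "level n ?A \<union> level n ?B = level n Z" using cov(1) by (metis image_Un)
    ultimately show ?thesis using gconnectedD[of "F n" _ "level n ?A" "level n ?B"] True cov(2,3) by blast
  next
    case False
    then obtain x y where xy: "x \<in> ?A" "y \<in> ?B" "x n = y n" by auto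
    then have "(x n, y n) \<in> edges (F n)" using rooted_treeD(6)[OF RT LD(1)[of x n]] Z(2) by auto
    then show ?thesis using xy by blast
  qed
  then have "\<exists>x\<in>?A. \<exists>y\<in>?B. (x, y) \<in> E" using cl Z(2) by (intro E_compact) auto
  then show False using noE by blast
qed

text \<open>The parts of \<open>preim K\<close> over the two halves of a level have closed images
  covering \<open>K\<close>. These meet, and a common point comes from two adjacent threads, which
  project to an edge between the halves.\<close>

lemma thread_conn_preim:
  assumes K: "closedin M K" "connectedin M K"
  shows "thread_conn (preim K)"
  unfolding thread_conn_def
proof
  fix n
  let ?Z = "preim K"
  show "gconnected (F n) (level n ?Z)"
  proof (rule gconnected_by_edges)
    show "level n ?Z \<subseteq> verts (F n)" using preim_sub LD(1) by blast
    fix A B assume AB: "A \<union> B = level n ?Z" "A \<inter> B = {}" "A \<noteq> {}" "B \<noteq> {}"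
    let ?A = "?Z \<inter> {x. x n \<in> A}" and ?B = "?Z \<inter> {x. x n \<in> B}"
    have cl: "closed ?A" "closed ?B" using closed_preim[OF K(1)] closed_coord by blast+
    have cM: "closedin M (q ` ?A)" "closedin M (q ` ?B)"
      using compactin_q[OF cl(1)] compactin_q[OF cl(2)] preim_sub unfolding compactin_M_iff by blast+
    have un: "?A \<union> ?B = ?Z" using AB(1) by blast
    have KQ: "q ` ?A \<union> q ` ?B = K"
      using q_preim[OF closedin_subset[OF K(1)]] un by (metis image_Un)
    have ne: "?A \<noteq> {}" "?B \<noteq> {}"
    proof -
      obtain a b where "a \<in> A" "b \<in> B" using AB by blast
      then have "a \<in> level n ?Z" "b \<in> level n ?Z" using AB(1) by blast+
      then show "?A \<noteq> {}" "?B \<noteq> {}" using \<open>a \<in> A\<close> \<open>b \<in> B\<close> by auto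
    qed
    have "q ` ?A \<inter> q ` ?B \<noteq> {}"
    proof
      assume "q ` ?A \<inter> q ` ?B = {}"
      then have "q ` ?A = {} \<or> q ` ?B = {}"
        by (rule connectedin_closed_cases[OF K(2) cM KQ])
      then show False using ne by blast
    qed
    then obtain x y where xy: "x \<in> ?A" "y \<in> ?B" "q x = q y" by blast
    then have "(x, y) \<in> E" using q_eq_iff preim_sub by blast
    then have "(x n, y n) \<in> edges (F n)" by (rule ED)
    then show "\<exists>a\<in>A. \<exists>b\<in>B. (a, b) \<in> edges (F n)" using xy by blast
  qed
qed

lemma subcontinuum_iff: "subcontinuum M K \<longleftrightarrow> K \<noteq> {} \<and> closedin M K \<and> connectedin M K"
  unfolding subcontinuum_def continuum_def compactin_M_iff[symmetric]
  using metrizable_space_subtopology[OF metrizable_M, of K]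
  by (auto simp: connectedin_def compactin_subspace inf.absorb2)

text \<open>The intersection is the limit of the intersections of levels, though its own levels may
  be smaller; \<open>lim_conn\<close> takes care of that.\<close>

lemma thread_conn_Int:
  assumes Z: "thread_closed Z1" "thread_conn Z1" "thread_closed Z2" "thread_conn Z2"
  shows "thread_conn (Z1 \<inter> Z2)"
proof -
  have sub: "Z1 \<subseteq> L" "Z2 \<subseteq> L" using Z unfolding thread_closed_def by auto
  have "x \<in> Z1 \<inter> Z2 \<longleftrightarrow> x \<in> L \<and> (\<forall>m\<ge>0. x m \<in> level m Z1 \<inter> level m Z2)" for x
    using Z(1,3) sub unfolding thread_closed_def by blast
  then have "Z1 \<inter> Z2 = {z \<in> L. \<forall>m\<ge>0. z m \<in> level m Z1 \<inter> level m Z2}"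
    by (intro set_eqI) (simp only: mem_Collect_eq)
  moreover have "thread_conn {z \<in> L. \<forall>m\<ge>0. z m \<in> level m Z1 \<inter> level m Z2}"
  proof (rule lim_conn)
    fix m
    show "gconnected (F m) (level m Z1 \<inter> level m Z2)"
      using Z(2,4) unfolding thread_conn_def by (intro gconnected_Int[OF RT]) blast+
    show "\<alpha> m ` (level (Suc m) Z1 \<inter> level (Suc m) Z2) \<subseteq> level m Z1 \<inter> level m Z2"
      using level_bnd[OF sub(1), of m "Suc m"] level_bnd[OF sub(2), of m "Suc m"]
      by (auto simp: bond_one[abs_def])
  qed
  ultimately show ?thesis by (rule ssubst)
qed

lemma hered_unicoherent_M: "hered_unicoherent M"
  unfolding hered_unicoherent_def
proof (intro allI impI)
  fix K K' assume "subcontinuum M K \<and> subcontinuum M K'"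
  then have K: "closedin M K" "connectedin M K" "closedin M K'" "connectedin M K'" by (auto simp: subcontinuum_iff)
  have tc: "thread_closed (preim K)" "thread_closed (preim K')"
    using closed_preim K preim_sub by (auto simp: thread_closed_iff)
  have Int: "preim K \<inter> preim K' = preim (K \<inter> K')" unfolding preim_def by blast
  have "thread_conn (preim (K \<inter> K'))"
    unfolding Int[symmetric] by (intro thread_conn_Int tc thread_conn_preim K)
  then have "connectedin M (q ` preim (K \<inter> K'))"
    by (intro connectedin_q closed_preim closedin_Int K preim_sub)
  then show "connectedin M (K \<inter> K')"
    using q_preim[of "K \<inter> K'"] closedin_subset[OF K(1)] by (metis le_infI1)
qed

end

subsection \<open>Arcs\<close>

text \<open>A continuous injection of a compact space into the line is an embedding. By
  connectedness its image is the interval between the values at \<open>p\<close> and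
  \<open>r\<close>, and rescaling gives the parametrization.\<close>

lemma arc_of_function:
  assumes A: "compactin X A" "connectedin X A" and f: "continuous_map (subtopology X A) euclideanreal f" "inj_on f A"
    and pr: "p \<in> A" "r \<in> A" "f p < f r" and b: "\<And>a. a \<in> A \<Longrightarrow> f p \<le> f a \<and> f a \<le> f r"
  obtains g where "arc_param X A g" "g 0 = p" "g 1 = r"
proof -
  have AX: "A \<subseteq> topspace X" using A(1) by (rule compactin_subset_topspace)
  let ?Y = "subtopology X A"
  have tY: "topspace ?Y = A" using AX by auto
  have "connectedin euclideanreal (f ` A)"
    using connectedin_continuous_map_image[OF f(1), of A] A(2) AX by (simp add: connectedin_subtopology)
  then have con: "connected (f ` A)" by simp
  have fA: "f ` A = {f p..f r}"
  proof
    show "f ` A \<subseteq> {f p..f r}" using b by auto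
    show "{f p..f r} \<subseteq> f ` A" using connected_contains_Icc[OF con] pr by blast
  qed
  define \<phi> where "\<phi> a = (f a - f p) / (f r - f p)" for a
  have cont: "continuous_map ?Y euclideanreal \<phi>"
    unfolding \<phi>_def using pr(3) by (intro continuous_map_real_divide continuous_map_diff f continuous_map_const[THEN iffD2]) auto
  have im: "\<phi> ` A = {0..1}"
  proof
    show "\<phi> ` A \<subseteq> {0..1}" using b pr(3) by (auto simp: \<phi>_def divide_simps)
    show "{0..1} \<subseteq> \<phi> ` A"
    proof
      fix t :: real assume t: "t \<in> {0..1}"
      have "f p + t * (f r - f p) \<in> {f p..f r}"
      proof -
        have "0 \<le> t * (f r - f p)" "t * (f r - f p) \<le> 1 * (f r - f p)"
          using t pr(3) by (auto intro: mult_right_mono)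
        then show ?thesis by simp
      qed
      then obtain a where "a \<in> A" "f a = f p + t * (f r - f p)" using fA by (metis imageE)
      then show "t \<in> \<phi> ` A" using pr(3) by (intro image_eqI[of _ _ a]) (auto simp: \<phi>_def)
    qed
  qed
  have "homeomorphic_map ?Y (top_of_set {0..1}) \<phi>"
  proof (rule continuous_imp_homeomorphic_map)
    show "continuous_map ?Y (top_of_set {0..1}) \<phi>" using cont im tY by (auto simp: continuous_map_in_subtopology)
    show "compact_space ?Y" using A(1) by (rule compact_space_subtopology)
    show "\<phi> ` topspace ?Y = topspace (top_of_set {0..1})" using im tY by simp
    show "inj_on \<phi> (topspace ?Y)"
      unfolding tY using f(2) pr(3) by (auto simp: inj_on_def \<phi>_def)
  qed (simp add: Hausdorff_space_subtopology)
  then obtain g where g: "homeomorphic_maps ?Y (top_of_set {0..1}) \<phi> g"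
    using homeomorphic_map_maps by blast
  have inv: "g (\<phi> a) = a" if "a \<in> A" for a using g that tY unfolding homeomorphic_maps_def by blast
  have "homeomorphic_map (top_of_set {0..1}) ?Y g"
    using g homeomorphic_maps_sym homeomorphic_maps_map by blast
  then have "arc_param X A g" using AX by (simp add: arc_param_def)
  moreover have "g 0 = p" "g 1 = r"
    using inv[OF pr(1)] inv[OF pr(2)] pr(3) by (simp_all add: \<phi>_def)
  ultimately show thesis by (rule that)
qed

lemma arc_paramD:
  assumes "arc_param X A g"
  shows "A \<subseteq> topspace X" "compactin X A" "connectedin X A" "g ` {0..1} = A" "inj_on g {0..1}"
proof -
  have A: "A \<subseteq> topspace X" and h: "homeomorphic_map (top_of_set {0..1}) (subtopology X A) g"
    using assms by (auto simp: arc_param_def)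
  have im: "g ` {0..1} = A" using homeomorphic_imp_surjective_map[OF h] A by auto
  have c: "continuous_map (top_of_set {0..1}) X g"
    using homeomorphic_imp_continuous_map[OF h] by (simp add: continuous_map_in_subtopology)
  have "compactin (top_of_set {0..1}) {0..1::real}" by (simp add: compactin_subtopology)
  then show "compactin X A" using image_compactin[OF _ c] im by metis
  have "connectedin (top_of_set {0..1}) {0..1::real}" by (simp add: connectedin_subtopology)
  then show "connectedin X A" using connectedin_continuous_map_image[OF c] im by metis
  show "A \<subseteq> topspace X" "g ` {0..1} = A" using A im by auto
  show "inj_on g {0..1}" using homeomorphic_imp_injective_map[OF h] by simp
qed

lemma arc_connected_subset:
  assumes g: "arc_param X A g" and C: "connectedin X C" "C \<subseteq> A" "g 0 \<in> C" "g 1 \<in> C"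
  shows "C = A"
proof -
  have AX: "A \<subseteq> topspace X" using arc_paramD[OF g] by blast
  have "homeomorphic_map (top_of_set {0..1}) (subtopology X A) g"
    using g by (simp add: arc_param_def)
  then obtain h where h: "homeomorphic_maps (top_of_set {0..1}) (subtopology X A) g h"
    using homeomorphic_map_maps by blast
  have hg: "h (g t) = t" if "t \<in> {0..1}" for t
    using h that unfolding homeomorphic_maps_def by auto
  have "continuous_map (subtopology X A) (top_of_set {0..1}) h"
    using h unfolding homeomorphic_maps_def by blast
  then have hc: "continuous_map (subtopology X A) euclideanreal h"
    by (simp add: continuous_map_in_subtopology)
  have "connectedin (subtopology X A) C" using C by (simp add: connectedin_subtopology)
  then have "connectedin euclideanreal (h ` C)" by (rule connectedin_continuous_map_image[OF hc])
  then have con: "connected (h ` C)" by simp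
  have "0 \<in> h ` C" "1 \<in> h ` C"
    using hg[of 0] hg[of 1] C(3,4) by (auto intro: rev_image_eqI)
  then have I: "{0..1} \<subseteq> h ` C" using connected_contains_Icc[OF con] by blast
  have "A \<subseteq> C"
  proof
    fix a assume "a \<in> A"
    then obtain t where t: "t \<in> {0..1}" "a = g t" using arc_paramD(4)[OF g] by blast
    then obtain c where c: "c \<in> C" "h c = t" using I by (metis imageE subsetD)
    then obtain t' where t': "t' \<in> {0..1}" "c = g t'" using arc_paramD(4)[OF g] C(2) by blast
    then have "t' = t" using hg c by simp
    then show "a \<in> C" using t t' c by simp
  qed
  then show ?thesis using C(2) by blast
qed

context tc_limit
begin

section \<open>Order segments of the quotient as arcs\<close>

definition H :: "(nat \<Rightarrow> nat) \<Rightarrow> real" where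
  "H = (SOME H. continuous_on L H \<and> (\<forall>x y. (x, y) \<in> E \<longrightarrow> H x = H y) \<and> (\<forall>x y. x \<sqsubseteq> y \<longrightarrow> H x \<le> H y) \<and>
    (\<forall>x y. x \<sqsubseteq> y \<longrightarrow> H x = H y \<longrightarrow> (x, y) \<in> E))"

lemma H: "continuous_on L H" "\<And>x y. (x, y) \<in> E \<Longrightarrow> H x = H y" "\<And>x y. x \<sqsubseteq> y \<Longrightarrow> H x \<le> H y"
  "\<And>x y. x \<sqsubseteq> y \<Longrightarrow> H x = H y \<Longrightarrow> (x, y) \<in> E"
proof -
  have "\<exists>H :: _ \<Rightarrow> real. continuous_on L H \<and> (\<forall>x y. (x, y) \<in> E \<longrightarrow> H x = H y) \<and> (\<forall>x y. x \<sqsubseteq> y \<longrightarrow> H x \<le> H y) \<and>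
    (\<forall>x y. x \<sqsubseteq> y \<longrightarrow> H x = H y \<longrightarrow> (x, y) \<in> E)"
  proof (rule height_function)
    fix H :: "(nat \<Rightarrow> nat) \<Rightarrow> real"
    assume *: "continuous_on L H" "\<And>x y. (x, y) \<in> E \<Longrightarrow> H x = H y" "\<And>x y. x \<sqsubseteq> y \<Longrightarrow> H x \<le> H y"
      "\<And>x y. x \<sqsubseteq> y \<Longrightarrow> H x = H y \<Longrightarrow> (x, y) \<in> E"
    show ?thesis by (intro exI[of _ H] conjI allI impI) (fact *)+
  qed
  from someI_ex[OF this, folded H_def]
  show "continuous_on L H" "\<And>x y. (x, y) \<in> E \<Longrightarrow> H x = H y" "\<And>x y. x \<sqsubseteq> y \<Longrightarrow> H x \<le> H y"
    "\<And>x y. x \<sqsubseteq> y \<Longrightarrow> H x = H y \<Longrightarrow> (x, y) \<in> E" by blast+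
qed

definition hM :: "(nat \<Rightarrow> nat) set \<Rightarrow> real" where
  "hM = (SOME g. continuous_map M euclideanreal g \<and> (\<forall>x\<in>L. g (q x) = H x))"

lemma hM: "continuous_map M euclideanreal hM" "\<And>x. x \<in> L \<Longrightarrow> hM (q x) = H x"
proof -
  have "\<exists>g. continuous_map M euclideanreal g \<and> (\<forall>x\<in>L. g (q x) = H x)"
    using function_on_M[OF H(1,2)] by metis
  from someI_ex[OF this, folded hM_def]
  show "continuous_map M euclideanreal hM" "\<And>x. x \<in> L \<Longrightarrow> hM (q x) = H x" by blast+
qed

definition seg :: "(nat \<Rightarrow> nat) \<Rightarrow> (nat \<Rightarrow> nat) \<Rightarrow> (nat \<Rightarrow> nat) set set" where
  "seg s x = q ` {t. s \<sqsubseteq> t \<and> t \<sqsubseteq> x}"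

lemma segI: "s \<sqsubseteq> t \<Longrightarrow> t \<sqsubseteq> x \<Longrightarrow> q t \<in> seg s x"
  by (auto simp: seg_def)

lemma seg_ends: "s \<sqsubseteq> x \<Longrightarrow> q s \<in> seg s x" "s \<sqsubseteq> x \<Longrightarrow> q x \<in> seg s x"
  using segI le_refl' leD by blast+

lemma seg_closed: "s \<sqsubseteq> x \<Longrightarrow> closedin M (seg s x)"
  using interval_closed_conn(1)[of s x] leD[of s x] compactin_q[of "{t. s \<sqsubseteq> t \<and> t \<sqsubseteq> x}"]
  unfolding thread_closed_iff seg_def compactin_M_iff by blast

lemma seg_connected: "s \<sqsubseteq> x \<Longrightarrow> connectedin M (seg s x)"
  using interval_closed_conn[of s x] leD[of s x] connectedin_q[of "{t. s \<sqsubseteq> t \<and> t \<sqsubseteq> x}"]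
  unfolding thread_closed_iff seg_def by blast

lemma seg_bounds: "p \<in> seg s x \<Longrightarrow> H s \<le> hM p \<and> hM p \<le> H x"
  unfolding seg_def using hM(2) H(3) leD by auto

text \<open>Points of a segment come from comparable threads, and for these equal height means
  adjacency.\<close>

lemma inj_on_seg: "inj_on hM (seg s x)"
proof (rule inj_onI)
  fix p p' assume "p \<in> seg s x" "p' \<in> seg s x" and e: "hM p = hM p'"
  then obtain t t' where t: "p = q t" "p' = q t'" "t \<sqsubseteq> x" "t' \<sqsubseteq> x" unfolding seg_def by blast
  then have Ht: "H t = H t'" using e hM(2) leD by metis
  have "t \<sqsubseteq> t' \<or> t' \<sqsubseteq> t" using le_chain t by blast
  then have "(t, t') \<in> E" using H(4)[of t t'] H(4)[of t' t] Ht E_sym by metis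
  then show "p = p'" using q_eq_iff t leD by metis
qed

lemma hM_seg_continuous: "continuous_map (subtopology M A) euclideanreal hM"
  by (rule continuous_map_from_subtopology[OF hM(1)])

lemma seg_arc:
  assumes sx: "s \<sqsubseteq> x" and ne: "q s \<noteq> q x"
  obtains g where "arc_param M (seg s x) g" "g 0 = q s" "g 1 = q x"
proof -
  have L: "s \<in> L" "x \<in> L" using leD[OF sx] by auto
  have "H s \<noteq> H x" using H(4)[OF sx] ne q_eq_iff L by blast
  then have lt: "hM (q s) < hM (q x)" using H(3)[OF sx] hM(2) L by simp
  show thesis
    by (rule arc_of_function[where X = M and A = "seg s x" and f = hM and p = "q s" and r = "q x"])
      (use seg_closed[OF sx] seg_connected[OF sx] inj_on_seg hM_seg_continuous seg_ends[OF sx] lt seg_bounds hM(2) L that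
        in \<open>simp_all add: compactin_M_iff\<close>)
qed

lemma seg_trivial: "s \<sqsubseteq> x \<Longrightarrow> q s = q x \<Longrightarrow> seg s x = {q s}"
proof -
  assume sx: "s \<sqsubseteq> x" and e: "q s = q x"
  have L: "s \<in> L" "x \<in> L" using leD[OF sx] by auto
  have Hsx: "H s = H x" using hM(2) L e by metis
  have "p = q s" if p: "p \<in> seg s x" for p
  proof -
    have "hM p = hM (q s)" using seg_bounds[OF p] Hsx hM(2) L by simp
    then show ?thesis using inj_onD[OF inj_on_seg _ p seg_ends(1)[OF sx]] by blast
  qed
  then show ?thesis using seg_ends(1)[OF sx] by blast
qed

lemma arc_from_seg: "s \<sqsubseteq> x \<Longrightarrow> arc_from M (q s) (q x) (seg s x)"
  unfolding arc_from_def using seg_trivial seg_arc leD topspace_M by (metis imageI)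

lemma arc_subcontinuum: "arc_param M A g \<Longrightarrow> subcontinuum M A"
  unfolding subcontinuum_iff using arc_paramD[of M A g] compactin_M_iff by force

text \<open>By hereditary unicoherence the intersection is connected, and a connected part of an arc
  containing both ends is the whole arc.\<close>

lemma arc_in_subcontinuum:
  assumes g: "arc_param M A g" and K: "subcontinuum M K" "g 0 \<in> K" "g 1 \<in> K"
  shows "A \<subseteq> K"
proof -
  have "connectedin M (A \<inter> K)"
    using hered_unicoherent_M arc_subcontinuum[OF g] K(1) unfolding hered_unicoherent_def by blast
  moreover have "g 0 \<in> A" "g 1 \<in> A" using arc_paramD(4)[OF g] by auto
  ultimately have "A \<inter> K = A" using arc_connected_subset[OF g, of "A \<inter> K"] K by blast
  then show ?thesis by blast
qed

lemma seg_in_arc: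
  assumes t: "t \<in> L" and A: "arc_from M (q rt) (q t) A"
  shows "seg rt t \<subseteq> A"
proof (cases "q rt = q t")
  case True
  then show ?thesis using seg_trivial[OF rt_le[OF t]] A unfolding arc_from_def by auto
next
  case False
  then obtain g where g: "arc_param M A g" "g 0 = q rt" "g 1 = q t" using A unfolding arc_from_def by blast
  have ends: "q rt \<in> A" "q t \<in> A" using arc_paramD(4)[OF g(1)] g(2,3) by (metis atLeastAtMost_iff imageI le_numeral_extra(3) zero_le_one le_numeral_extra(4))+
  obtain h where h: "arc_param M (seg rt t) h" "h 0 = q rt" "h 1 = q t" by (rule seg_arc[OF rt_le[OF t] False])
  show ?thesis by (rule arc_in_subcontinuum[OF h(1) arc_subcontinuum[OF g(1)]]) (use h ends in simp_all)
qed

text \<open>The segment \<open>seg rt t\<close> is an arc from the base point and lies in every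
  other arc with the same ends. So this relation is the image of the order on threads, which is
  compact.\<close>

lemma order_closed:
  "closedin (prod_topology M M)
     {(x, y). x \<in> topspace M \<and> y \<in> topspace M \<and> (\<forall>A. arc_from M (q rt) y A \<longrightarrow> x \<in> A)}"
proof -
  let ?f = "\<lambda>(s, t). (q s, q t)"
  have "{(x, y). x \<in> topspace M \<and> y \<in> topspace M \<and> (\<forall>A. arc_from M (q rt) y A \<longrightarrow> x \<in> A)} = ?f ` {(s, t). s \<sqsubseteq> t}"
    (is "?S = _")
  proof
    show "?S \<subseteq> ?f ` {(s, t). s \<sqsubseteq> t}"
    proof
      fix z assume "z \<in> ?S"
      then obtain p y where z: "z = (p, y)" "y \<in> topspace M" "\<And>A. arc_from M (q rt) y A \<Longrightarrow> p \<in> A" by blast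
      then obtain t where t: "t \<in> L" "y = q t" unfolding topspace_M by blast
      have "p \<in> seg rt t" using z(3) arc_from_seg[OF rt_le[OF t(1)]] t(2) by blast
      then obtain s where "s \<sqsubseteq> t" "p = q s" unfolding seg_def by blast
      then show "z \<in> ?f ` {(s, t). s \<sqsubseteq> t}" using z(1) t(2) by force
    qed
    show "?f ` {(s, t). s \<sqsubseteq> t} \<subseteq> ?S"
    proof
      fix z assume "z \<in> ?f ` {(s, t). s \<sqsubseteq> t}"
      then obtain s t where st: "s \<sqsubseteq> t" "z = (q s, q t)" by auto
      have "q s \<in> A" if "arc_from M (q rt) (q t) A" for A
        using seg_in_arc[OF leD(2)[OF st(1)] that] segI[OF rt_le[OF leD(1)[OF st(1)]] st(1)] by blast
      then show "z \<in> ?S" using st leD[OF st(1)] unfolding topspace_M by blast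
    qed
  qed
  moreover have "compactin (prod_topology M M) (?f ` {(s, t). s \<sqsubseteq> t})"
  proof (rule image_compactin)
    have "{(s, t). s \<sqsubseteq> t} \<subseteq> L \<times> L" using leD by blast
    then show "compactin (prod_topology (top_of_set L) (top_of_set L)) {(s, t). s \<sqsubseteq> t}"
      using compact_le by (simp add: prod_topology_subtopology_eu compactin_subtopology)
    show "continuous_map (prod_topology (top_of_set L) (top_of_set L)) (prod_topology M M) ?f"
      using continuous_map_q continuous_map_prod_top[of "top_of_set L" "top_of_set L" M M q q] by blast
  qed
  ultimately show ?thesis
    using compactin_imp_closedin[of "prod_topology M M"] Hausdorff_M by (simp add: Hausdorff_space_prod_topology)
qed

lemma thread_conn_L: "thread_conn L"
  unfolding thread_conn_def
proof
  fix m
  have "level m L = verts (F m)" using LD(1) L_surj by (metis (no_types, lifting) image_eqI image_subset_iff subsetI subset_antisym)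
  moreover have "gconnected (F m) (verts (F m))"
    using gconnected_iff[OF RT, of "verts (F m)" m] rooted_treeD(2)[OF RT, of m] par_in[OF RT, of _ m] by blast
  ultimately show "gconnected (F m) (level m L)" by simp
qed

lemma continuum_M: "continuum M"
proof -
  have "connectedin M (topspace M)"
    unfolding topspace_M by (rule connectedin_q[OF closed_L order_refl thread_conn_L])
  then show ?thesis
    unfolding continuum_def using compact_space_M metrizable_M rt_L connectedin_topspace[of M]
    by (auto simp: topspace_M)
qed

lemma arcwise_connected_M: "arcwise_connected_sp M"
  unfolding arcwise_connected_sp_def
proof (intro ballI impI)
  fix p p' assume "p \<in> topspace M" "p' \<in> topspace M" and ne: "p \<noteq> p'"
  then obtain x y where xy: "x \<in> L" "y \<in> L" "p = q x" "p' = q y" unfolding topspace_M by blast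
  \<comment> \<open>The two segments part at their highest common point \<open>w\<close>, which may
    be represented by different threads \<open>s\<close> and \<open>s'\<close> on the two
    sides.\<close>
  let ?K = "seg rt x \<inter> seg rt y"
  have K: "compactin M ?K"
    unfolding compactin_M_iff by (intro closedin_Int seg_closed rt_le xy)
  have Kne: "?K \<noteq> {}" using seg_ends(1)[OF rt_le[OF xy(1)]] seg_ends(1)[OF rt_le[OF xy(2)]] by blast
  have "compactin euclideanreal (hM ` ?K)" by (rule image_compactin[OF K hM(1)])
  then have "\<exists>s\<in>hM ` ?K. \<forall>t\<in>hM ` ?K. t \<le> s" using Kne by (intro compact_attains_sup) auto
  then obtain w where w: "w \<in> ?K" "\<And>p. p \<in> ?K \<Longrightarrow> hM p \<le> hM w" by auto
  obtain s s' where s: "s \<sqsubseteq> x" "w = q s" "s' \<sqsubseteq> y" "w = q s'" using w(1) unfolding seg_def by blast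
  have sL: "s \<in> L" "s' \<in> L" using leD s by auto
  let ?A = "seg s x" and ?B = "seg s' y"
  have sub: "?A \<subseteq> seg rt x" "?B \<subseteq> seg rt y" unfolding seg_def using rt_le leD by blast+
  have wAB: "w \<in> ?A" "w \<in> ?B" using seg_ends(1)[OF s(1)] seg_ends(1)[OF s(3)] s by auto
  have wh: "hM w = H s" "hM w = H s'" using hM(2)[OF sL(1)] hM(2)[OF sL(2)] s(2,4) by metis+
  have lo: "hM w \<le> hM a" if "a \<in> ?A \<union> ?B" for a using that seg_bounds wh by force
  have inter: "a = w" if "a \<in> ?A" "a \<in> ?B" for a
  proof -
    have "hM a = hM w" using w(2)[of a] lo[of a] that sub by force
    then show ?thesis using inj_onD[OF inj_on_seg _ that(1) wAB(1)] by blast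
  qed
  \<comment> \<open>Signed height: it increases along the way from \<open>p\<close> down to
    \<open>w\<close> and on up to \<open>p'\<close>, so it parametrizes the concatenation of the two
    segments.\<close>
  define \<sigma> where "\<sigma> a = (if a \<in> ?A then hM w - hM a else hM a - hM w)" for a
  have \<sigma>B: "\<sigma> a = hM a - hM w" if "a \<in> ?B" for a using inter[of a] that by (auto simp: \<sigma>_def)
  have \<sigma>A: "\<sigma> a = hM w - hM a" if "a \<in> ?A" for a using that by (simp add: \<sigma>_def)
  let ?X = "subtopology M (?A \<union> ?B)"
  have clA: "closedin M ?A" "closedin M ?B" by (intro seg_closed s)+
  have cont: "continuous_map ?X euclideanreal \<sigma>"
  proof (rule pasting_lemma_closed[of "UNIV :: bool set" _ "\<lambda>b. if b then ?A else ?B" _ "\<lambda>b a. if b then hM w - hM a else hM a - hM w"])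
    fix b :: bool
    show "closedin ?X (if b then ?A else ?B)"
      using clA by (auto intro: closedin_subset_topspace)
    show "continuous_map (subtopology ?X (if b then ?A else ?B)) euclideanreal (\<lambda>a. if b then hM w - hM a else hM a - hM w)"
      by (cases b) (auto intro!: continuous_map_diff continuous_map_from_subtopology hM(1))
  next
    fix i j :: bool and a
    assume "a \<in> topspace ?X \<inter> (if i then ?A else ?B) \<inter> (if j then ?A else ?B)"
    then show "(if i then hM w - hM a else hM a - hM w) = (if j then hM w - hM a else hM a - hM w)"
      using inter[of a] by (cases i; cases j) auto
  next
    fix a assume "a \<in> topspace ?X"
    then have "a \<in> ?A \<or> a \<in> ?B" by auto
    then show "\<exists>j. j \<in> UNIV \<and> a \<in> (if j then ?A else ?B) \<and> \<sigma> a = (if j then hM w - hM a else hM a - hM w)"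
      using \<sigma>A \<sigma>B by (metis UNIV_I)
  qed simp
  have inj: "inj_on \<sigma> (?A \<union> ?B)"
  proof (rule inj_onI)
    fix a b assume ab: "a \<in> ?A \<union> ?B" "b \<in> ?A \<union> ?B" "\<sigma> a = \<sigma> b"
    have mixed: "a = b" if "a \<in> ?A" "b \<in> ?B" "\<sigma> a = \<sigma> b" for a b
    proof -
      have "hM a = hM w" "hM b = hM w" using \<sigma>A[OF that(1)] \<sigma>B[OF that(2)] that lo[of a] lo[of b] by auto
      then show ?thesis
        using inj_onD[OF inj_on_seg _ that(1) wAB(1)] inj_onD[OF inj_on_seg _ that(2) wAB(2)] by simp
    qed
    consider "a \<in> ?A" "b \<in> ?A" | "a \<in> ?B" "b \<in> ?B" | "a \<in> ?A" "b \<in> ?B" | "b \<in> ?A" "a \<in> ?B" using ab by blast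
    then show "a = b"
    proof cases
      case 1
      then show ?thesis using ab(3) \<sigma>A inj_onD[OF inj_on_seg _ 1] by simp
    next
      case 2
      then show ?thesis using ab(3) \<sigma>B inj_onD[OF inj_on_seg _ 2] by simp
    next
      case 3
      then show ?thesis using mixed ab(3) by blast
    next
      case 4
      then show ?thesis using mixed[of b a] ab(3) by simp
    qed
  qed
  have pA: "p \<in> ?A" "p' \<in> ?B" using seg_ends(2) s xy by auto
  have hp: "hM p = H x" "hM p' = H y" using hM(2) xy by auto
  have bd: "\<sigma> p \<le> \<sigma> a \<and> \<sigma> a \<le> \<sigma> p'" if "a \<in> ?A \<union> ?B" for a
    using that lo[OF that] lo[of p] lo[of p'] pA \<sigma>A[of a] \<sigma>B[of a] \<sigma>A[OF pA(1)] \<sigma>B[OF pA(2)]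
      seg_bounds[of a s x] seg_bounds[of a s' y] hp by auto
  have "\<sigma> p \<noteq> \<sigma> p'" using inj_onD[OF inj] pA ne by blast
  then have lt: "\<sigma> p < \<sigma> p'" using bd[of p] pA by auto
  have "compactin M (?A \<union> ?B)" unfolding compactin_M_iff using clA by (rule closedin_Un)
  moreover have "connectedin M (?A \<union> ?B)"
    by (intro connectedin_Un seg_connected s) (use wAB in blast)
  ultimately obtain g where "arc_param M (?A \<union> ?B) g" "g 0 = p" "g 1 = p'"
    using arc_of_function[OF _ _ cont inj, of p p'] pA lt bd by blast
  then show "\<exists>A. arc_from M p p' A" unfolding arc_from_def using ne by blast
qed

lemma dendroid_M: "dendroid M"
  unfolding dendroid_def using continuum_M hered_unicoherent_M arcwise_connected_M by blast

lemma smooth_M: "smooth_dendroid M"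
  unfolding smooth_dendroid_def
  using dendroid_M order_closed rt_L topspace_M by blast

end

lemma open_coord: "open {x :: nat \<Rightarrow> nat. x n \<in> S}"
proof -
  have "closed {x :: nat \<Rightarrow> nat. x n \<in> - S}" by (rule closed_coord)
  moreover have "{x :: nat \<Rightarrow> nat. x n \<in> S} = - {x. x n \<in> - S}" by auto
  ultimately show ?thesis by (simp add: closed_def)
qed

lemma Hausdorff_nat_fun: "Hausdorff_space (euclidean :: (nat \<Rightarrow> nat) topology)"
proof -
  have "Hausdorff_space (product_topology (\<lambda>i :: nat. euclidean :: nat topology) UNIV)"
    by (rule Hausdorff_space_product_topology[THEN iffD2]) (simp add: discrete_topology_nat[of UNIV, simplified, symmetric])
  then show ?thesis by (simp only: euclidean_product_topology)
qed

context tc_limit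
begin

subsection \<open>The Kelley property\<close>

text \<open>Uniform continuity of \<open>q\<close>, with levels measuring the closeness of threads.
  The radius \<open>e / 2\<close> allows a triangle inequality through a centre of a finite cover by
  cylinders.\<close>

lemma metric_modulus:
  assumes d: "Metric_space (topspace M) d" "Metric_space.mtopology (topspace M) d = M" and e: "e > 0"
  obtains n where "\<And>x y. x \<in> L \<Longrightarrow> y \<in> L \<Longrightarrow> x n = y n \<Longrightarrow> d (q x) (q y) < e"
proof -
  interpret m: Metric_space "topspace M" d by (rule d(1))
  have "\<exists>n. \<forall>y\<in>L. y n = x n \<longrightarrow> d (q x) (q y) < e / 2" if x: "x \<in> L" for x
  proof -
    have "openin M (m.mball (q x) (e / 2))" using m.openin_mball[of "q x" "e / 2"] unfolding d(2) .
    then have "openin (top_of_set L) {y \<in> topspace (top_of_set L). q y \<in> m.mball (q x) (e / 2)}"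
      by (rule openin_continuous_map_preimage[OF continuous_map_q])
    then obtain U where U: "open U" "{y \<in> L. q y \<in> m.mball (q x) (e / 2)} = L \<inter> U"
      by (auto simp: openin_open)
    have "q x \<in> m.mball (q x) (e / 2)" using x e by (simp add: topspace_M[symmetric] m.centre_in_mball_iff del: m.in_mball) (simp add: topspace_M)
    then have "x \<in> U" using U(2) x by blast
    then obtain n where "\<And>y. y \<in> L \<Longrightarrow> y n = x n \<Longrightarrow> y \<in> U" using cylinder_nhd[OF U(1) _ x] by blast
    then have "\<And>y. y \<in> L \<Longrightarrow> y n = x n \<Longrightarrow> q y \<in> m.mball (q x) (e / 2)" using U(2) by blast
    then show ?thesis by (metis m.in_mball)
  qed
  then obtain n where n: "\<And>x y. x \<in> L \<Longrightarrow> y \<in> L \<Longrightarrow> y (n x) = x (n x) \<Longrightarrow> d (q x) (q y) < e / 2"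
    by metis
  have "\<exists>T\<subseteq>L. finite T \<and> L \<subseteq> (\<Union>x\<in>T. {y. y (n x) \<in> {x (n x)}})"
  proof (rule compactE_image[OF compact_L, of L "\<lambda>x. {y. y (n x) \<in> {x (n x)}}"])
    show "open {y. y (n x) \<in> {x (n x)}}" for x by (rule open_coord)
  qed auto
  then obtain T where T: "T \<subseteq> L" "finite T" "L \<subseteq> (\<Union>x\<in>T. {y. y (n x) \<in> {x (n x)}})" by (elim exE conjE)
  define N where "N = Max (insert 0 (n ` T))"
  have "d (q x) (q y) < e" if xy: "x \<in> L" "y \<in> L" "x N = y N" for x y
  proof -
    obtain z where z: "z \<in> T" "x (n z) = z (n z)" using T(3) xy(1) by blast
    have "n z \<le> N" unfolding N_def using T(2) z(1) by (intro Max_ge) auto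
    then have "y (n z) = z (n z)" using L_eq_down[OF xy(1,2) _ xy(3)] z(2) by metis
    then have "d (q z) (q x) < e / 2" "d (q z) (q y) < e / 2" using n[of z x] n[of z y] z T(1) xy by auto
    moreover have "d (q x) (q y) \<le> d (q x) (q z) + d (q z) (q y)"
      using m.triangle[of "q x" "q z" "q y"] xy z T(1) unfolding topspace_M by blast
    ultimately show ?thesis using m.commute[of "q x" "q z"] by linarith
  qed
  then show thesis by (rule that)
qed

lemma hausdist_le:
  assumes d: "Metric_space (topspace M) d" and sub: "A \<subseteq> L" "B \<subseteq> L" and ne: "A \<noteq> {}"
    and lev: "level n A = level n B" and mod: "\<And>x y. x \<in> L \<Longrightarrow> y \<in> L \<Longrightarrow> x n = y n \<Longrightarrow> d (q x) (q y) < e"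
  shows "\<bar>hausdist d (q ` A) (q ` B)\<bar> \<le> e"
proof -
  interpret m: Metric_space "topspace M" d by (rule d)
  \<comment> \<open>A separate \<open>f\<close> lets the estimate serve both the distance and its
    transpose, the two halves of \<open>hausdist\<close>.\<close>
  have half: "0 \<le> (SUP a\<in>q ` X. INF b\<in>q ` Y. f a b) \<and> (SUP a\<in>q ` X. INF b\<in>q ` Y. f a b) \<le> e"
    if X: "X \<subseteq> L" "Y \<subseteq> L" "X \<noteq> {}" "level n X = level n Y" and f: "\<And>a b. f a b = d a b" for X Y and f :: "_ \<Rightarrow> _ \<Rightarrow> real"
  proof -
    have Yne: "Y \<noteq> {}" using X(3,4) by blast
    have bb: "bdd_below ((\<lambda>b. f a b) ` q ` Y)" for a by (rule bdd_belowI[of _ 0]) (auto simp: f)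
    have lo: "0 \<le> (INF b\<in>q ` Y. f a b)" for a using Yne by (intro cINF_greatest) (auto simp: f)
    have up: "(INF b\<in>q ` Y. f a b) \<le> e" if a: "a \<in> q ` X" for a
    proof -
      obtain x where x: "x \<in> X" "a = q x" using a by blast
      have "x n \<in> level n Y" using x X(4) by blast
      then obtain y where y: "y \<in> Y" "x n = y n" by auto
      have "x \<in> L" "y \<in> L" using x(1) y(1) X(1,2) by blast+
      then have "f a (q y) \<le> e" using mod[of x y] x(2) y(2) by (simp add: f)
      then show ?thesis using cINF_lower[OF bb, of "q y" a] y by force
    qed
    obtain x where x: "x \<in> X" using X(3) by blast
    have "bdd_above ((\<lambda>a. INF b\<in>q ` Y. f a b) ` q ` X)" using up by (intro bdd_aboveI[of _ e]) blast
    then have "(INF b\<in>q ` Y. f (q x) b) \<le> (SUP a\<in>q ` X. INF b\<in>q ` Y. f a b)"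
      using x by (intro cSUP_upper) auto
    then show ?thesis using lo[of "q x"] up X(3) by (auto intro: cSUP_least)
  qed
  have "B \<noteq> {}" using ne lev by blast
  then show ?thesis
    unfolding hausdist_def
    using half[OF sub ne lev refl] half[OF sub(2,1) _ lev[symmetric], of "\<lambda>b a. d a b"] m.commute by auto
qed

text \<open>At the largest level up to \<open>i\<close> where \<open>x\<close> meets the level of
  \<open>K\<close>, confluence gives a set through \<open>x\<close> with the same level as
  \<open>K\<close>; agreement there implies agreement at all lower levels. The bound
  \<open>i\<close> makes the maximum exist.\<close>

lemma continuum_through:
  assumes K: "thread_conn K" "K \<subseteq> L" and x: "x \<in> L"
  obtains Z where "thread_closed Z" "thread_conn Z" "x \<in> Z" "\<And>n. n \<le> i \<Longrightarrow> x n \<in> level n K \<Longrightarrow> level n Z = level n K"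
proof (cases "\<exists>n\<le>i. x n \<in> level n K")
  case False
  have "thread_closed L" unfolding thread_closed_iff using closed_L by simp
  then show thesis using that[OF _ thread_conn_L x] False by blast
next
  case True
  define n where "n = Max {n. n \<le> i \<and> x n \<in> level n K}"
  have fin: "finite {n. n \<le> i \<and> x n \<in> level n K}" by (rule finite_subset[of _ "{..i}"]) auto
  have n: "x n \<in> level n K" using Max_in[OF fin] True unfolding n_def by blast
  have nmax: "m \<le> n" if "m \<le> i" "x m \<in> level m K" for m
    unfolding n_def using fin that by (intro Max_ge) auto
  have "gconnected (F n) (level n K)" using K(1) by (simp add: thread_conn_def)
  then obtain Z where Z: "thread_closed Z" "thread_conn Z" "x \<in> Z" "level n Z = level n K"
    using confluent_thread[OF _ x n] by blast
  have "level m Z = level m K" if "m \<le> i" "x m \<in> level m K" for m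
  proof -
    have "Z \<subseteq> L" using Z(1) by (simp add: thread_closed_def)
    then show ?thesis using level_bnd[of Z m n] level_bnd[OF K(2), of m n] nmax[OF that] Z(4) by simp
  qed
  then show thesis using that[OF Z(1-3)] by blast
qed

lemma kelley_M: "kelley M"
  unfolding kelley_def
proof (intro conjI allI impI continuum_M)
  fix d K p pn
  assume "Metric_space (topspace M) d \<and> Metric_space.mtopology (topspace M) d = M"
    and "subcontinuum M K \<and> p \<in> K \<and> range pn \<subseteq> topspace M \<and> limitin M pn p sequentially"
  then have d: "Metric_space (topspace M) d" "Metric_space.mtopology (topspace M) d = M"
    and K: "closedin M K" "connectedin M K" "K \<noteq> {}" and p: "p \<in> K" and pn: "range pn \<subseteq> q ` L" "limitin M pn p sequentially"
    unfolding subcontinuum_iff topspace_M by blast+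
  have Kt: "thread_conn (preim K)" "preim K \<subseteq> L" using thread_conn_preim[OF K(1,2)] preim_sub by auto
  have "\<exists>x\<in>L. pn i = q x" for i using pn(1) by blast
  then obtain x where x: "\<And>i. x i \<in> L" "\<And>i. pn i = q (x i)" by metis
  have "\<exists>Z. thread_closed Z \<and> thread_conn Z \<and> x i \<in> Z \<and> (\<forall>n\<le>i. x i n \<in> level n (preim K) \<longrightarrow> level n Z = level n (preim K))" for i
    by (rule continuum_through[OF Kt x(1), of i i]) blast
  then obtain Z where Z: "\<And>i. thread_closed (Z i)" "\<And>i. thread_conn (Z i)" "\<And>i. x i \<in> Z i"
    "\<And>i n. n \<le> i \<Longrightarrow> x i n \<in> level n (preim K) \<Longrightarrow> level n (Z i) = level n (preim K)"
    by metis
  have ZL: "closed (Z i)" "Z i \<subseteq> L" for i using Z(1) by (auto simp: thread_closed_iff)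
  show "\<exists>Kn. (\<forall>n. subcontinuum M (Kn n) \<and> pn n \<in> Kn n) \<and> (\<lambda>n. hausdist d (Kn n) K) \<longlonglongrightarrow> 0"
  proof (intro exI[of _ "\<lambda>i. q ` Z i"] conjI allI)
    fix i
    show "subcontinuum M (q ` Z i)"
      unfolding subcontinuum_iff using compactin_q[OF ZL] connectedin_q[OF ZL Z(2)] Z(3)[of i]
      by (auto simp: compactin_M_iff)
    show "pn i \<in> q ` Z i" using x(2) Z(3) by blast
  next
    have KQ: "q ` preim K = K" by (rule q_preim[OF closedin_subset[OF K(1)]])
    show "(\<lambda>i. hausdist d (q ` Z i) K) \<longlonglongrightarrow> 0"
    proof (rule LIMSEQ_I)
      fix r :: real assume "r > 0"
      then have "r / 2 > 0" by simp
      then obtain n where n: "\<And>x y. x \<in> L \<Longrightarrow> y \<in> L \<Longrightarrow> x n = y n \<Longrightarrow> d (q x) (q y) < r / 2"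
        using metric_modulus[OF d] by blast
      \<comment> \<open>The threads that miss the \<open>n\<close>-th level of \<open>K\<close>.
        Their image is closed and avoids \<open>p\<close>, so for large \<open>i\<close> the thread
        \<open>x i\<close> meets this level, and \<open>Z i\<close> agrees with \<open>K\<close>
        there.\<close>
      let ?O = "L \<inter> {y. y n \<in> - level n (preim K)}"
      have "closedin M (q ` ?O)"
        unfolding compactin_M_iff[symmetric] by (rule compactin_q) (intro closed_Int closed_L closed_coord, blast)
      moreover have "p \<notin> q ` ?O"
      proof
        assume "p \<in> q ` ?O"
        then obtain y where "y \<in> L" "y n \<notin> level n (preim K)" "p = q y" by blast
        moreover from this have "y \<in> preim K" using p by (simp add: preim_def)
        ultimately show False by blast
      qed
      ultimately have "openin M (topspace M - q ` ?O)" "p \<in> topspace M - q ` ?O"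
        using closedin_subset[OF K(1)] p by auto
      then have "\<forall>\<^sub>F i in sequentially. pn i \<in> topspace M - q ` ?O"
        using pn(2) unfolding limitin_def by blast
      then obtain N where N: "\<And>i. i \<ge> N \<Longrightarrow> pn i \<notin> q ` ?O" unfolding eventually_sequentially by blast
      have "\<bar>hausdist d (q ` Z i) (q ` preim K)\<bar> \<le> r / 2" if i: "i \<ge> max N n" for i
      proof -
        have "x i \<notin> ?O" using N[of i] x(2)[of i] i by auto
        then have "x i n \<in> level n (preim K)" using x(1) by blast
        then have lev: "level n (Z i) = level n (preim K)" using Z(4)[of n i] i by simp
        show ?thesis
          by (rule hausdist_le[OF d(1) ZL(2) preim_sub _ lev n]) (use Z(3) in blast)
      qed
      then have "norm (hausdist d (q ` Z i) K - 0) < r" if "i \<ge> max N n" for i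
        using that \<open>r > 0\<close> unfolding KQ by fastforce
      then show "\<exists>no. \<forall>n\<ge>no. norm (hausdist d (q ` Z n) K - 0) < r" by blast
    qed
  qed
qed

subsection \<open>End points\<close>

definition max_thread :: "(nat \<Rightarrow> nat) \<Rightarrow> bool" where
  "max_thread x \<longleftrightarrow> x \<in> L \<and> (\<forall>z. x \<sqsubseteq> z \<longrightarrow> z = x)"

text \<open>The segment may contain only the lower neighbour \<open>t\<close> of \<open>x\<close>.
  By \<open>E_above\<close> it then ends at \<open>t\<close> or at a thread above \<open>x\<close>,
  which is \<open>x\<close> by maximality; both represent the same point.\<close>

lemma max_thread_seg:
  assumes x: "max_thread x" and u: "u \<in> L" and p: "q x \<in> seg rt u"
  shows "q x = q u"
proof -
  obtain t where t: "t \<sqsubseteq> u" "q x = q t" using p unfolding seg_def by blast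
  have L: "x \<in> L" "t \<in> L" using x leD[OF t(1)] unfolding max_thread_def by auto
  have E: "(t, x) \<in> E" using q_eq_iff[OF L(2,1)] t(2) by simp
  show ?thesis
  proof (cases "t = x")
    case True
    then show ?thesis using t x unfolding max_thread_def by blast
  next
    case False
    then have tx: "t \<sqsubseteq> x" using E_comparable[OF E] x unfolding max_thread_def by blast
    have "u = t \<or> x \<sqsubseteq> u" by (rule E_above[OF E tx False t(1)])
    then show ?thesis using t(2) x unfolding max_thread_def by blast
  qed
qed

text \<open>An arc lies in the union of the segments from the root to its two ends, and on each of
  these \<open>q x\<close> can only be the upper end.\<close>

lemma max_thread_endpoint:
  assumes x: "max_thread x"
  shows "endpoint M (q x)"
  unfolding endpoint_def
proof (intro conjI allI impI)
  show "q x \<in> topspace M" using x unfolding max_thread_def topspace_M by blast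
  fix A g assume Ag: "arc_param M A g \<and> q x \<in> A"
  then have g: "arc_param M A g" by blast
  have "g 0 \<in> A" "g 1 \<in> A" using arc_paramD(4)[OF g] by auto
  then have "g 0 \<in> q ` L" "g 1 \<in> q ` L" using arc_paramD(1)[OF g] unfolding topspace_M by blast+
  then obtain u v where uv: "u \<in> L" "v \<in> L" "g 0 = q u" "g 1 = q v" by blast
  have ends: "q rt \<in> seg rt u" "q u \<in> seg rt u" "q rt \<in> seg rt v" "q v \<in> seg rt v"
    using seg_ends rt_le uv by blast+
  have "subcontinuum M (seg rt u \<union> seg rt v)"
    unfolding subcontinuum_iff
    by (intro conjI closedin_Un connectedin_Un seg_closed seg_connected rt_le uv) (use ends in blast)+
  then have "A \<subseteq> seg rt u \<union> seg rt v" by (rule arc_in_subcontinuum[OF g]) (use uv ends in auto)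
  then show "q x = g 0 \<or> q x = g 1" using max_thread_seg[OF x] uv Ag by auto
qed

lemma top_thread_ex:
  assumes x: "x \<in> L"
  obtains c where "top_thread c" "x \<sqsubseteq> c" "(x, c) \<in> E"
proof (cases "top_thread x")
  case True
  then show thesis using that le_refl'[OF x] E_refl[OF x] by blast
next
  case False
  then obtain c where c: "(x, c) \<in> E" "x \<sqsubseteq> c" "c \<noteq> x" using x unfolding top_thread_def by blast
  have "top_thread c" unfolding top_thread_def using no_E_chain[OF c(1,2)] c(3) leD(2)[OF c(2)] by blast
  then show thesis using that c by blast
qed

text \<open>Above a thread of greatest height in the compact up-set of \<open>z\<close> there are
  only threads of its own edge class, so the upper thread of that class is maximal.\<close>

lemma max_thread_above:
  assumes z: "z \<in> L"
  obtains c where "max_thread c" "z \<sqsubseteq> c"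
proof -
  have "{t. z \<sqsubseteq> t} = {t \<in> L. \<forall>m\<ge>0. t m \<in> {v. tle (F m) (z m) v}}" using z by (auto simp: le_def)
  then have "thread_closed {t. z \<sqsubseteq> t}" using thread_closedI[of 0 "\<lambda>m. {v. tle (F m) (z m) v}"] by simp
  then have "compact {t. z \<sqsubseteq> t}" "{t. z \<sqsubseteq> t} \<subseteq> L" using compact_thread unfolding thread_closed_iff by blast+
  moreover have "{t. z \<sqsubseteq> t} \<noteq> {}" using le_refl'[OF z] by blast
  ultimately obtain t where t: "z \<sqsubseteq> t" "\<And>t'. z \<sqsubseteq> t' \<Longrightarrow> H t' \<le> H t"
    using continuous_attains_sup[of "{t. z \<sqsubseteq> t}" H] continuous_on_subset[OF H(1)] by auto
  obtain c where c: "top_thread c" "t \<sqsubseteq> c" "(t, c) \<in> E" by (rule top_thread_ex[OF leD(2)[OF t(1)]])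
  have zc: "z \<sqsubseteq> c" by (rule le_trans'[OF t(1) c(2)])
  have "c' = c" if c': "c \<sqsubseteq> c'" for c'
  proof -
    have "H c' \<le> H c" using t(2)[OF le_trans'[OF zc c']] H(2)[OF c(3)] by simp
    then have "(c, c') \<in> E" using H(3,4)[OF c'] by simp
    then show ?thesis using c(1) c' unfolding top_thread_def by blast
  qed
  then show thesis using that[of c] zc leD(2)[OF zc] unfolding max_thread_def by blast
qed

lemma endpoints_dense: "M closure_of {p. endpoint M p} = topspace M"
  unfolding dense_intersects_open
proof (intro allI impI)
  fix T assume T: "openin M T \<and> T \<noteq> {}"
  then obtain x where x: "x \<in> L" "q x \<in> T" using openin_subset[of M T] unfolding topspace_M by blast
  have "openin (top_of_set L) {x \<in> L. q x \<in> T}" using T openin_M by blast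
  then obtain U where U: "open U" "{x \<in> L. q x \<in> T} = L \<inter> U" by (auto simp: openin_open)
  obtain n where n: "\<And>y. y \<in> L \<Longrightarrow> y n = x n \<Longrightarrow> y \<in> U"
    by (rule cylinder_nhd[OF U(1) _ x(1)]) (use U(2) x in auto)
  obtain z where z: "z \<in> L" "\<And>z'. z \<sqsubseteq> z' \<Longrightarrow> z' n = x n" using leaf_thread[OF LD(1)[OF x(1)]] by metis
  obtain c where c: "max_thread c" "z \<sqsubseteq> c" by (rule max_thread_above[OF z(1)])
  have "q c \<in> T" using n[OF leD(2)[OF c(2)] z(2)[OF c(2)]] U(2) leD(2)[OF c(2)] by blast
  then show "{p. endpoint M p} \<inter> T \<noteq> {}" using max_thread_endpoint[OF c(1)] by blast
qed

subsection \<open>Ramification points\<close>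

lemma branches_off_mono:
  assumes "branches_off x y n' z" "n \<le> n'" "x \<in> L"
  shows "branches_off x y n z"
proof -
  obtain m where m: "m \<ge> n'" "\<And>t. tle (F m) t (y m) \<Longrightarrow> tle (F m) t (z m) \<Longrightarrow> tle (F n') (bnd n' m t) (x n')"
    using assms(1) unfolding branches_off_def by blast
  have "tle (F n) (bnd n m t) (x n)" if "tle (F m) t (y m)" "tle (F m) t (z m)" for t
    using tmorD(6)[OF tm_bnd[OF assms(2)] m(2)[OF that]] bond_bond[OF assms(2) m(1)] L_bnd[OF assms(3,2)] by simp
  then show ?thesis unfolding branches_off_def using m(1) assms(2) by (intro exI[of _ m]) auto
qed

text \<open>The threads branching off at \<open>x\<close> from each of finitely many given ones form a residual set.\<close>

lemma branching_thread_ex: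
  assumes x: "top_thread x" and W: "finite W" "\<And>w. w \<in> W \<Longrightarrow> x \<sqsubseteq> w \<and> w \<noteq> x" "W \<noteq> {}"
  shows "\<exists>z. x \<sqsubseteq> z \<and> z \<noteq> x \<and> (\<forall>w\<in>W. \<forall>t. t \<sqsubseteq> w \<longrightarrow> t \<sqsubseteq> z \<longrightarrow> t \<sqsubseteq> x)"
proof -
  have xL: "x \<in> L" using x unfolding top_thread_def by blast
  let ?S = "{t. x \<sqsubseteq> t}"
  have SL: "?S \<subseteq> L" using leD by blast
  have "?S = {t \<in> L. \<forall>m\<ge>0. t m \<in> {v. tle (F m) (x m) v}}" using xL by (auto simp: le_def)
  then have "thread_closed ?S" using thread_closedI[of 0 "\<lambda>m. {v. tle (F m) (x m) v}"] by simp
  then have compS: "compact ?S" using compact_thread unfolding thread_closed_iff by blast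
  let ?X = "top_of_set ?S"
  define D where "D w n = {z \<in> ?S. branches_off x w n z}" for w n
  let ?G = "(\<lambda>(w, n). D w n) ` {(w, n). w \<in> W \<and> x n \<noteq> w n}"
  have "?X closure_of \<Inter>?G = topspace ?X"
  proof (rule Baire_category)
    have "compact_space ?X" using compS by (simp add: compact_space_subtopology)
    moreover have "Hausdorff_space ?X"
      by (rule Hausdorff_space_subtopology[OF Hausdorff_nat_fun])
    ultimately show "completely_metrizable_space ?X \<or> locally_compact_space ?X \<and> regular_space ?X"
      using compact_imp_locally_compact_space compact_Hausdorff_imp_regular_space by blast
    show "countable ?G"
      using W(1) by (intro countable_image countable_subset[of "{(w, n). w \<in> W \<and> x n \<noteq> w n}" "W \<times> UNIV"] countable_SIGMA) (auto simp: countable_finite)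
    fix T assume "T \<in> ?G"
    then obtain w n where wn: "w \<in> W" "x n \<noteq> w n" "T = D w n" by auto
    have xw: "x \<sqsubseteq> w" and wL: "w \<in> L" using W(2)[OF wn(1)] leD by blast+
    have "D w n = ?S \<inter> (\<Union>m\<in>{n..}. {z. z m \<in> {v. \<forall>t. tle (F m) t (w m) \<longrightarrow> tle (F m) t v \<longrightarrow> tle (F n) (bnd n m t) (x n)}})"
      unfolding D_def branches_off_def by auto
    moreover have "open (\<Union>m\<in>{n..}. {z. z m \<in> {v. \<forall>t. tle (F m) t (w m) \<longrightarrow> tle (F m) t v \<longrightarrow> tle (F n) (bnd n m t) (x n)}})"
      by (intro open_UN ballI open_coord)
    ultimately have "openin ?X (D w n)" by (simp only: openin_open_Int)
    moreover have "?X closure_of (D w n) = topspace ?X"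
      unfolding dense_intersects_open
    proof (intro allI impI)
      fix T assume T: "openin ?X T \<and> T \<noteq> {}"
      then obtain U where U: "open U" "T = ?S \<inter> U" by (auto simp: openin_open)
      then obtain z where z: "x \<sqsubseteq> z" "z \<in> U" using T by blast
      obtain k where k: "\<And>y. y \<in> L \<Longrightarrow> y k = z k \<Longrightarrow> y \<in> U"
        using cylinder_nhd[OF U(1) z(2) leD(2)[OF z(1)]] by blast
      \<comment> \<open>Working at level \<open>max n k\<close> keeps the new thread in the given
        cylinder at level \<open>k\<close>.\<close>
      have "x (max n k) \<noteq> w (max n k)" by (rule L_neq_up[OF xL wL _ wn(2)]) simp
      then obtain z' where z': "x \<sqsubseteq> z'" "z' (max n k) = z (max n k)" "branches_off x w (max n k) z'"
        by (rule branches_off_dense[OF x xw z(1)])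
      have "z' k = z k" using L_eq_down[OF leD(2)[OF z'(1)] leD(2)[OF z(1)] _ z'(2), of k] by simp
      then have "z' \<in> T" using k[OF leD(2)[OF z'(1)]] U(2) z'(1) by blast
      moreover have "z' \<in> D w n" unfolding D_def using branches_off_mono[OF z'(3) _ xL] z'(1) by simp
      ultimately show "D w n \<inter> T \<noteq> {}" by blast
    qed
    ultimately show "openin ?X T \<and> ?X closure_of T = topspace ?X" using wn(3) by simp
  qed
  then have dense: "\<And>T. openin ?X T \<Longrightarrow> T \<noteq> {} \<Longrightarrow> \<Inter>?G \<inter> T \<noteq> {}"
    unfolding dense_intersects_open by blast
  \<comment> \<open>The thread \<open>x\<close> itself belongs to all the sets \<open>D w n\<close>;
    prescribing the coordinate \<open>y k\<close>, different from \<open>x k\<close>, excludes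
    it.\<close>
  obtain y where y: "y \<in> W" using W(3) by blast
  then obtain k where k: "x k \<noteq> y k" using W(2) by (metis ext)
  have "openin ?X (?S \<inter> {z. z k \<in> {y k}})" by (rule openin_open_Int[OF open_coord])
  moreover have "?S \<inter> {z. z k \<in> {y k}} \<noteq> {}" using W(2)[OF y] by blast
  ultimately have "\<Inter>?G \<inter> (?S \<inter> {z. z k \<in> {y k}}) \<noteq> {}" by (rule dense)
  then obtain z where z: "z \<in> \<Inter>?G" "x \<sqsubseteq> z" "z k = y k" by blast
  have "t \<sqsubseteq> x" if w: "w \<in> W" and t: "t \<sqsubseteq> w" "t \<sqsubseteq> z" for w t
  proof -
    obtain n0 where n0: "x n0 \<noteq> w n0" using W(2)[OF w] by (metis ext)
    have wL: "w \<in> L" using W(2)[OF w] leD by blast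
    have "branches_off x w n z" if "n \<ge> n0" for n
    proof -
      have "x n \<noteq> w n" by (rule L_neq_up[OF xL wL that n0])
      then have "D w n \<in> ?G" using w by (intro image_eqI[of _ _ "(w, n)"]) auto
      then show ?thesis using z(1) unfolding D_def by blast
    qed
    then show ?thesis by (rule branches_off_meet[OF xL _ t])
  qed
  moreover have "z \<noteq> x" using z(3) k by auto
  ultimately show ?thesis using z(2) by (intro exI[of _ z] conjI ballI allI impI)
qed

text \<open>A common point comes from two adjacent threads. These are comparable, and the lower one
  is a common lower bound of \<open>y\<close> and \<open>z\<close>, hence equal to
  \<open>x\<close>.\<close>

lemma seg_Int:
  assumes m: "\<And>t. t \<sqsubseteq> y \<Longrightarrow> t \<sqsubseteq> z \<Longrightarrow> t \<sqsubseteq> x" and xy: "x \<sqsubseteq> y" "x \<sqsubseteq> z"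
  shows "seg x y \<inter> seg x z = {q x}"
proof -
  have "p = q x" if p: "p \<in> seg x y" "p \<in> seg x z" for p
  proof -
    obtain t t' where t: "x \<sqsubseteq> t" "t \<sqsubseteq> y" "p = q t" "x \<sqsubseteq> t'" "t' \<sqsubseteq> z" "p = q t'"
      using p unfolding seg_def by blast
    then have "(t, t') \<in> E" using q_eq_iff leD by metis
    then have "t \<sqsubseteq> t' \<or> t' \<sqsubseteq> t" by (rule E_comparable)
    then have "t \<sqsubseteq> x \<or> t' \<sqsubseteq> x" using m le_trans' t by metis
    then have "t = x \<or> t' = x" using le_antisym' t by blast
    then show ?thesis using t by blast
  qed
  then show ?thesis using seg_ends(1) xy by blast
qed

lemma ramification:
  assumes x: "top_thread x" and y: "x \<sqsubseteq> y" "y \<noteq> x"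
  shows "ramification_point M (q x)"
proof -
  obtain z1 where z1: "x \<sqsubseteq> z1" "z1 \<noteq> x" "\<And>t. t \<sqsubseteq> y \<Longrightarrow> t \<sqsubseteq> z1 \<Longrightarrow> t \<sqsubseteq> x"
  proof -
    have "\<exists>z. x \<sqsubseteq> z \<and> z \<noteq> x \<and> (\<forall>w\<in>{y}. \<forall>t. t \<sqsubseteq> w \<longrightarrow> t \<sqsubseteq> z \<longrightarrow> t \<sqsubseteq> x)"
      by (rule branching_thread_ex[OF x]) (use y in auto)
    then show thesis using that by blast
  qed
  obtain z2 where z2: "x \<sqsubseteq> z2" "z2 \<noteq> x" "\<And>t. t \<sqsubseteq> y \<Longrightarrow> t \<sqsubseteq> z2 \<Longrightarrow> t \<sqsubseteq> x" "\<And>t. t \<sqsubseteq> z1 \<Longrightarrow> t \<sqsubseteq> z2 \<Longrightarrow> t \<sqsubseteq> x"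
  proof -
    have "\<exists>z. x \<sqsubseteq> z \<and> z \<noteq> x \<and> (\<forall>w\<in>{y, z1}. \<forall>t. t \<sqsubseteq> w \<longrightarrow> t \<sqsubseteq> z \<longrightarrow> t \<sqsubseteq> x)"
      by (rule branching_thread_ex[OF x]) (use y z1(1,2) in auto)
    then show thesis using that by blast
  qed
  have arc: "is_arc M (seg x w)" if w: "x \<sqsubseteq> w" "w \<noteq> x" for w
  proof -
    have "(x, w) \<notin> E" using x w unfolding top_thread_def by blast
    then have "q x \<noteq> q w" using q_eq_iff leD[OF w(1)] by blast
    then show ?thesis using seg_arc[OF w(1)] unfolding is_arc_def by metis
  qed
  have "q x \<in> topspace M" using leD[OF y(1)] unfolding topspace_M by blast
  then show ?thesis
    unfolding ramification_point_def
    by (intro conjI exI[of _ "seg x y"] exI[of _ "seg x z1"] exI[of _ "seg x z2"] arc y z1(1,2) z2(1,2)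
        seg_Int[OF z1(3) y(1) z1(1)] seg_Int[OF z2(3) y(1) z2(1)] seg_Int[OF z2(4) z1(1) z2(1)])
qed

lemma endpoint_or_ramification:
  assumes "p \<in> topspace M"
  shows "endpoint M p \<or> ramification_point M p"
proof -
  obtain x0 where x0: "x0 \<in> L" "p = q x0" using assms unfolding topspace_M by blast
  obtain x where x: "top_thread x" "x0 \<sqsubseteq> x" "(x0, x) \<in> E" by (rule top_thread_ex[OF x0(1)])
  have p: "p = q x" using x0 x q_eq_iff leD by blast
  show ?thesis
  proof (cases "max_thread x")
    case True
    then show ?thesis using max_thread_endpoint p by blast
  next
    case False
    then obtain y where "x \<sqsubseteq> y" "y \<noteq> x" using leD(2)[OF x(2)] unfolding max_thread_def by blast
    then show ?thesis using ramification[OF x(1)] p by blast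
  qed
qed

end

theorem theorem8p30:
  fixes F :: "nat \<Rightarrow> rtree" and \<alpha> :: "nat \<Rightarrow> nat \<Rightarrow> nat"
  assumes "is_TC_limit F \<alpha>"
  shows "trans (lim_edges F \<alpha>)
    \<and> dendroid (realization F \<alpha>)
    \<and> kelley (realization F \<alpha>)
    \<and> smooth_dendroid (realization F \<alpha>)
    \<and> (realization F \<alpha>) closure_of {p. endpoint (realization F \<alpha>) p} = topspace (realization F \<alpha>)
    \<and> (\<forall>p\<in>topspace (realization F \<alpha>).
          endpoint (realization F \<alpha>) p \<or> ramification_point (realization F \<alpha>) p)"
proof -
  interpret tc_limit F \<alpha> by (rule tc_limit.intro[OF assms])
  show ?thesis
    using E_trans dendroid_M kelley_M smooth_M endpoints_dense endpoint_or_ramification by blast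
qed


end
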